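(* Given $\alpha > 0$ and a multi-set $X$ of size $n$, we can decide whether $X$ has an $\alpha$-almost divisor, and compute an $\alpha$-almost divisor if it exists, in time $\widetilde{O}(n + \sqrt{\max(X)})$.
   Context: For a finite non-empty multi-set $X$ of positive integers: $|X|$ is the number of elements counted with multiplicity, $\max(X)$ its maximum element, $\mu_X$ the largest multiplicity of any number in $X$, and $\Sigma(X)$ the sum of all elements (with multiplicity). For an integer $d$, $X(d) := X\cap d\mathbb{Z}$ and $\overline{X(d)} := X\setminus X(d)$. An integer $d>1$ is an $\alpha$-almost divisor of $X$ if $|\overline{X(d)}| \le \alpha\cdot\mu_X\cdot\Sigma(X)/|X|^2$. $\widetilde{O}$ hides polylogarithmic factors. *)

theory Defs
  imports Complex_Main "HOL-Library.Multiset" "HOL-Library.Log_Nat"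
begin

section \<open>Almost divisors of multisets\<close>

definition max_mult :: "'a multiset \<Rightarrow> nat" where
  "max_mult X = Max (count X ` set_mset X)"

definition multiples :: "nat multiset \<Rightarrow> nat \<Rightarrow> nat multiset" where
  "multiples X d = filter_mset (\<lambda>x. d dvd x) X"

definition nonmultiples :: "nat multiset \<Rightarrow> nat \<Rightarrow> nat multiset" where
  "nonmultiples X d = X - multiples X d"

definition almost_divisor :: "real \<Rightarrow> nat multiset \<Rightarrow> nat \<Rightarrow> bool" where
  "almost_divisor \<alpha> X d \<longleftrightarrow>
     d > 1 \<and>
     real (size (nonmultiples X d))
       \<le> \<alpha> * real (max_mult X) * real (sum_mset X) / (real (size X))\<^sup>2"


section \<open>A random access machine with logarithmic cost\<close>

text \<open>
  Programs are while programs over registers and arrays of natural numbers, with indirect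
  addressing. A program mentions only finitely many registers and arrays, so the arrays amount to
  one random access memory with interleaved address spaces. Integers are not bounded in size;
  instead every access and operation is charged by the bit lengths of the values and addresses
  involved.

  The parameter \<open>\<alpha>\<close> is a real number and hence cannot be stored in a register. As with a
  real input on a real RAM, a program sees it through comparisons: \<open>Scaled a b\<close> tests
  \<open>a \<le> \<alpha> * b\<close>.
\<close>

record state =
  reg :: "nat \<Rightarrow> nat"
  arr :: "nat \<Rightarrow> nat \<Rightarrow> nat"

datatype binop = Add | Sub | Mul | Div | Mod

datatype aexp =
    Num nat
  | Reg nat
  | Arr nat aexp
  | Bin binop aexp aexp

datatype bexp =
    Less aexp aexp
  | Scaled aexp aexp
  | Neg bexp
  | Conj bexp bexp

datatype com =
    Skip
  | Assign nat aexp
  | Store nat aexp aexp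
  | Seq com com
  | Cond bexp com com
  | While bexp com

fun binop_val :: "binop \<Rightarrow> nat \<Rightarrow> nat \<Rightarrow> nat" where
  "binop_val Add x y = x + y"
| "binop_val Sub x y = x - y"
| "binop_val Mul x y = x * y"
| "binop_val Div x y = x div y"
| "binop_val Mod x y = x mod y"

fun aval :: "state \<Rightarrow> aexp \<Rightarrow> nat" where
  "aval s (Num k) = k"
| "aval s (Reg r) = reg s r"
| "aval s (Arr A e) = arr s A (aval s e)"
| "aval s (Bin f a b) = binop_val f (aval s a) (aval s b)"

fun bval :: "real \<Rightarrow> state \<Rightarrow> bexp \<Rightarrow> bool" where
  "bval \<alpha> s (Less a b) \<longleftrightarrow> aval s a < aval s b"
| "bval \<alpha> s (Scaled a b) \<longleftrightarrow> real (aval s a) \<le> \<alpha> * real (aval s b)"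
| "bval \<alpha> s (Neg b) \<longleftrightarrow> \<not> bval \<alpha> s b"
| "bval \<alpha> s (Conj b c) \<longleftrightarrow> bval \<alpha> s b \<and> bval \<alpha> s c"

abbreviation bitlen :: "nat \<Rightarrow> nat" where
  "bitlen k \<equiv> floorlog 2 k"

text \<open>
  An operation on operands of total bit length \<open>l\<close> is charged about \<open>l * log l\<close>. This is the bit
  complexity, up to constant factors, of multiplying and dividing \<open>l\<close>-bit integers, and an
  overestimate for the other operations, so no operation is cheaper than what a word RAM or a
  multitape Turing machine achieves on integers stored in binary.
\<close>

definition op_cost :: "nat \<Rightarrow> nat \<Rightarrow> nat" where
  "op_cost x y = (let l = bitlen x + bitlen y + 1 in l * bitlen l)"

fun acost :: "state \<Rightarrow> aexp \<Rightarrow> nat" where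
  "acost s (Num k) = bitlen k + 1"
| "acost s (Reg r) = bitlen (reg s r) + 1"
| "acost s (Arr A e) = acost s e + bitlen (aval s e) + bitlen (arr s A (aval s e)) + 1"
| "acost s (Bin f a b) = acost s a + acost s b + op_cost (aval s a) (aval s b)"

fun bcost :: "state \<Rightarrow> bexp \<Rightarrow> nat" where
  "bcost s (Less a b) = acost s a + acost s b + op_cost (aval s a) (aval s b)"
| "bcost s (Scaled a b) = acost s a + acost s b + op_cost (aval s a) (aval s b)"
| "bcost s (Neg b) = bcost s b + 1"
| "bcost s (Conj b c) = bcost s b + bcost s c + 1"

text \<open>\<open>exec \<alpha> c s t s'\<close>: started in \<open>s\<close>, the program \<open>c\<close> halts in \<open>s'\<close> with total cost \<open>t\<close>.\<close>

inductive exec :: "real \<Rightarrow> com \<Rightarrow> state \<Rightarrow> nat \<Rightarrow> state \<Rightarrow> bool" for \<alpha> :: real where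
  Skip: "exec \<alpha> Skip s 1 s"
| Assign: "exec \<alpha> (Assign r e) s (acost s e + bitlen (aval s e) + 1)
             (s\<lparr>reg := (reg s)(r := aval s e)\<rparr>)"
| Store: "exec \<alpha> (Store A i e) s
             (acost s i + acost s e + bitlen (aval s i) + bitlen (aval s e) + 1)
             (s\<lparr>arr := (arr s)(A := (arr s A)(aval s i := aval s e))\<rparr>)"
| Seq: "\<lbrakk>exec \<alpha> c s t s'; exec \<alpha> d s' u s''\<rbrakk> \<Longrightarrow> exec \<alpha> (Seq c d) s (t + u) s''"
| CondTrue: "\<lbrakk>bval \<alpha> s b; exec \<alpha> c s t s'\<rbrakk> \<Longrightarrow> exec \<alpha> (Cond b c d) s (bcost s b + t + 1) s'"
| CondFalse: "\<lbrakk>\<not> bval \<alpha> s b; exec \<alpha> d s t s'\<rbrakk> \<Longrightarrow> exec \<alpha> (Cond b c d) s (bcost s b + t + 1) s'"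
| WhileFalse: "\<not> bval \<alpha> s b \<Longrightarrow> exec \<alpha> (While b c) s (bcost s b + 1) s"
| WhileTrue: "\<lbrakk>bval \<alpha> s b; exec \<alpha> c s t s'; exec \<alpha> (While b c) s' u s''\<rbrakk>
               \<Longrightarrow> exec \<alpha> (While b c) s (bcost s b + 1 + t + u) s''"

inductive_cases exec_SkipE: "exec \<alpha> Skip s t s'"
inductive_cases exec_AssignE: "exec \<alpha> (Assign r e) s t s'"
inductive_cases exec_StoreE: "exec \<alpha> (Store A i e) s t s'"
inductive_cases exec_SeqE: "exec \<alpha> (Seq c d) s t s'"
inductive_cases exec_CondE: "exec \<alpha> (Cond b c d) s t s'"
inductive_cases exec_WhileE: "exec \<alpha> (While b c) s t s'"

lemma exec_deterministic:
  assumes "exec \<alpha> c s t s'" and "exec \<alpha> c s u s''"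
  shows "t = u \<and> s' = s''"
  using assms
proof (induction arbitrary: u s'' rule: exec.induct)
  case (Skip s)
  then show ?case by (auto elim: exec_SkipE)
next
  case (Assign r e s)
  then show ?case by (auto elim: exec_AssignE)
next
  case (Store A i e s)
  then show ?case by (auto elim: exec_StoreE)
next
  case (Seq c s t s' d u s'' v r)
  from Seq.prems obtain v1 v2 r1
    where *: "v = v1 + v2" "exec \<alpha> c s v1 r1" "exec \<alpha> d r1 v2 r"
    by (rule exec_SeqE)
  from Seq.IH(1)[OF *(2)] have "t = v1" "s' = r1" by auto
  with Seq.IH(2) * show ?case by auto
next
  case (CondTrue s b c t s' d v r)
  from CondTrue.prems CondTrue.hyps(1) obtain v1
    where *: "v = bcost s b + v1 + 1" "exec \<alpha> c s v1 r"
    by (auto elim: exec_CondE)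
  from CondTrue.IH[OF *(2)] * show ?case by simp
next
  case (CondFalse s b d t s' c v r)
  from CondFalse.prems CondFalse.hyps(1) obtain v1
    where *: "v = bcost s b + v1 + 1" "exec \<alpha> d s v1 r"
    by (auto elim: exec_CondE)
  from CondFalse.IH[OF *(2)] * show ?case by simp
next
  case (WhileFalse s b c v r)
  then show ?case by (auto elim: exec_WhileE)
next
  case (WhileTrue s b c t s' u s'' v r)
  from WhileTrue.prems WhileTrue.hyps(1) obtain v1 v2 r1
    where *: "v = bcost s b + 1 + v1 + v2" "exec \<alpha> c s v1 r1" "exec \<alpha> (While b c) r1 v2 r"
    by (auto elim: exec_WhileE)
  from WhileTrue.IH(1)[OF *(2)] have "t = v1" "s' = r1" by auto
  with WhileTrue.IH(2) * show ?case by auto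
qed

text \<open>
  Input: array 0 lists the elements with multiplicity, in any order, and register 0 holds their
  number. Output: register 0 holds the decision bit and, if it is 1, register 1 the divisor.
\<close>

definition input_state :: "nat list \<Rightarrow> state" where
  "input_state xs =
     \<lparr>reg = (\<lambda>r. if r = 0 then length xs else 0),
      arr = (\<lambda>A i. if A = 0 \<and> i < length xs then xs ! i else 0)\<rparr>"

definition finds_almost_divisor :: "real \<Rightarrow> nat multiset \<Rightarrow> state \<Rightarrow> bool" where
  "finds_almost_divisor \<alpha> X s \<longleftrightarrow>
     (if \<exists>d. almost_divisor \<alpha> X d
      then reg s 0 = 1 \<and> almost_divisor \<alpha> X (reg s 1)
      else reg s 0 = 0)"

end

theory Submission
  imports Defs "HOL-Computational_Algebra.Primes"
begin

text \<open>
  Replacing \<open>d\<close> by a prime factor only adds multiples, so it suffices to find a prime that divides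
  the most elements. Let \<open>S\<close> be the ceiling of \<open>sqrt (max X)\<close>. For each binary digit position
  \<open>j\<close>, let \<open>Q\<close> be the product of the primes up to \<open>S\<close> whose \<open>j\<close>-th digit is 1, and split every
  list entry \<open>y\<close> into \<open>gcd y Q\<close> and the part of \<open>y\<close> coprime to \<open>Q\<close>. A prime divides as many
  entries after the split as before. After all digits have been used, two distinct primes up to \<open>S\<close>
  have been separated, no such prime divides an entry twice, and an entry, being at most \<open>S\<^sup>2\<close>, has
  at most one prime factor above \<open>S\<close>; so every entry is 1 or prime and the entries can be counted.

  All residues of \<open>Q\<close> modulo the entries are computed at once by a product tree and a remainder
  tree on long integers. This takes almost linear time because the machine multiplies and divides
  long integers in almost linear time.
\<close>

section \<open>Cost-bounded execution\<close>

text \<open>Dividing every element by every prime up to \<open>S\<close> would cost the product of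
  \<open>n\<close> and the square root of the maximum, while only their sum is allowed. So all
  entries must meet all primes at once, inside products of primes. One gcd with the product of all
  primes up to \<open>S\<close> would not tell these primes apart. Binary digits do, with only
  logarithmically many products: distinct numbers differ in some digit. It also matters that every
  prime has some digit 1, for in that round the gcd with the squarefree \<open>Q\<close> strips its
  repetitions; this loses nothing, since only divisibility is counted. Splitting lengthens the list,
  but a logarithmic weight keeps it below \<open>n * bitlen M\<close> entries, where
  \<open>M\<close> is the maximum. The long integers stay affordable because a node with index
  \<open>i\<close> in a tree has bit length at most about \<open>1 / i\<close> of the whole, so a
  tree has harmonic total size. Numbers outside the trees are bounded by one polynomial
  \<open>V\<close> in \<open>n + S\<close>, which enters the cost only through
  \<open>bitlen V\<close>.\<close>

definition runs :: "real \<Rightarrow> com \<Rightarrow> state \<Rightarrow> nat \<Rightarrow> (state \<Rightarrow> bool) \<Rightarrow> bool" where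
  "runs \<alpha> c s T Q \<longleftrightarrow> (\<exists>t s'. exec \<alpha> c s t s' \<and> t \<le> T \<and> Q s')"

fun wregs :: "com \<Rightarrow> nat set" where
  "wregs Skip = {}"
| "wregs (Assign r e) = {r}"
| "wregs (Store A i e) = {}"
| "wregs (Seq c d) = wregs c \<union> wregs d"
| "wregs (Cond b c d) = wregs c \<union> wregs d"
| "wregs (While b c) = wregs c"

fun warrs :: "com \<Rightarrow> nat set" where
  "warrs Skip = {}"
| "warrs (Assign r e) = {}"
| "warrs (Store A i e) = {A}"
| "warrs (Seq c d) = warrs c \<union> warrs d"
| "warrs (Cond b c d) = warrs c \<union> warrs d"
| "warrs (While b c) = warrs c"

text \<open>Postconditions state only what a command establishes. What it leaves alone is read off
  the syntax once and for all in \<open>exec_frame\<close>, and \<open>runs_mono\<close>,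
  \<open>runs_seq\<close> and the loop rules hand this fact to their premises.\<close>

definition frame :: "com \<Rightarrow> state \<Rightarrow> state \<Rightarrow> bool" where
  "frame c s s' \<longleftrightarrow>
     (\<forall>r. r \<notin> wregs c \<longrightarrow> reg s' r = reg s r) \<and> (\<forall>A. A \<notin> warrs c \<longrightarrow> arr s' A = arr s A)"

lemma frame_reg: "frame c s s' \<Longrightarrow> r \<notin> wregs c \<Longrightarrow> reg s' r = reg s r"
  and frame_arr: "frame c s s' \<Longrightarrow> A \<notin> warrs c \<Longrightarrow> arr s' A = arr s A"
  by (auto simp: frame_def)

lemma frame_refl: "frame c s s"
  by (simp add: frame_def)

lemma frame_trans: "frame c s s' \<Longrightarrow> frame c s' s'' \<Longrightarrow> frame c s s''"
  by (simp add: frame_def)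

lemma frame_mono:
  "frame c s s' \<Longrightarrow> wregs c \<subseteq> wregs d \<Longrightarrow> warrs c \<subseteq> warrs d \<Longrightarrow> frame d s s'"
  by (auto simp: frame_def)

lemma exec_frame: "exec \<alpha> c s t s' \<Longrightarrow> frame c s s'"
  by (induction rule: exec.induct) (auto simp: frame_def)

lemma runs_mono:
  assumes "runs \<alpha> c s T P" "T \<le> U" "\<And>s'. P s' \<Longrightarrow> frame c s s' \<Longrightarrow> Q s'"
  shows "runs \<alpha> c s U Q"
  using assms exec_frame unfolding runs_def by (meson order_trans)

lemma runs_seq:
  assumes "runs \<alpha> c s T P"
    and "\<And>s'. P s' \<Longrightarrow> frame c s s' \<Longrightarrow> runs \<alpha> d s' U Q"
  shows "runs \<alpha> (Seq c d) s (T + U) Q"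
proof -
  obtain t s' where 1: "exec \<alpha> c s t s'" "t \<le> T" "P s'"
    using assms(1) by (auto simp: runs_def)
  obtain u s'' where 2: "exec \<alpha> d s' u s''" "u \<le> U" "Q s''"
    using assms(2)[OF 1(3) exec_frame[OF 1(1)]] by (auto simp: runs_def)
  show ?thesis
    unfolding runs_def using exec.Seq[OF 1(1) 2(1)] 1(2) 2(2,3) by (meson add_mono)
qed

lemma runs_cond:
  assumes "bcost s b \<le> B"
    and "bval \<alpha> s b \<Longrightarrow> runs \<alpha> c s T Q" and "\<not> bval \<alpha> s b \<Longrightarrow> runs \<alpha> d s T Q"
  shows "runs \<alpha> (Cond b c d) s (B + T + 1) Q"
proof (cases "bval \<alpha> s b")
  case True
  then obtain t s' where "exec \<alpha> c s t s'" "t \<le> T" "Q s'"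
    using assms(2) by (auto simp: runs_def)
  then show ?thesis
    unfolding runs_def using exec.CondTrue[OF True] assms(1) by (meson add_mono order_refl)
next
  case False
  then obtain t s' where "exec \<alpha> d s t s'" "t \<le> T" "Q s'"
    using assms(3) by (auto simp: runs_def)
  then show ?thesis
    unfolding runs_def using exec.CondFalse[OF False] assms(1) by (meson add_mono order_refl)
qed

text \<open>For loops whose number of rounds is known. The cost may vary with the round: in the
  trees and in the sieve it behaves like \<open>D div i\<close> for the index \<open>i\<close> being
  treated, and only the sum over all rounds is almost linear.\<close>

lemma runs_for:
  assumes I0: "I 0 s0"
    and step: "\<And>k s. \<lbrakk>k < m; I k s; frame (While b c) s0 s\<rbrakk>
      \<Longrightarrow> bval \<alpha> s b \<and> bcost s b \<le> B \<and> runs \<alpha> c s (\<tau> k) (I (Suc k))"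
    and fin: "\<And>s. \<lbrakk>I m s; frame (While b c) s0 s\<rbrakk> \<Longrightarrow> \<not> bval \<alpha> s b \<and> bcost s b \<le> B"
  shows "runs \<alpha> (While b c) s0 ((\<Sum>k<m. \<tau> k + B + 1) + B + 1) (I m)"
proof -
  \<comment> \<open>Induction on the number \<open>j\<close> of rounds still to come, since
    \<open>WhileTrue\<close> unfolds a loop at its front.\<close>
  have "runs \<alpha> (While b c) s ((\<Sum>k=m-j..<m. \<tau> k + B + 1) + B + 1) (I m)"
    if "j \<le> m" "I (m - j) s" "frame (While b c) s0 s" for j s
    using that
  proof (induction j arbitrary: s)
    case 0
    then have *: "\<not> bval \<alpha> s b" "bcost s b \<le> B" using fin by auto
    show ?case
      unfolding runs_def using exec.WhileFalse[OF *(1)] *(2) 0 by fastforce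
  next
    case (Suc j)
    let ?k = "m - Suc j"
    have k: "?k < m" "Suc ?k = m - j" using Suc.prems(1) by auto
    from step[OF k(1) Suc.prems(2,3)] obtain t s'
      where b: "bval \<alpha> s b" "bcost s b \<le> B" and e: "exec \<alpha> c s t s'" "t \<le> \<tau> ?k" "I (m - j) s'"
      unfolding runs_def k(2) by blast
    have "frame (While b c) s s'" using exec_frame[OF e(1)] by (rule frame_mono) auto
    then have "frame (While b c) s0 s'" using Suc.prems(3) frame_trans by blast
    then obtain u s'' where u: "exec \<alpha> (While b c) s' u s''"
      "u \<le> (\<Sum>k=m-j..<m. \<tau> k + B + 1) + B + 1" "I m s''"
      using Suc.IH[of s'] e(3) Suc.prems(1) by (auto simp: runs_def)
    have "(\<Sum>k=?k..<m. \<tau> k + B + 1) = (\<tau> ?k + B + 1) + (\<Sum>k=m-j..<m. \<tau> k + B + 1)"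
      using sum.atLeast_Suc_lessThan[OF k(1), of "\<lambda>k. \<tau> k + B + 1"] k(2) by simp
    then have "bcost s b + 1 + t + u \<le> (\<Sum>k=?k..<m. \<tau> k + B + 1) + B + 1"
      using u(2) e(2) b(2) by linarith
    then show ?case
      unfolding runs_def using exec.WhileTrue[OF b(1) e(1) u(1)] u(3) by blast
  qed
  from this[of m s0] show ?thesis using I0 frame_refl by (simp add: atLeast0LessThan)
qed

text \<open>For a loop whose number of rounds is not known beforehand, which is the case in
  \<open>euclid\<close>: the measure \<open>v\<close> bounds the rounds, and each round is charged
  the same.\<close>

lemma runs_while:
  fixes v :: "state \<Rightarrow> nat"
  assumes I0: "I s0"
    and step: "\<And>s. \<lbrakk>I s; frame (While b c) s0 s; bval \<alpha> s b\<rbrakk>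
      \<Longrightarrow> runs \<alpha> c s T (\<lambda>s'. I s' \<and> v s' < v s)"
    and cost: "\<And>s. \<lbrakk>I s; frame (While b c) s0 s\<rbrakk> \<Longrightarrow> bcost s b \<le> B"
  shows "runs \<alpha> (While b c) s0 ((v s0 + 1) * (T + B + 1)) (\<lambda>s. I s \<and> \<not> bval \<alpha> s b)"
proof -
  have "runs \<alpha> (While b c) s ((v s + 1) * (T + B + 1)) (\<lambda>s. I s \<and> \<not> bval \<alpha> s b)"
    if "I s" "frame (While b c) s0 s" for s
    using that
  proof (induction "v s" arbitrary: s rule: less_induct)
    case less
    show ?case
    proof (cases "bval \<alpha> s b")
      case False
      have "bcost s b + 1 \<le> (v s + 1) * (T + B + 1)"
        using cost[OF less.prems] by (simp add: algebra_simps)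
      then show ?thesis
        unfolding runs_def using exec.WhileFalse[OF False] False less.prems(1) by blast
    next
      case True
      from step[OF less.prems True] obtain t s'
        where e: "exec \<alpha> c s t s'" "t \<le> T" "I s'" "v s' < v s" by (auto simp: runs_def)
      have "frame (While b c) s s'" using exec_frame[OF e(1)] by (rule frame_mono) auto
      then have "frame (While b c) s0 s'" using less.prems(2) frame_trans by blast
      then obtain u s'' where u: "exec \<alpha> (While b c) s' u s''"
        "u \<le> (v s' + 1) * (T + B + 1)" "I s''" "\<not> bval \<alpha> s'' b"
        using less.hyps[OF e(4) e(3)] by (auto simp: runs_def)
      have "u \<le> v s * (T + B + 1)"
        using u(2) e(4) mult_le_mono1[of "v s' + 1" "v s" "T + B + 1"] by simp
      then have "bcost s b + 1 + t + u \<le> (v s + 1) * (T + B + 1)"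
        using cost[OF less.prems] e(2) by (simp add: algebra_simps)
      then show ?thesis
        unfolding runs_def using exec.WhileTrue[OF True e(1) u(1)] u(3,4) by blast
    qed
  qed
  then show ?thesis using I0 frame_refl by blast
qed


section \<open>Loop-free code on small numbers\<close>

text \<open>Only sums and products need a test of their own: differences, quotients and remainders
  never exceed the left operand, even when the divisor is 0.\<close>

fun asmall :: "nat \<Rightarrow> state \<Rightarrow> aexp \<Rightarrow> bool" where
  "asmall V s (Num k) \<longleftrightarrow> k \<le> V"
| "asmall V s (Reg r) \<longleftrightarrow> reg s r \<le> V"
| "asmall V s (Arr A e) \<longleftrightarrow> asmall V s e \<and> arr s A (aval s e) \<le> V"
| "asmall V s (Bin f a b) \<longleftrightarrow> asmall V s a \<and> asmall V s b \<and>
     (f = Add \<or> f = Mul \<longrightarrow> binop_val f (aval s a) (aval s b) \<le> V)"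

fun bsmall :: "nat \<Rightarrow> state \<Rightarrow> bexp \<Rightarrow> bool" where
  "bsmall V s (Less a b) \<longleftrightarrow> asmall V s a \<and> asmall V s b"
| "bsmall V s (Scaled a b) \<longleftrightarrow> asmall V s a \<and> asmall V s b"
| "bsmall V s (Neg b) \<longleftrightarrow> bsmall V s b"
| "bsmall V s (Conj b c) \<longleftrightarrow> bsmall V s b \<and> bsmall V s c"

fun asize :: "aexp \<Rightarrow> nat" where
  "asize (Num k) = 1"
| "asize (Reg r) = 1"
| "asize (Arr A e) = asize e + 1"
| "asize (Bin f a b) = asize a + asize b + 1"

fun bsize :: "bexp \<Rightarrow> nat" where
  "bsize (Less a b) = asize a + asize b + 1"
| "bsize (Scaled a b) = asize a + asize b + 1"
| "bsize (Neg b) = bsize b + 1"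
| "bsize (Conj b c) = bsize b + bsize c + 1"

fun csize :: "com \<Rightarrow> nat" where
  "csize Skip = 1"
| "csize (Assign r e) = asize e + 1"
| "csize (Store A i e) = asize i + asize e + 1"
| "csize (Seq c d) = csize c + csize d"
| "csize (Cond b c d) = bsize b + csize c + csize d + 1"
| "csize (While b c) = bsize b + csize c + 1"

text \<open>A weakest precondition that also demands small values throughout. One syntactic unit
  then costs at most \<open>unit_cost V\<close>, and the cost of loop-free code is read off its
  length. \<open>While\<close> gets \<open>False\<close>, since code length does not bound the cost
  of a loop; loops go through \<open>runs_for\<close> and \<open>runs_while\<close>.\<close>

fun wp :: "real \<Rightarrow> nat \<Rightarrow> com \<Rightarrow> (state \<Rightarrow> bool) \<Rightarrow> state \<Rightarrow> bool" where
  "wp \<alpha> V Skip Q s \<longleftrightarrow> Q s"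
| "wp \<alpha> V (Assign r e) Q s \<longleftrightarrow> asmall V s e \<and> Q (s\<lparr>reg := (reg s)(r := aval s e)\<rparr>)"
| "wp \<alpha> V (Store A i e) Q s \<longleftrightarrow> asmall V s i \<and> asmall V s e \<and>
     Q (s\<lparr>arr := (arr s)(A := (arr s A)(aval s i := aval s e))\<rparr>)"
| "wp \<alpha> V (Seq c d) Q s \<longleftrightarrow> wp \<alpha> V c (wp \<alpha> V d Q) s"
| "wp \<alpha> V (Cond b c d) Q s \<longleftrightarrow> bsmall V s b \<and>
     (bval \<alpha> s b \<longrightarrow> wp \<alpha> V c Q s) \<and> (\<not> bval \<alpha> s b \<longrightarrow> wp \<alpha> V d Q s)"
| "wp \<alpha> V (While b c) Q s \<longleftrightarrow> False"

text \<open>Two operands up to \<open>V\<close> have at most \<open>2 * bitlen V + 1\<close> as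
  their \<open>l\<close> in \<open>op_cost\<close>, and \<open>l * bitlen l\<close> is bounded
  crudely by the square of \<open>l\<close>.\<close>

definition unit_cost :: "nat \<Rightarrow> nat" where
  "unit_cost V = (2 * bitlen V + 2)\<^sup>2"

section \<open>Bit lengths and the cost of small steps\<close>

lemma bitlen_mono: "x \<le> y \<Longrightarrow> bitlen x \<le> bitlen y"
  by (rule floorlog_mono)

lemma less_two_power_bitlen: "x < 2 ^ bitlen x"
  using floorlog_bounds[of x 2] by (cases "x = 0") (auto simp: floorlog_def)

lemma bitlen_le_iff: "bitlen x \<le> k \<longleftrightarrow> x < 2 ^ k"
proof
  assume "bitlen x \<le> k"
  then have "(2::nat) ^ bitlen x \<le> 2 ^ k" by simp
  then show "x < 2 ^ k" using less_two_power_bitlen[of x] by linarith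
next
  assume "x < 2 ^ k"
  then show "bitlen x \<le> k" by (intro floorlog_leI) auto
qed

lemma bitlen_le_self: "bitlen x \<le> x"
  using bitlen_le_iff[of x x] by simp

lemma two_power_le_of_bitlen: "x > 0 \<Longrightarrow> 2 ^ (bitlen x - 1) \<le> x"
  using floorlog_bounds[of x 2] by auto

lemma bitlen_mult: "bitlen (x * y) \<le> bitlen x + bitlen y"
proof -
  have "x * y < 2 ^ bitlen x * 2 ^ bitlen y"
    by (intro mult_strict_mono less_two_power_bitlen) auto
  then show ?thesis by (simp add: bitlen_le_iff power_add)
qed

lemma bitlen_le_unit_cost: "3 * bitlen V + 2 \<le> unit_cost V"
  by (simp add: unit_cost_def power2_eq_square algebra_simps)

lemma unit_cost_pos: "1 \<le> unit_cost V"
  using bitlen_le_unit_cost[of V] by simp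

lemma op_cost_small: "x \<le> V \<Longrightarrow> y \<le> V \<Longrightarrow> op_cost x y \<le> unit_cost V"
proof -
  assume xy: "x \<le> V" "y \<le> V"
  define l where "l = bitlen x + bitlen y + 1"
  have l: "l \<le> 2 * bitlen V + 2"
    using bitlen_mono[OF xy(1)] bitlen_mono[OF xy(2)] by (simp add: l_def)
  have "op_cost x y = l * bitlen l" by (simp add: op_cost_def l_def Let_def)
  also have "\<dots> \<le> l * l" using bitlen_le_self by simp
  also have "\<dots> \<le> unit_cost V"
    unfolding unit_cost_def power2_eq_square by (intro mult_le_mono l)
  finally show ?thesis .
qed

lemma asmall_aval: "asmall V s e \<Longrightarrow> aval s e \<le> V"
proof (induction e)
  case (Bin f a b)
  then show ?case
    by (cases f) (auto intro: order_trans[OF div_le_dividend] order_trans[OF mod_less_eq_dividend])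
qed auto

lemma acost_small: "asmall V s e \<Longrightarrow> acost s e \<le> asize e * unit_cost V"
proof (induction e)
  case (Num k)
  then show ?case using bitlen_mono[of k V] bitlen_le_unit_cost[of V] by simp
next
  case (Reg r)
  then show ?case using bitlen_mono[of "reg s r" V] bitlen_le_unit_cost[of V] by simp
next
  case (Arr A e)
  then show ?case
    using bitlen_mono[of "aval s e" V] bitlen_mono[of "arr s A (aval s e)" V]
      bitlen_le_unit_cost[of V] asmall_aval[of V s e] by simp
next
  case (Bin f a b)
  then show ?case
    using op_cost_small[of "aval s a" V "aval s b"] asmall_aval[of V s a] asmall_aval[of V s b]
    by (simp add: algebra_simps)
qed

lemma bcost_small: "bsmall V s b \<Longrightarrow> bcost s b \<le> bsize b * unit_cost V"
proof (induction b)
  case (Less a b)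
  then show ?case
    using op_cost_small[of "aval s a" V "aval s b"] asmall_aval[of V s a] asmall_aval[of V s b]
      acost_small[of V s a] acost_small[of V s b] by (simp add: algebra_simps)
next
  case (Scaled a b)
  then show ?case
    using op_cost_small[of "aval s a" V "aval s b"] asmall_aval[of V s a] asmall_aval[of V s b]
      acost_small[of V s a] acost_small[of V s b] by (simp add: algebra_simps)
next
  case (Neg b)
  then show ?case using bitlen_le_unit_cost[of V] by simp
next
  case (Conj b c)
  then show ?case using bitlen_le_unit_cost[of V] by (simp add: algebra_simps)
qed

lemma runs_wp: "wp \<alpha> V c Q s \<Longrightarrow> runs \<alpha> c s (csize c * unit_cost V) Q"
proof (induction c arbitrary: Q s)
  case Skip
  then show ?case unfolding runs_def using exec.Skip[of \<alpha> s] bitlen_le_unit_cost[of V] by fastforce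
next
  case (Assign r e)
  have "acost s e + bitlen (aval s e) + 1 \<le> csize (Assign r e) * unit_cost V"
    using Assign acost_small[of V s e] bitlen_mono[OF asmall_aval, of V s e]
      bitlen_le_unit_cost[of V] by simp
  then show ?case unfolding runs_def using exec.Assign[of \<alpha> r e s] Assign by fastforce
next
  case (Store A i e)
  have "acost s i + acost s e + bitlen (aval s i) + bitlen (aval s e) + 1
      \<le> csize (Store A i e) * unit_cost V"
    using Store acost_small[of V s e] bitlen_mono[OF asmall_aval, of V s e]
      acost_small[of V s i] bitlen_mono[OF asmall_aval, of V s i]
      bitlen_le_unit_cost[of V] by (simp add: algebra_simps)
  then show ?case unfolding runs_def using exec.Store[of \<alpha> A i e s] Store by fastforce
next
  case (Seq c d)
  have "runs \<alpha> (Seq c d) s (csize c * unit_cost V + csize d * unit_cost V) Q"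
    using Seq.prems by (auto intro!: runs_seq[OF Seq.IH(1)] Seq.IH(2))
  then show ?case by (simp add: algebra_simps)
next
  case (Cond b c d)
  have "runs \<alpha> (Cond b c d) s (bsize b * unit_cost V + (csize c + csize d) * unit_cost V + 1) Q"
    using Cond.prems
    by (intro runs_cond bcost_small)
      (auto intro: runs_mono[OF Cond.IH(1)] runs_mono[OF Cond.IH(2)])
  then show ?case
    by (rule runs_mono) (use bitlen_le_unit_cost[of V] in \<open>auto simp: algebra_simps\<close>)
qed simp

lemma runs_for_small:
  assumes I0: "I 0 s0"
    and step: "\<And>k s. \<lbrakk>k < m; I k s; frame (While b c) s0 s\<rbrakk>
      \<Longrightarrow> bval \<alpha> s b \<and> bsmall V s b \<and> wp \<alpha> V c (I (Suc k)) s"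
    and fin: "\<And>s. \<lbrakk>I m s; frame (While b c) s0 s\<rbrakk> \<Longrightarrow> \<not> bval \<alpha> s b \<and> bsmall V s b"
  shows "runs \<alpha> (While b c) s0 ((m + 1) * csize (While b c) * unit_cost V) (I m)"
proof (rule runs_mono)
  show "runs \<alpha> (While b c) s0
    ((\<Sum>k<m. csize c * unit_cost V + bsize b * unit_cost V + 1) + bsize b * unit_cost V + 1) (I m)"
    using assms by (intro runs_for[where I = I] I0) (auto intro: bcost_small runs_wp)
  have "1 \<le> unit_cost V" by (rule unit_cost_pos)
  then have le: "csize c * unit_cost V + bsize b * unit_cost V + 1 \<le> csize (While b c) * unit_cost V"
    by (simp add: algebra_simps)
  have "m * (csize c * unit_cost V + bsize b * unit_cost V + 1) + bsize b * unit_cost V + 1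
      \<le> m * (csize (While b c) * unit_cost V) + csize (While b c) * unit_cost V"
    using mult_le_mono2[OF le, of m] le by linarith
  then show "(\<Sum>k<m. csize c * unit_cost V + bsize b * unit_cost V + 1) + bsize b * unit_cost V + 1
      \<le> (m + 1) * csize (While b c) * unit_cost V"
    by (simp only: sum_constant card_lessThan of_nat_id) (simp only: distrib_right mult_1 mult.assoc)
qed

text \<open>The trees handle their long integers only through this command. The addresses are small
  and the operands have \<open>l\<close> bits together; \<open>V\<close> has to bound
  \<open>l + 1\<close> but not the operands. The charge \<open>(l + 1) * bitlen (l + 1)\<close> is
  then linear in \<open>l\<close> up to a factor depending on \<open>bitlen V\<close>.\<close>

lemma runs_big_store:
  assumes small: "asmall V s i" "asmall V s e1" "asmall V s e2"
    and l: "bitlen (arr s A1 (aval s e1)) + bitlen (arr s A2 (aval s e2)) = l" "l + 1 \<le> V"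
    and f: "bitlen (binop_val f (arr s A1 (aval s e1)) (arr s A2 (aval s e2))) \<le> l"
    and Q: "Q (s\<lparr>arr := (arr s)(A := (arr s A)(aval s i :=
              binop_val f (arr s A1 (aval s e1)) (arr s A2 (aval s e2))))\<rparr>)"
  shows "runs \<alpha> (Store A i (Bin f (Arr A1 e1) (Arr A2 e2))) s
           ((asize i + asize e1 + asize e2 + 4 + l) * unit_cost V) Q"
proof -
  let ?K = "unit_cost V"
  let ?v1 = "arr s A1 (aval s e1)" and ?v2 = "arr s A2 (aval s e2)"
  have b: "bitlen (aval s i) \<le> bitlen V" "bitlen (aval s e1) \<le> bitlen V"
    "bitlen (aval s e2) \<le> bitlen V"
    using small by (auto intro!: bitlen_mono asmall_aval)
  have "op_cost ?v1 ?v2 = (l + 1) * bitlen (l + 1)"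
    using l(1) by (simp add: op_cost_def Let_def)
  also have "\<dots> \<le> (l + 1) * bitlen V" using bitlen_mono[OF l(2)] by (rule mult_le_mono2)
  finally have "op_cost ?v1 ?v2 \<le> l * bitlen V + bitlen V" by simp
  moreover have "l * (bitlen V + 2) \<le> l * ?K"
    using bitlen_le_unit_cost[of V] by (intro mult_le_mono2) simp
  moreover note acost_small[OF small(1)] acost_small[OF small(2)] acost_small[OF small(3)] b f l(1)
    bitlen_le_unit_cost[of V]
  ultimately have "acost s i + acost s (Bin f (Arr A1 e1) (Arr A2 e2)) + bitlen (aval s i)
      + bitlen (aval s (Bin f (Arr A1 e1) (Arr A2 e2))) + 1
      \<le> (asize i + asize e1 + asize e2 + 4 + l) * ?K"
    by (simp add: algebra_simps)
  then show ?thesis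
    unfolding runs_def using exec.Store[of \<alpha> A i "Bin f (Arr A1 e1) (Arr A2 e2)" s] Q by fastforce
qed

section \<open>Splitting numbers along the binary digits of their prime factors\<close>

text \<open>The bound by \<open>S\<close> gives all primes above \<open>S\<close> the same digits,
  namely none, so in every round they pass into the part coprime to \<open>Q\<close>.\<close>

definition digit_prime :: "nat \<Rightarrow> nat \<Rightarrow> nat \<Rightarrow> bool" where
  "digit_prime S j p \<longleftrightarrow> p \<le> S \<and> odd (p div 2 ^ j)"

text \<open>Rejected numbers contribute the factor 1, exactly as they do at the leaves of the
  product tree whose root will be this number.\<close>

definition digit_prod :: "nat \<Rightarrow> nat \<Rightarrow> nat" where
  "digit_prod S j = (\<Prod>k\<in>{1..S}. if prime k \<and> odd (k div 2 ^ j) then k else 1)"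

text \<open>The invariant of an entry after \<open>J\<close> digit positions. When \<open>J\<close>
  covers all digits of \<open>S\<close>, agreement on digits means equality for primes up to
  \<open>S\<close>, and each such prime has been selected at some position, hence is not
  repeated.\<close>

definition separated :: "nat \<Rightarrow> nat \<Rightarrow> nat \<Rightarrow> bool" where
  "separated S J y \<longleftrightarrow> y > 0 \<and>
     (\<forall>j<J. \<forall>p q. prime p \<and> prime q \<and> p dvd y \<and> q dvd y \<longrightarrow>
        digit_prime S j p = digit_prime S j q) \<and>
     (\<forall>j<J. \<forall>p. prime p \<and> digit_prime S j p \<longrightarrow> \<not> p\<^sup>2 dvd y)"

lemma digit_prod_eq: "digit_prod S j = \<Prod>{k\<in>{1..S}. prime k \<and> odd (k div 2 ^ j)}"
  unfolding digit_prod_def by (rule prod.inter_filter[symmetric]) simp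

lemma prime_dvd_digit_prod:
  assumes "prime p"
  shows "p dvd digit_prod S j \<longleftrightarrow> digit_prime S j p"
proof
  assume "p dvd digit_prod S j"
  then have "\<exists>k\<in>{k\<in>{1..S}. prime k \<and> odd (k div 2 ^ j)}. p dvd k"
    unfolding digit_prod_eq by (subst (asm) prime_dvd_prod_iff[OF _ assms]) simp_all
  then obtain k where "k \<in> {1..S}" "prime k" "odd (k div 2 ^ j)" "p dvd k"
    by blast
  then show "digit_prime S j p"
    using primes_dvd_imp_eq[OF assms] by (auto simp: digit_prime_def)
next
  assume "digit_prime S j p"
  then have "p \<in> {k\<in>{1..S}. prime k \<and> odd (k div 2 ^ j)}"
    using assms prime_ge_1_nat by (auto simp: digit_prime_def)
  then show "p dvd digit_prod S j" unfolding digit_prod_eq by (intro dvd_prodI) auto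
qed

text \<open>The factors other than 1 are distinct primes, so once \<open>p\<close> is taken out
  nothing divisible by \<open>p\<close> is left.\<close>

lemma prime_square_not_dvd_digit_prod:
  assumes "prime p"
  shows "\<not> p\<^sup>2 dvd digit_prod S j"
proof
  let ?A = "{k\<in>{1..S}. prime k \<and> odd (k div 2 ^ j)}"
  assume sq: "p\<^sup>2 dvd digit_prod S j"
  then have "digit_prime S j p"
    using prime_dvd_digit_prod[OF assms] by (meson dvd_trans dvd_power zero_less_numeral)
  then have p: "p \<in> ?A" using assms prime_ge_1_nat by (auto simp: digit_prime_def)
  then have "digit_prod S j = p * \<Prod>(?A - {p})"
    unfolding digit_prod_eq by (intro prod.remove) auto
  then have "p dvd \<Prod>(?A - {p})"
    using sq prime_gt_0_nat[OF assms] by (simp add: power2_eq_square)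
  then have "\<exists>k\<in>?A - {p}. p dvd k"
    by (subst (asm) prime_dvd_prod_iff[OF _ assms]) simp_all
  then obtain k where "prime k" "k \<noteq> p" "p dvd k" by blast
  then show False using primes_dvd_imp_eq[OF assms] by blast
qed

text \<open>For an entry \<open>y\<close>, \<open>a\<close> keeps one copy of each prime of
  \<open>Q\<close> in \<open>y\<close>, and \<open>b\<close> keeps everything else. Further copies
  of primes of \<open>Q\<close> are discarded. The exponent is known only to be at least
  \<open>y\<close>, because the program finds it by doubling.\<close>

context
  fixes S J y e Q a b :: nat
  assumes y: "y > 0" and e: "e \<ge> y"
  defines "Q \<equiv> digit_prod S J"
  defines "a \<equiv> gcd y Q" and "b \<equiv> y div gcd y (Q ^ e)"
begin

lemma split_snd_mult: "b * gcd y (Q ^ e) = y"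
  unfolding b_def by simp

lemma split_pos: "a > 0" "b > 0"
  using y split_snd_mult by (auto simp: a_def intro: Nat.gr0I)

text \<open>Equality fails when \<open>y\<close> contains a prime of \<open>Q\<close> repeatedly.
  The inequality is what keeps the total weight from growing.\<close>

lemma split_mult_le: "a * b \<le> y"
proof -
  have "a dvd gcd y (Q ^ e)"
    unfolding a_def using e y by (auto intro: dvd_trans[OF gcd_dvd2] dvd_power)
  then have "a * b dvd y" using split_snd_mult mult_dvd_mono[of a "gcd y (Q ^ e)" b b]
    by (simp add: mult.commute)
  then show ?thesis using y dvd_imp_le by blast
qed

lemma split_dvd: "a dvd y" "b dvd y"
  using split_snd_mult by (simp_all add: a_def) (metis dvd_triv_left)

lemma prime_dvd_split_fst: "prime p \<Longrightarrow> p dvd a \<longleftrightarrow> p dvd y \<and> digit_prime S J p"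
  by (simp add: a_def Q_def prime_dvd_digit_prod)

text \<open>The multiplicity \<open>k\<close> of \<open>p\<close> in \<open>y\<close> satisfies
  \<open>k < 2 ^ k <= p ^ k <= y <= e\<close>. If \<open>p\<close> divides \<open>Q\<close>, the gcd
  therefore swallows all of \<open>p ^ k\<close>, and one more \<open>p\<close> in the quotient
  would exceed the multiplicity. A prime not dividing \<open>Q\<close> misses the gcd and survives
  in the quotient.\<close>

lemma prime_dvd_split_snd:
  assumes p: "prime p"
  shows "p dvd b \<longleftrightarrow> p dvd y \<and> \<not> digit_prime S J p"
proof
  assume pb: "p dvd b"
  have "\<not> digit_prime S J p"
  proof
    assume "digit_prime S J p"
    then have pQ: "p dvd Q" by (simp add: Q_def prime_dvd_digit_prod p)
    define k where "k = multiplicity p y"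
    have pk: "p ^ k dvd y" unfolding k_def by (rule multiplicity_dvd)
    have "k < 2 ^ k" by simp
    also have "\<dots> \<le> p ^ k" using prime_ge_2_nat[OF p] by (rule power_mono) simp
    also have "\<dots> \<le> y" using pk y dvd_imp_le by blast
    finally have "p ^ k dvd Q ^ e" using e pQ by (intro dvd_power_le) auto
    then have "p ^ k dvd gcd y (Q ^ e)" using pk by simp
    then have "p * p ^ k dvd y" using split_snd_mult mult_dvd_mono[OF pb] by metis
    then have "p ^ Suc k dvd y" by simp
    then have "Suc k \<le> multiplicity p y"
      using y p by (intro multiplicity_geI) (auto dest: prime_gt_1_nat)
    then show False by (simp add: k_def)
  qed
  then show "p dvd y \<and> \<not> digit_prime S J p" using pb split_dvd(2) dvd_trans by blast
next
  assume *: "p dvd y \<and> \<not> digit_prime S J p"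
  then have "\<not> p dvd gcd y (Q ^ e)"
    using p prime_dvd_digit_prod prime_dvd_power Q_def by (metis gcd_dvd2 dvd_trans)
  then show "p dvd b" using * split_snd_mult prime_dvd_mult_iff[OF p] by metis
qed

text \<open>As a divisor of the squarefree \<open>Q\<close>, \<open>a\<close> has no repeated prime
  at all, and its primes share the digit 1 at position \<open>J\<close>.\<close>

lemma separated_split_fst:
  assumes "separated S J y"
  shows "separated S (Suc J) a"
proof -
  have "\<not> p\<^sup>2 dvd a" if "prime p" for p
    using prime_square_not_dvd_digit_prod[OF that] by (auto simp: a_def Q_def)
  moreover have "digit_prime S j p = digit_prime S j q"
    if "j < Suc J" "prime p" "prime q" "p dvd a" "q dvd a" for j p q
    using that assms prime_dvd_split_fst[of p] prime_dvd_split_fst[of q]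
    unfolding separated_def less_Suc_eq by metis
  ultimately show ?thesis using split_pos(1) unfolding separated_def by metis
qed

text \<open>Only primes without digit 1 at position \<open>J\<close> are left in \<open>b\<close>;
  the conditions for earlier positions pass from \<open>y\<close> to its divisor.\<close>

lemma separated_split_snd:
  assumes "separated S J y"
  shows "separated S (Suc J) b"
proof -
  have "\<not> p\<^sup>2 dvd b" if "prime p" "digit_prime S J p" for p
    using prime_dvd_split_snd[OF that(1)] that by (auto simp: power2_eq_square dest: dvd_mult_left)
  moreover have "\<not> p\<^sup>2 dvd b" if "prime p" "digit_prime S j p" "j < J" for p j
    using that assms split_dvd(2) unfolding separated_def by (meson dvd_trans)
  moreover have "digit_prime S j p = digit_prime S j q"
    if "j < Suc J" "prime p" "prime q" "p dvd b" "q dvd b" for j p q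
    using that assms prime_dvd_split_snd[of p] prime_dvd_split_snd[of q]
    unfolding separated_def less_Suc_eq by metis
  ultimately show ?thesis using split_pos(2) unfolding separated_def less_Suc_eq by metis
qed

text \<open>Serves the branch in which the program leaves the entry as it is: with gcd 1, no prime
  of \<open>y\<close> is selected at position \<open>J\<close>.\<close>

lemma separated_no_split:
  assumes "separated S J y" and a1: "a = 1"
  shows "separated S (Suc J) y"
proof -
  have no: "\<not> digit_prime S J p" if "prime p" "p dvd y" for p
    using prime_dvd_split_fst[OF that(1)] that a1 by auto
  have "\<not> p\<^sup>2 dvd y" if "prime p" "digit_prime S J p" for p
    using no[OF that(1)] that by (auto simp: power2_eq_square dest: dvd_mult_left)
  then show ?thesis using assms(1) no by (auto simp: separated_def less_Suc_eq)
qed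

end

section \<open>From separated entries to primes\<close>

lemma separated_0: "separated S 0 y \<longleftrightarrow> y > 0"
  by (simp add: separated_def)

lemma separated_imp_prime:
  assumes sep: "separated S J y" and J: "S < 2 ^ J" and le: "y \<le> S\<^sup>2" and y1: "y \<noteq> 1"
  shows "prime y"
proof -
  obtain p where p: "prime p" "p dvd y" using prime_factor_nat[OF y1] by blast
  \<comment> \<open>A number below \<open>2 ^ J\<close> whose digits below \<open>J\<close> all
    vanish is 0. The induction rebuilds the residue modulo \<open>2 ^ j\<close> digit by
    digit.\<close>
  have small: "\<exists>j<J. digit_prime S j q" if q: "prime q" "q \<le> S" for q
  proof (rule ccontr)
    assume "\<not> ?thesis"
    then have ev: "even (q div 2 ^ j)" if "j < J" for j using that q by (auto simp: digit_prime_def)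
    have "q mod 2 ^ j = 0" if "j \<le> J" for j
      using that
    proof (induction j)
      case (Suc j)
      have "q mod 2 ^ Suc j = 2 ^ j * (q div 2 ^ j mod 2) + q mod 2 ^ j"
        using mod_mult2_eq[of q "2 ^ j" 2] by (simp add: mult.commute)
      then show ?case using ev[of j] Suc by simp
    qed simp
    from this[of J] have "q = 0" using q(2) J by simp
    then show False using q(1) by simp
  qed
  have y0: "y > 0" using sep by (simp add: separated_def)
  have prod_le: "\<not> q * r dvd y" if "q > S" "r > S" for q r
  proof
    assume "q * r dvd y"
    then have "q * r \<le> y" using y0 dvd_imp_le by blast
    moreover have "S * S < q * r" using that by (intro mult_strict_mono) auto
    ultimately show False using le by (simp add: power2_eq_square)
  qed
  have eq: "q = p" if q: "prime q" "q dvd y" for q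
  proof (rule ccontr)
    assume ne: "q \<noteq> p"
    have pq: "p * q dvd y"
      using p q ne by (intro divides_mult primes_coprime) auto
    have same: "digit_prime S j q = digit_prime S j p" if "j < J" for j
      using sep p q that unfolding separated_def by blast
    \<comment> \<open>A prime up to \<open>S\<close> has some digit 1, while a prime above
      \<open>S\<close> counts as having none, so agreement excludes a mixed pair. Two primes above
      \<open>S\<close> are excluded by size.\<close>
    have "q \<le> S \<longleftrightarrow> p \<le> S"
      using small[OF p(1)] small[OF q(1)] same unfolding digit_prime_def by blast
    with prod_le[of p q] pq have le: "q \<le> S" "p \<le> S" by auto
    then have par: "odd (q div 2 ^ j) = odd (p div 2 ^ j)" if "j < J" for j
      using same[OF that] by (simp add: digit_prime_def)
    have "q mod 2 ^ j = p mod 2 ^ j" if "j \<le> J" for j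
      using that
    proof (induction j)
      case (Suc j)
      have "z mod 2 ^ Suc j = 2 ^ j * (z div 2 ^ j mod 2) + z mod 2 ^ j" for z :: nat
        using mod_mult2_eq[of z "2 ^ j" 2] by (simp add: mult.commute)
      moreover have "q div 2 ^ j mod 2 = p div 2 ^ j mod 2"
        using par[of j] Suc.prems by (simp add: mod2_eq_if)
      ultimately show ?case using Suc by simp
    qed simp
    from this[of J] have "q = p" using le J by simp
    with ne show False ..
  qed
  obtain z where z: "y = p * z" using p(2) by blast
  \<comment> \<open>A further prime factor would again be \<open>p\<close>, so \<open>p\<close>
    would divide \<open>y\<close> twice. For \<open>p\<close> up to \<open>S\<close> the separation
    forbids this, for larger \<open>p\<close> the bound on \<open>y\<close>.\<close>
  have "z = 1"
  proof (rule ccontr)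
    assume "z \<noteq> 1"
    then obtain q where "prime q" "q dvd z" using prime_factor_nat by blast
    then have "p dvd z" using eq[of q] z by auto
    then have sq: "p\<^sup>2 dvd y" using z by (simp add: power2_eq_square)
    show False
    proof (cases "p \<le> S")
      case True
      then show False using small[OF p(1)] sep sq p(1) by (auto simp: separated_def)
    next
      case False
      then show False using prod_le[of p p] sq by (simp add: power2_eq_square)
    qed
  qed
  then show ?thesis using z p by simp
qed

text \<open>
  The total weight does not grow when entries are split, and every entry has weight at least 1, so
  it bounds the length of the list.
\<close>

definition weight :: "nat \<Rightarrow> nat" where
  "weight y = max 1 (bitlen y - 1)"

text \<open>\<open>bitlen y - 1\<close> is the floor of the binary logarithm of a positive
  \<open>y\<close>, and such floors are superadditive on products. As \<open>a\<close> and
  \<open>b\<close> exceed 1, the maximum with 1 does not interfere.\<close>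

lemma weight_split:
  assumes "a > 1" "b > 1" "a * b \<le> y"
  shows "weight a + weight b \<le> weight y"
proof -
  have pos: "bitlen a \<ge> 2" "bitlen b \<ge> 2"
    using assms bitlen_le_iff[of a 1] bitlen_le_iff[of b 1] by auto
  have "2 ^ (bitlen a - 1 + (bitlen b - 1)) \<le> a * b"
    unfolding power_add using assms by (intro mult_le_mono two_power_le_of_bitlen) auto
  then have "\<not> bitlen y \<le> bitlen a - 1 + (bitlen b - 1)"
    using assms(3) bitlen_le_iff[of y] by simp
  then show ?thesis using pos by (simp add: weight_def)
qed

lemma weight_mono: "x \<le> y \<Longrightarrow> weight x \<le> weight y"
  using bitlen_mono[of x y] by (simp add: weight_def max.coboundedI2)

text \<open>Integer form of the harmonic sum. At most \<open>M div 2 + 1\<close> indices exceed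
  \<open>M div 2\<close>, each contributing at most \<open>D div (M div 2 + 1)\<close>, hence at
  most \<open>D\<close> together. Halving \<open>M\<close> removes exactly one bit.\<close>

lemma sum_div_le: "(\<Sum>i=1..M. D div i) \<le> D * bitlen M"
proof (induction M rule: less_induct)
  case (less M)
  show ?case
  proof (cases "M = 0")
    case False
    let ?h = "M div 2"
    have h: "?h < M" using False by simp
    have "(\<Sum>i=?h+1..M. D div i) \<le> (\<Sum>i=?h+1..M. D div (?h+1))"
      by (intro sum_mono div_le_mono2) auto
    also have "\<dots> = (M - ?h) * (D div (?h+1))" by simp
    also have "\<dots> \<le> (?h + 1) * (D div (?h+1))" by (intro mult_le_mono1) linarith
    also have "\<dots> \<le> D" by (metis mult.commute div_times_less_eq_dividend)
    finally have "(\<Sum>i=?h+1..M. D div i) \<le> D" .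
    moreover have "(\<Sum>i=1..M. D div i) = (\<Sum>i=1..?h. D div i) + (\<Sum>i=?h+1..M. D div i)"
      using sum.ub_add_nat[of 1 ?h "\<lambda>i. D div i" "M - ?h"] h by simp
    moreover have "bitlen M = bitlen ?h + 1"
      using False by (subst compute_floorlog) auto
    ultimately show ?thesis using less.IH[OF h] by simp
  qed simp
qed

section \<open>The program\<close>

abbreviation (input) "r_len \<equiv> 0 :: nat"
abbreviation (input) "r_best \<equiv> 1 :: nat"
abbreviation (input) "r_size \<equiv> 2 :: nat"
abbreviation (input) "r_idx \<equiv> 3 :: nat"
abbreviation (input) "r_sum \<equiv> 4 :: nat"
abbreviation (input) "r_mult \<equiv> 5 :: nat"
abbreviation (input) "r_max \<equiv> 6 :: nat"
abbreviation (input) "r_root \<equiv> 7 :: nat"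
abbreviation (input) "r_tmp \<equiv> 8 :: nat"
abbreviation (input) "r_pow \<equiv> 9 :: nat"
abbreviation (input) "r_leaves \<equiv> 10 :: nat"
abbreviation (input) "r_gcd \<equiv> 11 :: nat"
abbreviation (input) "r_snd \<equiv> 12 :: nat"
abbreviation (input) "r_swap \<equiv> 13 :: nat"
abbreviation (input) "r_cur \<equiv> 14 :: nat"
abbreviation (input) "r_in \<equiv> 15 :: nat"
abbreviation (input) "r_exp \<equiv> 16 :: nat"
abbreviation (input) "r_out \<equiv> 17 :: nat"
abbreviation (input) "r_rem \<equiv> 18 :: nat"

abbreviation (input) "a_list \<equiv> 0 :: nat"
abbreviation (input) "a_count \<equiv> 1 :: nat"
abbreviation (input) "a_primes \<equiv> 2 :: nat"
abbreviation (input) "a_ptree \<equiv> 3 :: nat"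
abbreviation (input) "a_ltree \<equiv> 4 :: nat"
abbreviation (input) "a_rtree \<equiv> 5 :: nat"
abbreviation (input) "a_pcount \<equiv> 6 :: nat"

abbreviation (input) plus_e (infixl "\<oplus>" 65) where "a \<oplus> b \<equiv> Bin Add a b"
abbreviation (input) minus_e (infixl "\<ominus>" 65) where "a \<ominus> b \<equiv> Bin Sub a b"
abbreviation (input) times_e (infixl "\<otimes>" 70) where "a \<otimes> b \<equiv> Bin Mul a b"
abbreviation (input) div_e (infixl "\<oslash>" 70) where "a \<oslash> b \<equiv> Bin Div a b"
abbreviation (input) mod_e (infixl "\<odot>" 70) where "a \<odot> b \<equiv> Bin Mod a b"
abbreviation (input) seq_c (infixr ";;" 60) where "c ;; d \<equiv> Seq c d"
abbreviation (input) incr where "incr r \<equiv> Assign r (Reg r \<oplus> Num 1)"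

text \<open>Multiplicities are counted in an array indexed by the elements themselves: a large
  address is charged only by its bit length, and the array starts with zeros. \<open>r_size\<close>
  saves the size of the input, since \<open>r_len\<close> will grow.\<close>

definition scan :: com where
  "scan = Assign r_size (Reg r_len) ;;
     While (Less (Reg r_idx) (Reg r_size))
       (Assign r_tmp (Arr a_list (Reg r_idx)) ;;
        Assign r_sum (Reg r_sum \<oplus> Reg r_tmp) ;;
        Store a_count (Reg r_tmp) (Arr a_count (Reg r_tmp) \<oplus> Num 1) ;;
        Cond (Less (Reg r_mult) (Arr a_count (Reg r_tmp)))
          (Assign r_mult (Arr a_count (Reg r_tmp))) Skip ;;
        Cond (Less (Reg r_max) (Reg r_tmp)) (Assign r_max (Reg r_tmp)) Skip ;;
        incr r_idx)"

definition find_root :: com where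
  "find_root = While (Less (Reg r_root \<otimes> Reg r_root) (Reg r_max)) (incr r_root)"

text \<open>A struck entry becomes 1 and not 0, because the entries will be multiplied. Multiples of
  composite numbers are struck as well; the harmonic sum covers this.\<close>

definition sieve :: com where
  "sieve = Assign r_idx (Num 1) ;;
     While (Less (Reg r_idx) (Reg r_root \<oplus> Num 1))
       (Store a_primes (Reg r_idx) (Reg r_idx) ;; incr r_idx) ;;
     Assign r_idx (Num 2) ;;
     While (Less (Reg r_idx) (Reg r_root \<oplus> Num 1))
       (Assign r_tmp (Num 2 \<otimes> Reg r_idx) ;;
        While (Less (Reg r_tmp) (Reg r_root \<oplus> Num 1))
          (Store a_primes (Reg r_tmp) (Num 1) ;; Assign r_tmp (Reg r_tmp \<oplus> Reg r_idx)) ;;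
        incr r_idx)"

definition prime_leaves :: com where
  "prime_leaves = Assign r_idx (Num 0) ;;
     While (Less (Reg r_idx) (Reg r_root))
       (Cond (Less ((Reg r_idx \<oplus> Num 1) \<oslash> Reg r_pow \<odot> Num 2) (Num 1))
          (Store a_ptree (Reg r_root \<oplus> Reg r_idx) (Num 1))
          (Store a_ptree (Reg r_root \<oplus> Reg r_idx) (Arr a_primes (Reg r_idx \<oplus> Num 1))) ;;
        incr r_idx)"

definition list_leaves :: com where
  "list_leaves = (Assign r_leaves (Reg r_len) ;; Assign r_idx (Num 0)) ;;
     While (Less (Reg r_idx) (Reg r_leaves))
       (Store a_ltree (Reg r_leaves \<oplus> Reg r_idx) (Arr a_list (Reg r_idx)) ;; incr r_idx)"

text \<open>
  The trees are stored like binary heaps: node \<open>i\<close> has the children \<open>2 * i\<close> and \<open>2 * i + 1\<close>, and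
  with \<open>m\<close> leaves the leaves are the nodes \<open>m, \<dots>, 2 * m - 1\<close>. This needs no assumption on \<open>m\<close>.
\<close>

definition prod_tree :: "nat \<Rightarrow> nat \<Rightarrow> com" where
  "prod_tree A r = Assign r_idx (Reg r) ;;
     While (Less (Num 1) (Reg r_idx))
       (Assign r_idx (Reg r_idx \<ominus> Num 1) ;;
        Store A (Reg r_idx)
          (Arr A (Num 2 \<otimes> Reg r_idx) \<otimes> Arr A (Num 2 \<otimes> Reg r_idx \<oplus> Num 1)))"

text \<open>Increasing indices visit a parent before its children. Each node reduces the remainder
  of its parent, so operands shrink along with the nodes on the way to the leaves.\<close>

definition rem_tree :: com where
  "rem_tree = Store a_rtree (Num 1) (Arr a_ptree (Num 1) \<odot> Arr a_ltree (Num 1)) ;;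
     Assign r_idx (Num 2) ;;
     While (Less (Reg r_idx) (Num 2 \<otimes> Reg r_leaves))
       (Store a_rtree (Reg r_idx)
          (Arr a_rtree (Reg r_idx \<oslash> Num 2) \<odot> Arr a_ltree (Reg r_idx)) ;;
        incr r_idx)"

definition euclid :: com where
  "euclid = While (Less (Num 0) (Reg r_snd))
     (Assign r_swap (Reg r_gcd \<odot> Reg r_snd) ;; Assign r_gcd (Reg r_snd) ;;
      Assign r_snd (Reg r_swap))"

text \<open>Repeated squaring until the exponent reaches \<open>y\<close>. Residues modulo
  \<open>y\<close> suffice, since the power is only used in a gcd with \<open>y\<close>.\<close>

definition power_rem :: com where
  "power_rem = Assign r_exp (Num 1) ;;
     While (Less (Reg r_exp) (Reg r_cur))
       (Assign r_exp (Num 2 \<otimes> Reg r_exp) ;;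
        Assign r_rem (Reg r_rem \<otimes> Reg r_rem \<odot> Reg r_cur))"

text \<open>
  If the gcd is 1, the entry stays as it is; otherwise it is overwritten by the gcd, and the
  coprime part is appended to the list unless it is 1.
\<close>

definition split_entry :: com where
  "split_entry =
     (Assign r_cur (Arr a_list (Reg r_idx)) ;;
      Assign r_rem (Arr a_rtree (Reg r_leaves \<oplus> Reg r_idx)) ;;
      Assign r_gcd (Reg r_cur) ;; Assign r_snd (Reg r_rem)) ;;
     euclid ;;
     Assign r_in (Reg r_gcd) ;;
     Cond (Less (Num 1) (Reg r_in))
       (power_rem ;;
        (Assign r_gcd (Reg r_cur) ;; Assign r_snd (Reg r_rem)) ;;
        euclid ;;
        Store a_list (Reg r_idx) (Reg r_in) ;;
        Assign r_out (Reg r_cur \<oslash> Reg r_gcd) ;;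
        Cond (Less (Num 1) (Reg r_out))
          (Store a_list (Reg r_len) (Reg r_out) ;; incr r_len) Skip)
       Skip"

definition split_list :: com where
  "split_list = Assign r_idx (Num 0) ;;
     While (Less (Reg r_idx) (Reg r_leaves)) (split_entry ;; incr r_idx)"

definition stage :: com where
  "stage = prime_leaves ;; prod_tree a_ptree r_root ;;
     list_leaves ;; prod_tree a_ltree r_leaves ;;
     rem_tree ;; split_list ;; Assign r_pow (Num 2 \<otimes> Reg r_pow)"

definition factor_list :: com where
  "factor_list = Assign r_pow (Num 1) ;; While (Less (Reg r_pow) (Reg r_root \<oplus> Num 1)) stage"

text \<open>Starting with 2 makes \<open>r_best\<close> a prime even if every entry is 1.\<close>

definition count_primes :: com where
  "count_primes = (Assign r_idx (Num 0) ;; Assign r_best (Num 2)) ;;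
     While (Less (Reg r_idx) (Reg r_len))
       (Assign r_tmp (Arr a_list (Reg r_idx)) ;;
        Cond (Less (Num 1) (Reg r_tmp))
          (Store a_pcount (Reg r_tmp) (Arr a_pcount (Reg r_tmp) \<oplus> Num 1) ;;
           Cond (Less (Arr a_pcount (Reg r_best)) (Arr a_pcount (Reg r_tmp)))
             (Assign r_best (Reg r_tmp)) Skip)
          Skip ;;
        incr r_idx)"

text \<open>The inequality of an almost divisor, multiplied by the square of the size.
  \<open>r_len\<close> and \<open>r_best\<close> are registers 0 and 1, so the answer already stands
  where the output is expected.\<close>

definition decide :: com where
  "decide = Cond
     (Scaled ((Reg r_size \<ominus> Arr a_pcount (Reg r_best)) \<otimes> (Reg r_size \<otimes> Reg r_size))
        (Reg r_mult \<otimes> Reg r_sum))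
     (Assign r_len (Num 1)) (Assign r_len (Num 0))"

definition almost_divisor_prog :: com where
  "almost_divisor_prog =
     scan ;; find_root ;; sieve ;; factor_list ;; count_primes ;; decide"


section \<open>Product and remainder trees\<close>

text \<open>
  The bound \<open>i * bitlen (node i) \<le> D\<close> is inherited from the children by their product. It makes the
  total size of the tree a harmonic sum.
\<close>

lemma runs_prod_tree:
  assumes m: "reg s r = m" "m \<ge> 1"
    and leaves: "\<And>i. i \<in> {m..<2*m} \<Longrightarrow> 0 < arr s A i \<and> i * bitlen (arr s A i) \<le> D"
    and V: "2 * m + 2 \<le> V" "D + 1 \<le> V"
  shows "runs \<alpha> (prod_tree A r) s ((22 * m + D * bitlen m) * unit_cost V) (\<lambda>s'.
     (\<forall>i\<in>{m..<2*m}. arr s' A i = arr s A i) \<and>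
     (\<forall>i\<in>{1..<2*m}. 0 < arr s' A i \<and> i * bitlen (arr s' A i) \<le> D) \<and>
     (\<forall>i\<in>{1..<m}. arr s' A i = arr s' A (2*i) * arr s' A (2*i+1)) \<and>
     arr s' A 1 = (\<Prod>i=m..<2*m. arr s A i))"
proof -
  let ?K = "unit_cost V"
  let ?b = "Less (Num 1) (Reg r_idx)"
  define c where "c = Store A (Reg r_idx)
          (Arr A (Num 2 \<otimes> Reg r_idx) \<otimes> Arr A (Num 2 \<otimes> Reg r_idx \<oplus> Num 1))"
  let ?c = "Assign r_idx (Reg r_idx \<ominus> Num 1) ;; c"
  \<comment> \<open>With \<open>j = m - k\<close>, the window of nodes from \<open>j\<close> to
    \<open>2 * j - 1\<close> keeps the product of all leaves: a round replaces the nodes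
    \<open>2 * i\<close> and \<open>2 * i + 1\<close> by their product at \<open>i\<close>. At the
    end the window is the root alone, whatever the shape of the tree.\<close>
  define I where "I k s' \<longleftrightarrow> reg s' r_idx = m - k \<and>
     (\<forall>i\<in>{m..<2*m}. arr s' A i = arr s A i) \<and>
     (\<forall>i\<in>{m-k..<2*m}. 0 < arr s' A i \<and> i * bitlen (arr s' A i) \<le> D) \<and>
     (\<forall>i\<in>{m-k..<m}. arr s' A i = arr s' A (2*i) * arr s' A (2*i+1)) \<and>
     (\<Prod>i=m-k..<2*(m-k). arr s' A i) = (\<Prod>i=m..<2*m. arr s A i)" for k and s' :: state
  have step: "runs \<alpha> ?c s' ((17 + D div (m - 1 - k)) * ?K) (I (Suc k))"
    if k: "k < m - 1" and I: "I k s'" for k and s' :: state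
  proof -
    define i where "i = m - 1 - k"
    have i: "i \<ge> 1" "m - k = Suc i" "m - Suc k = i" "Suc i \<le> m" using k by (auto simp: i_def)
    let ?x = "arr s' A (2*i)" and ?y = "arr s' A (2*i+1)"
    define l where "l = bitlen ?x + bitlen ?y"
    have xy: "0 < ?x" "2*i * bitlen ?x \<le> D" "0 < ?y" "(2*i+1) * bitlen ?y \<le> D"
    proof -
      have *: "0 < arr s' A j \<and> j * bitlen (arr s' A j) \<le> D" if "Suc i \<le> j" "j < 2 * m" for j
        using I that unfolding I_def i(2) by simp
      show "0 < ?x" "2*i * bitlen ?x \<le> D" "0 < ?y" "(2*i+1) * bitlen ?y \<le> D"
        using *[of "2*i"] *[of "2*i+1"] i by auto
    qed
    \<comment> \<open>The children have indices at least \<open>2 * i\<close>, so adding their two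
      bounds gives twice the bound wanted for the parent.\<close>
    have "2 * (i * l) \<le> 2 * D" using xy(2,4) by (simp add: l_def algebra_simps)
    then have il: "i * l \<le> D" by simp
    then have l: "l \<le> D div i" using i(1) by (simp add: less_eq_div_iff_mult_less_eq mult.commute)
    have "l \<le> i * l" using i(1) by simp
    then have lV: "l + 1 \<le> V" using il V(2) by linarith
    have "runs \<alpha> ?c s' (csize (Assign r_idx (Reg r_idx \<ominus> Num 1)) * ?K
        + (1 + 3 + 5 + 4 + l) * ?K) (I (Suc k))"
    proof (rule runs_seq)
      show "runs \<alpha> (Assign r_idx (Reg r_idx \<ominus> Num 1)) s'
         (csize (Assign r_idx (Reg r_idx \<ominus> Num 1)) * ?K) (\<lambda>s''. reg s'' r_idx = i)"
        using I i V by (intro runs_wp) (auto simp: I_def)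
      fix s''
      assume s'': "reg s'' r_idx = i" and fr: "frame (Assign r_idx (Reg r_idx \<ominus> Num 1)) s' s''"
      have A: "arr s'' = arr s'" using frame_arr[OF fr] by auto
      let ?s = "s''\<lparr>arr := (arr s'')(A := (arr s'' A)(i := ?x * ?y))\<rparr>"
      have bl: "bitlen (?x * ?y) \<le> l" using bitlen_mult by (simp add: l_def)
      have "(\<Prod>j=i..<2*i. ((arr s' A)(i := ?x * ?y)) j) = (\<Prod>j=Suc i..<2*Suc i. arr s' A j)"
      proof -
        have "(\<Prod>j=i..<2*i. ((arr s' A)(i := ?x * ?y)) j) = ?x * ?y * (\<Prod>j=Suc i..<2*i. arr s' A j)"
          using i(1) by (subst prod.atLeast_Suc_lessThan) auto
        moreover have "2 * Suc i = Suc (Suc (2*i))" by simp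
        ultimately show ?thesis using i(1) by (simp add: mult_ac)
      qed
      moreover have "i * bitlen (?x * ?y) \<le> D" using bl il by (meson le_trans mult_le_mono2)
      moreover have "{i..<2*m} = insert i {Suc i..<2*m}" "{i..<m} = insert i {Suc i..<m}"
        using i by auto
      ultimately have "I (Suc k) ?s"
        using I s'' A i xy unfolding I_def i(2,3) by (auto simp: i(2,3))
      then have "runs \<alpha> c s'' ((asize (Reg r_idx) + asize (Num 2 \<otimes> Reg r_idx)
          + asize (Num 2 \<otimes> Reg r_idx \<oplus> Num 1) + 4 + l) * ?K) (I (Suc k))"
        unfolding c_def
        using s'' A V i bl lV by (intro runs_big_store) (auto simp: l_def)
      then show "runs \<alpha> c s'' ((1 + 3 + 5 + 4 + l) * ?K) (I (Suc k))"
        by simp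
    qed
    then show ?thesis
      unfolding i_def[symmetric]
      by (rule runs_mono) (use mult_le_mono1[OF l, of ?K] in \<open>auto simp: algebra_simps\<close>)
  qed
  have "runs \<alpha> (prod_tree A r) s (csize (Assign r_idx (Reg r)) * ?K +
     ((\<Sum>k<m-1. (17 + D div (m - 1 - k)) * ?K + 3 * ?K + 1) + 3 * ?K + 1)) (I (m - 1))"
    unfolding prod_tree_def c_def[symmetric]
  proof (rule runs_seq)
    show "runs \<alpha> (Assign r_idx (Reg r)) s (csize (Assign r_idx (Reg r)) * ?K) (I 0)"
      using m leaves V by (intro runs_wp) (auto simp: I_def)
    fix s' assume "I 0 s'"
    then show "runs \<alpha> (While ?b ?c) s'
        ((\<Sum>k<m-1. (17 + D div (m - 1 - k)) * ?K + 3 * ?K + 1) + 3 * ?K + 1) (I (m - 1))"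
    proof (rule runs_for)
      fix k t assume k: "k < m - 1" and t: "I k t"
      have "bcost t ?b \<le> bsize ?b * ?K"
        using t V by (intro bcost_small) (auto simp: I_def)
      then show "bval \<alpha> t ?b \<and> bcost t ?b \<le> 3 * ?K \<and>
          runs \<alpha> ?c t ((17 + D div (m - 1 - k)) * ?K) (I (Suc k))"
        using step[OF k t] k t by (auto simp: I_def)
    next
      fix t assume t: "I (m - 1) t"
      have "bcost t ?b \<le> bsize ?b * ?K"
        using t V by (intro bcost_small) (auto simp: I_def)
      then show "\<not> bval \<alpha> t ?b \<and> bcost t ?b \<le> 3 * ?K" using t m(2) by (auto simp: I_def)
    qed
  qed
  then show ?thesis
  proof (rule runs_mono)
    have K: "1 \<le> ?K" by (rule unit_cost_pos)
    have "(\<Sum>k<m-1. D div (m - 1 - k)) = (\<Sum>k<m-1. D div Suc (m - 1 - Suc k))"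
      by (rule sum.cong) (auto simp: Suc_diff_Suc)
    also have "\<dots> = (\<Sum>k<m-1. D div Suc k)"
      by (rule sum.nat_diff_reindex[of "\<lambda>k. D div Suc k"])
    also have "\<dots> = (\<Sum>i=1..m-1. D div i)"
      by (simp add: sum.atLeast1_atMost_eq)
    also have "\<dots> \<le> D * bitlen (m - 1)" by (rule sum_div_le)
    also have "\<dots> \<le> D * bitlen m" by (intro mult_le_mono2 bitlen_mono) simp
    finally have D: "(\<Sum>k<m-1. D div (m - 1 - k)) \<le> D * bitlen m" .
    have "(\<Sum>k<m-1. (17 + D div (m - 1 - k)) * ?K + 3 * ?K + 1)
        \<le> (\<Sum>k<m-1. (21 + D div (m - 1 - k)) * ?K)"
      using K by (intro sum_mono) (simp add: algebra_simps)
    also have "\<dots> = (21 * (m - 1) + (\<Sum>k<m-1. D div (m - 1 - k))) * ?K"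
      by (simp add: sum_distrib_right[symmetric] sum.distrib)
    also have "\<dots> \<le> (21 * (m - 1) + D * bitlen m) * ?K" using D by (intro mult_le_mono1) simp
    finally have "csize (Assign r_idx (Reg r)) * ?K
        + ((\<Sum>k<m-1. (17 + D div (m - 1 - k)) * ?K + 3 * ?K + 1) + 3 * ?K + 1)
        \<le> (21 * (m - 1) + D * bitlen m) * ?K + 6 * ?K" using K by simp
    also have "\<dots> = (21 * (m - 1) + D * bitlen m + 6) * ?K" by (simp add: algebra_simps)
    also have "\<dots> \<le> (22 * m + D * bitlen m) * ?K" using m(2) by (intro mult_le_mono1) simp
    finally show "csize (Assign r_idx (Reg r)) * ?K
        + ((\<Sum>k<m-1. (17 + D div (m - 1 - k)) * ?K + 3 * ?K + 1) + 3 * ?K + 1)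
        \<le> (22 * m + D * bitlen m) * ?K" .
  qed (use m(2) in \<open>auto simp: I_def numeral_2_eq_2\<close>)
qed

text \<open>A node divides its parent, so reducing the parent's remainder gives the same as reducing
  the long product itself. The bound on \<open>a_ptree\<close> pays for the one reduction at the
  root, which has no parent.\<close>

lemma runs_rem_tree:
  assumes m: "reg s r_leaves = m" "m \<ge> 1"
    and tree: "\<And>i. i \<in> {1..<2*m} \<Longrightarrow>
      0 < arr s a_ltree i \<and> i * bitlen (arr s a_ltree i) \<le> D"
      "\<And>i. i \<in> {1..<m} \<Longrightarrow> arr s a_ltree i = arr s a_ltree (2*i) * arr s a_ltree (2*i+1)"
    and Q: "bitlen (arr s a_ptree 1) \<le> D"
    and V: "2 * m + 2 \<le> V" "4 * D + 1 \<le> V"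
  shows "runs \<alpha> rem_tree s ((40 * m + 2 * D + 4 * D * bitlen (2 * m)) * unit_cost V) (\<lambda>s'.
     \<forall>i\<in>{1..<2*m}. arr s' a_rtree i = arr s a_ptree 1 mod arr s a_ltree i)"
proof -
  let ?K = "unit_cost V"
  let ?b = "Less (Reg r_idx) (Num 2 \<otimes> Reg r_leaves)"
  define c where "c = Store a_rtree (Reg r_idx)
    (Arr a_rtree (Reg r_idx \<oslash> Num 2) \<odot> Arr a_ltree (Reg r_idx))"
  let ?c = "c ;; incr r_idx"
  define T where "T = arr s a_ltree"
  define q where "q = arr s a_ptree 1"
  define I where "I k s' \<longleftrightarrow> reg s' r_idx = k + 2 \<and>
     (\<forall>i\<in>{1..<k+2}. arr s' a_rtree i = q mod T i)" for k and s' :: state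
  have Tpos: "0 < T i" "i * bitlen (T i) \<le> D" if "i \<in> {1..<2*m}" for i
    using tree(1)[OF that] by (auto simp: T_def)
  have Tdvd: "T i dvd T (i div 2)" if "i \<in> {2..<2*m}" for i
  proof -
    have "i div 2 \<in> {1..<m}" "i = 2 * (i div 2) \<or> i = 2 * (i div 2) + 1" using that by auto
    then show ?thesis using tree(2)[of "i div 2"] unfolding T_def by (metis dvd_triv_left dvd_triv_right)
  qed
  have step: "runs \<alpha> ?c s' ((13 + 4 * D div (k + 2)) * ?K) (I (Suc k))"
    if k: "k < 2 * m - 2" and I: "I k s'" and A: "arr s' a_ltree = T" for k and s' :: state
  proof -
    define i where "i = k + 2"
    have i: "i \<in> {2..<2*m}" "i div 2 \<in> {1..<2*m}" "i \<in> {1..<2*m}" "i div 2 \<in> {1..<k+2}"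
      using k by (auto simp: i_def)
    let ?x = "arr s' a_rtree (i div 2)" and ?y = "T i"
    define l where "l = bitlen ?x + bitlen ?y"
    have x: "?x = q mod T (i div 2)" using I i(4) by (auto simp: I_def)
    then have "?x \<le> T (i div 2)" using Tpos(1)[OF i(2)] by simp
    then have "(i div 2) * bitlen ?x \<le> D"
      using Tpos(2)[OF i(2)] bitlen_mono by (meson le_trans mult_le_mono2)
    \<comment> \<open>The extreme case is \<open>i = 3\<close>. In terms of \<open>i\<close>, the
      parent's remainder thus accounts for \<open>3 * D\<close> and the node for \<open>D\<close>,
      which is the origin of \<open>4 * D\<close>.\<close>
    moreover have "i \<le> 3 * (i div 2)" using i(1) by auto
    then have "i * bitlen ?x \<le> 3 * (i div 2) * bitlen ?x" by (rule mult_le_mono1)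
    ultimately have "i * l \<le> 4 * D"
      using Tpos(2)[OF i(3)] unfolding l_def add_mult_distrib2 by linarith
    then have l: "l \<le> 4 * D div i" using i(1) by (simp add: less_eq_div_iff_mult_less_eq mult.commute)
    have "l \<le> i * l" using i(1) by simp
    then have lV: "l + 1 \<le> V" using \<open>i * l \<le> 4 * D\<close> V(2) by linarith
    have "runs \<alpha> ?c s' ((1 + 3 + 1 + 4 + l) * ?K + csize (incr r_idx) * ?K) (I (Suc k))"
    proof (rule runs_seq)
      let ?P = "\<lambda>s'' :: state. reg s'' r_idx = i \<and> (\<forall>j\<in>{1..<k+3}. arr s'' a_rtree j = q mod T j)"
      have "?x mod ?y = q mod ?y" unfolding x using Tdvd[OF i(1)] by (rule mod_mod_cancel)
      moreover have "{1..<k+3} = insert i {1..<k+2}" by (auto simp: i_def)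
      moreover have bl: "bitlen (?x mod ?y) \<le> l"
        using bitlen_mono[OF mod_less_eq_dividend[of ?x ?y]] by (simp add: l_def)
      moreover have "i + 1 \<le> V" using i V by auto
      ultimately have "runs \<alpha> c s' ((asize (Reg r_idx) + asize (Reg r_idx \<oslash> Num 2)
          + asize (Reg r_idx) + 4 + l) * ?K) ?P"
        unfolding c_def using I A V lV by (intro runs_big_store) (auto simp: I_def i_def l_def)
      then show "runs \<alpha> c s' ((1 + 3 + 1 + 4 + l) * ?K) ?P" by simp
      fix s'' assume "?P s''"
      then show "runs \<alpha> (incr r_idx) s'' (csize (incr r_idx) * ?K) (I (Suc k))"
        using i V by (intro runs_wp) (auto simp: I_def i_def)
    qed
    then show ?thesis
      unfolding i_def[symmetric]
      by (rule runs_mono) (use mult_le_mono1[OF l, of ?K] in \<open>auto simp: algebra_simps\<close>)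
  qed
  let ?init = "Store a_rtree (Num 1) (Arr a_ptree (Num 1) \<odot> Arr a_ltree (Num 1))"
  let ?W = "(\<Sum>k<2*m-2. (13 + 4 * D div (k + 2)) * ?K + 5 * ?K + 1) + 5 * ?K + 1"
  have "runs \<alpha> rem_tree s ((7 + 2 * D) * ?K + (csize (Assign r_idx (Num 2)) * ?K + ?W)) (I (2 * m - 2))"
    unfolding rem_tree_def c_def[symmetric]
  proof (rule runs_seq)
    have one: "1 \<in> {1..<2*m}" using m(2) by auto
    define l where "l = bitlen q + bitlen (T 1)"
    have l: "l \<le> 2 * D" using Tpos(2)[OF one] Q by (simp add: l_def q_def)
    have bl: "bitlen (q mod T 1) \<le> l"
      using bitlen_mono[OF mod_less_eq_dividend[of q "T 1"]] by (simp add: l_def)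
    have "runs \<alpha> ?init s ((asize (Num 1) + asize (Num 1) + asize (Num 1) + 4 + l) * ?K)
         (\<lambda>s'. arr s' a_rtree 1 = q mod T 1)"
      using V bl l by (intro runs_big_store) (auto simp: l_def q_def T_def)
    then show "runs \<alpha> ?init s ((7 + 2 * D) * ?K) (\<lambda>s'. arr s' a_rtree 1 = q mod T 1)"
      by (rule runs_mono) (use l in auto)
    fix s1 assume s1: "arr s1 a_rtree 1 = q mod T 1" and fr1: "frame ?init s s1"
    show "runs \<alpha> (Assign r_idx (Num 2) ;; While ?b ?c) s1
        (csize (Assign r_idx (Num 2)) * ?K + ?W) (I (2 * m - 2))"
    proof (rule runs_seq)
      show "runs \<alpha> (Assign r_idx (Num 2)) s1 (csize (Assign r_idx (Num 2)) * ?K) (I 0)"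
        using s1 V by (intro runs_wp) (auto simp: I_def)
      fix s2 assume I0: "I 0 s2" and fr2: "frame (Assign r_idx (Num 2)) s1 s2"
      have s2: "reg s2 r_leaves = m" "arr s2 a_ltree = T"
        using fr1 fr2 m by (auto simp: frame_def T_def)
      from I0 show "runs \<alpha> (While ?b ?c) s2 ?W (I (2 * m - 2))"
      proof (rule runs_for)
        fix k t assume k: "k < 2 * m - 2" and t: "I k t" and fr: "frame (While ?b ?c) s2 t"
        have t': "reg t r_leaves = m" "arr t a_ltree = T"
          using fr s2 by (auto simp: frame_def c_def)
        have "bcost t ?b \<le> bsize ?b * ?K"
          using t t' k V by (intro bcost_small) (auto simp: I_def)
        then show "bval \<alpha> t ?b \<and> bcost t ?b \<le> 5 * ?K \<and>
            runs \<alpha> ?c t ((13 + 4 * D div (k + 2)) * ?K) (I (Suc k))"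
          using step[OF k t t'(2)] k t t' by (auto simp: I_def)
      next
        fix t assume t: "I (2 * m - 2) t" and fr: "frame (While ?b ?c) s2 t"
        have t': "reg t r_leaves = m" using fr s2 by (auto simp: frame_def c_def)
        have "bcost t ?b \<le> bsize ?b * ?K"
          using t t' V by (intro bcost_small) (auto simp: I_def)
        then show "\<not> bval \<alpha> t ?b \<and> bcost t ?b \<le> 5 * ?K" using t m(2) t' by (auto simp: I_def)
      qed
    qed
  qed
  then show ?thesis
  proof (rule runs_mono)
    have K: "1 \<le> ?K" by (rule unit_cost_pos)
    have "(\<Sum>k<2*m-2. 4 * D div (k + 2)) = (\<Sum>i\<in>(\<lambda>k. k + 2) ` {..<2*m-2}. 4 * D div i)"
      by (subst sum.reindex) (auto simp: inj_on_def)
    also have "\<dots> \<le> (\<Sum>i=1..2*m. 4 * D div i)" by (rule sum_mono2) auto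
    also have "\<dots> \<le> 4 * D * bitlen (2 * m)" by (rule sum_div_le)
    finally have D: "(\<Sum>k<2*m-2. 4 * D div (k + 2)) \<le> 4 * D * bitlen (2 * m)" .
    have "(\<Sum>k<2*m-2. (13 + 4 * D div (k + 2)) * ?K + 5 * ?K + 1)
        \<le> (\<Sum>k<2*m-2. (19 + 4 * D div (k + 2)) * ?K)"
      using K by (intro sum_mono) (simp add: algebra_simps)
    also have "\<dots> = (19 * (2 * m - 2) + (\<Sum>k<2*m-2. 4 * D div (k + 2))) * ?K"
      by (simp add: sum_distrib_right[symmetric] sum.distrib)
    also have "\<dots> \<le> (19 * (2 * m - 2) + 4 * D * bitlen (2 * m)) * ?K"
      using D by (intro mult_le_mono1) simp
    finally have "(7 + 2 * D) * ?K + (csize (Assign r_idx (Num 2)) * ?K + ?W)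
        \<le> (7 + 2 * D) * ?K + (19 * (2 * m - 2) + 4 * D * bitlen (2 * m)) * ?K + 8 * ?K"
      using K by simp
    also have "\<dots> = (15 + 2 * D + 19 * (2 * m - 2) + 4 * D * bitlen (2 * m)) * ?K"
      by (simp add: algebra_simps)
    also have "\<dots> \<le> (40 * m + 2 * D + 4 * D * bitlen (2 * m)) * ?K"
      using m(2) by (intro mult_le_mono1) simp
    finally show "(7 + 2 * D) * ?K + (csize (Assign r_idx (Num 2)) * ?K + ?W)
        \<le> (40 * m + 2 * D + 4 * D * bitlen (2 * m)) * ?K" .
  qed (use m(2) in \<open>auto simp: I_def T_def q_def\<close>)
qed

section \<open>Splitting the list\<close>

lemma gcd_mod_nat: "gcd y (x mod y) = gcd y (x :: nat)"
  by (metis gcd.commute gcd_red_nat)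

lemma bitlen_pos: "x > 0 \<Longrightarrow> bitlen x > 0"
  using bitlen_le_iff[of x 0] by auto

text \<open>For \<open>0 < y <= x\<close> one has \<open>2 * (x mod y) <= x\<close>, so the product
  of the two registers at least halves in each round and its bit length bounds the rounds.
  \<open>v <= u\<close> makes this true from the start.\<close>

lemma runs_euclid:
  assumes "reg s r_gcd = u" "reg s r_snd = v" "v \<le> u" "u \<le> V"
  shows "runs \<alpha> euclid s ((2 * bitlen V + 1) * (12 * unit_cost V)) (\<lambda>s'. reg s' r_gcd = gcd u v)"
proof -
  let ?K = "unit_cost V"
  let ?b = "Less (Num 0) (Reg r_snd)"
  let ?c = "Assign r_swap (Reg r_gcd \<odot> Reg r_snd) ;; Assign r_gcd (Reg r_snd) ;;
      Assign r_snd (Reg r_swap)"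
  define I where "I s' \<longleftrightarrow> gcd (reg s' r_gcd) (reg s' r_snd) = gcd u v \<and>
    reg s' r_snd \<le> reg s' r_gcd \<and> reg s' r_gcd \<le> V" for s' :: state
  define \<nu> where "\<nu> s' = (if reg s' r_snd = 0 then 0 else bitlen (reg s' r_gcd * reg s' r_snd))"
    for s' :: state
  have "runs \<alpha> euclid s ((\<nu> s + 1) * (8 * ?K + 3 * ?K + 1)) (\<lambda>s'. I s' \<and> \<not> bval \<alpha> s' ?b)"
    unfolding euclid_def
  proof (rule runs_while)
    show "I s" using assms by (simp add: I_def)
  next
    fix s' assume I: "I s'" and b: "bval \<alpha> s' ?b"
    define x y where "x = reg s' r_gcd" and "y = reg s' r_snd"
    have xy: "0 < y" "y \<le> x" "x \<le> V" "gcd x y = gcd u v"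
      using I b by (auto simp: I_def x_def y_def)
    have "bitlen (y * (x mod y)) < bitlen (x * y)" if "0 < x mod y"
    proof -
      have "x = y * (x div y) + x mod y" by simp
      moreover have "y * 1 \<le> y * (x div y)"
        using xy by (intro mult_le_mono2) (simp add: Suc_le_eq div_greater_zero_iff)
      moreover have "x mod y < y" using xy(1) by simp
      ultimately have "2 * (x mod y) \<le> x" by linarith
      then have "y * (2 * (x mod y)) \<le> y * x" by (rule mult_le_mono2)
      then have "2 * (y * (x mod y)) \<le> x * y" by (simp add: mult_ac)
      moreover have "bitlen (2 * (y * (x mod y))) = bitlen (y * (x mod y)) + 1"
        using that xy(1) by (subst compute_floorlog) auto
      ultimately show ?thesis using bitlen_mono by (metis Suc_eq_plus1 Suc_le_eq)
    qed
    moreover have "0 < bitlen (x * y)" using xy by (intro bitlen_pos) auto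
    moreover have "gcd y (x mod y) = gcd u v" using xy(4) gcd_red_nat by metis
    moreover have "x mod y < y" using xy(1) by simp
    moreover from this have "x mod y \<le> V" using xy by linarith
    ultimately have "wp \<alpha> V ?c (\<lambda>s''. I s'' \<and> \<nu> s'' < \<nu> s') s'"
      using xy by (auto simp: I_def \<nu>_def x_def[symmetric] y_def[symmetric])
    from runs_wp[OF this] show "runs \<alpha> ?c s' (8 * ?K) (\<lambda>s''. I s'' \<and> \<nu> s'' < \<nu> s')"
      by (rule runs_mono) simp_all
  next
    fix s' assume "I s'"
    then have "bcost s' ?b \<le> bsize ?b * ?K" by (intro bcost_small) (auto simp: I_def)
    then show "bcost s' ?b \<le> 3 * ?K" by simp
  qed
  then show ?thesis
  proof (rule runs_mono)
    have "\<nu> s \<le> bitlen u + bitlen v"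
      using assms bitlen_mult by (auto simp: \<nu>_def)
    also have "\<dots> \<le> 2 * bitlen V"
      using assms bitlen_mono[of u V] bitlen_mono[of v V] by simp
    finally show "(\<nu> s + 1) * (8 * ?K + 3 * ?K + 1) \<le> (2 * bitlen V + 1) * (12 * ?K)"
      using unit_cost_pos[of V] by (intro mult_le_mono) auto
  qed (auto simp: I_def)
qed

lemma runs_power_rem:
  assumes "reg s r_cur = y" "0 < y" "reg s r_rem = Q mod y" "2 * y \<le> V" "y * y \<le> V"
  shows "runs \<alpha> power_rem s ((16 + 14 * bitlen V) * unit_cost V)
    (\<lambda>s'. \<exists>e\<ge>y. reg s' r_rem = Q ^ e mod y)"
proof -
  let ?K = "unit_cost V"
  let ?b = "Less (Reg r_exp) (Reg r_cur)"
  let ?c = "Assign r_exp (Num 2 \<otimes> Reg r_exp) ;;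
        Assign r_rem (Reg r_rem \<otimes> Reg r_rem \<odot> Reg r_cur)"
  \<comment> \<open>The least exponent with \<open>y <= 2 ^ m\<close>; it is 0 for
    \<open>y = 1\<close>, when the loop is not entered.\<close>
  define m where "m = bitlen (y - 1)"
  define I where "I k s' \<longleftrightarrow> reg s' r_exp = 2 ^ k \<and> reg s' r_rem = Q ^ (2 ^ k) mod y"
    for k and s' :: state
  have less: "2 ^ k < y \<longleftrightarrow> k < m" for k
    using bitlen_le_iff[of "y - 1" k] assms(2) unfolding m_def by linarith
  have small: "Q ^ k mod y * (Q ^ k mod y) \<le> V" for k
  proof -
    have "Q ^ k mod y * (Q ^ k mod y) \<le> y * y"
      using assms(2) by (intro mult_le_mono) (auto intro: less_imp_le)
    then show ?thesis using assms(5) by linarith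
  qed
  have yV: "y \<le> V" "2 \<le> V" using assms by auto
  have modV: "Q ^ k mod y \<le> V" for k
    using mod_less_divisor[OF assms(2), of "Q ^ k"] yV(1) by linarith
  have "runs \<alpha> power_rem s (csize (Assign r_exp (Num 1)) * ?K
      + (m + 1) * csize (While ?b ?c) * ?K) (I m)"
    unfolding power_rem_def
  proof (rule runs_seq)
    show "runs \<alpha> (Assign r_exp (Num 1)) s (csize (Assign r_exp (Num 1)) * ?K) (I 0)"
      using assms yV by (intro runs_wp) (auto simp: I_def)
    fix s1 assume s1: "I 0 s1" "frame (Assign r_exp (Num 1)) s s1"
    have y1: "reg s1 r_cur = y" using frame_reg[OF s1(2)] assms(1) by simp
    show "runs \<alpha> (While ?b ?c) s1 ((m + 1) * csize (While ?b ?c) * ?K) (I m)"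
    proof (rule runs_for_small)
      show "I 0 s1" by (rule s1)
    next
      fix k t assume k: "k < m" and t: "I k t" and fr: "frame (While ?b ?c) s1 t"
      have y: "reg t r_cur = y" using frame_reg[OF fr] y1 by simp
      have "Q ^ (2 ^ k) mod y * (Q ^ (2 ^ k) mod y) mod y = Q ^ (2 ^ Suc k) mod y"
        by (simp add: mod_mult_eq power_add[symmetric] mult_2)
      moreover have "2 ^ k < y" using k less by blast
      ultimately show "bval \<alpha> t ?b \<and> bsmall V t ?b \<and> wp \<alpha> V ?c (I (Suc k)) t"
        using t y assms(4) yV small[of "2 ^ k"] modV[of "2 ^ k"] by (auto simp: I_def)
    next
      fix t assume t: "I m t" and fr: "frame (While ?b ?c) s1 t"
      have y: "reg t r_cur = y" using frame_reg[OF fr] y1 by simp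
      have "2 ^ m \<le> 2 * y"
      proof (cases m)
        case 0 then show ?thesis using assms(2) by simp
      next
        case (Suc j) then show ?thesis using less[of j] by simp
      qed
      then show "\<not> bval \<alpha> t ?b \<and> bsmall V t ?b"
        using t y less[of m] assms(4) yV by (auto simp: I_def)
    qed
  qed
  then show ?thesis
  proof (rule runs_mono)
    have "m \<le> bitlen V" unfolding m_def using yV by (intro bitlen_mono) simp
    then have "(m + 1) * 14 * ?K \<le> (14 + 14 * bitlen V) * ?K"
      by (intro mult_le_mono1) simp
    moreover have "csize (While ?b ?c) = 14" "csize (Assign r_exp (Num 1)) = 2" by simp_all
    ultimately show "csize (Assign r_exp (Num 1)) * ?K + (m + 1) * csize (While ?b ?c) * ?K
        \<le> (16 + 14 * bitlen V) * ?K"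
      by (simp only: distrib_right)
    show "\<exists>e\<ge>y. reg s' r_rem = Q ^ e mod y" if "I m s'" for s'
      using that less[of m] unfolding I_def by (metis less_irrefl not_le)
  qed
qed

text \<open>The exponent is a parameter because the program picks some power of 2; for a positive
  entry, every exponent from the entry upwards gives the same quotient.\<close>

definition split_result :: "nat \<Rightarrow> nat \<Rightarrow> nat \<Rightarrow> (nat \<Rightarrow> nat) \<Rightarrow> nat \<Rightarrow> (nat \<Rightarrow> nat) \<Rightarrow> nat \<Rightarrow> bool" where
  "split_result Q e i A len A' len' \<longleftrightarrow>
     (let a = gcd (A i) Q; b = A i div gcd (A i) (Q ^ e) in
      if a = 1 then A' = A \<and> len' = len
      else if b = 1 then A' = A(i := a) \<and> len' = len
      else A' = A(i := a, len := b) \<and> len' = Suc len)"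

lemma runs_split_entry:
  assumes i: "reg s r_idx = i" "reg s r_len = len" "reg s r_leaves = m"
    and y: "arr s a_list i = y" "0 < y" and rem: "arr s a_rtree (m + i) = Q mod y"
    and V: "2 * y \<le> V" "y * y \<le> V" "m + i \<le> V" "len + 1 \<le> V"
  shows "runs \<alpha> split_entry s (160 * bitlen V * unit_cost V)
    (\<lambda>s'. \<exists>e\<ge>y. split_result Q e i (arr s a_list) len (arr s' a_list) (reg s' r_len))"
proof -
  let ?K = "unit_cost V"
  let ?E = "(2 * bitlen V + 1) * (12 * ?K)"
  let ?c1 = "Assign r_cur (Arr a_list (Reg r_idx)) ;;
      Assign r_rem (Arr a_rtree (Reg r_leaves \<oplus> Reg r_idx)) ;;
      Assign r_gcd (Reg r_cur) ;; Assign r_snd (Reg r_rem)"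
  let ?c2 = "Assign r_gcd (Reg r_cur) ;; Assign r_snd (Reg r_rem)"
  let ?c3 = "Store a_list (Reg r_idx) (Reg r_in) ;;
        Assign r_out (Reg r_cur \<oslash> Reg r_gcd) ;;
        Cond (Less (Num 1) (Reg r_out))
          (Store a_list (Reg r_len) (Reg r_out) ;; incr r_len) Skip"
  let ?b = "Less (Num 1) (Reg r_in)"
  let ?Q = "\<lambda>s'. \<exists>e\<ge>y. split_result Q e i (arr s a_list) len (arr s' a_list) (reg s' r_len)"
  define a where "a = gcd y Q"
  have yV: "y \<le> V" "2 \<le> V" "i \<le> V" "m \<le> V" "len \<le> V" using V y by auto
  have modV: "x mod y \<le> V" for x
    using mod_less_divisor[OF y(2), of x] yV(1) by linarith
  have gV: "gcd y x \<le> V" for x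
    using gcd_le1_nat[of y x] y(2) yV(1) by linarith
  have common: "reg t r_cur = y \<and> reg t r_idx = i \<and> reg t r_len = len \<and> arr t a_list = arr s a_list"
    if "frame d s' t" "wregs d \<inter> {r_cur, r_idx, r_len} = {}" "a_list \<notin> warrs d"
      "reg s' r_cur = y \<and> reg s' r_idx = i \<and> reg s' r_len = len \<and> arr s' a_list = arr s a_list"
    for d s' t
    using that frame_reg[OF that(1)] frame_arr[OF that(1)] by auto
  have "runs \<alpha> split_entry s (csize ?c1 * ?K + (?E + (csize (Assign r_in (Reg r_gcd)) * ?K
      + (3 * ?K + ((16 + 14 * bitlen V) * ?K + (csize ?c2 * ?K + (?E + csize ?c3 * ?K))) + 1)))) ?Q"
    unfolding split_entry_def
  proof (rule runs_seq)
    let ?P1 = "\<lambda>t :: state. (reg t r_cur = y \<and> reg t r_idx = i \<and> reg t r_len = len \<and>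
        arr t a_list = arr s a_list) \<and> reg t r_rem = Q mod y \<and> reg t r_gcd = y \<and> reg t r_snd = Q mod y"
    show "runs \<alpha> ?c1 s (csize ?c1 * ?K) ?P1"
      using assms yV modV by (intro runs_wp) auto
    fix s1 assume s1: "?P1 s1"
    show "runs \<alpha> (euclid ;; Assign r_in (Reg r_gcd) ;;
        Cond ?b (power_rem ;; ?c2 ;; euclid ;; ?c3) Skip) s1 (?E + (csize (Assign r_in (Reg r_gcd)) * ?K
      + (3 * ?K + ((16 + 14 * bitlen V) * ?K + (csize ?c2 * ?K + (?E + csize ?c3 * ?K))) + 1))) ?Q"
    proof (rule runs_seq)
      show "runs \<alpha> euclid s1 ?E (\<lambda>t. reg t r_gcd = a)"
        unfolding a_def gcd_mod_nat[of y Q, symmetric]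
        using s1 y(2) yV by (intro runs_euclid) auto
      fix s2 assume s2: "reg s2 r_gcd = a" and fr2: "frame euclid s1 s2"
      have c2: "reg s2 r_cur = y \<and> reg s2 r_idx = i \<and> reg s2 r_len = len \<and> arr s2 a_list = arr s a_list"
        using s1 by (intro common[OF fr2]) (auto simp: euclid_def)
      have r2: "reg s2 r_rem = Q mod y" using s1 frame_reg[OF fr2] by (simp add: euclid_def)
      show "runs \<alpha> (Assign r_in (Reg r_gcd) ;; Cond ?b (power_rem ;; ?c2 ;; euclid ;; ?c3) Skip) s2
          (csize (Assign r_in (Reg r_gcd)) * ?K
          + (3 * ?K + ((16 + 14 * bitlen V) * ?K + (csize ?c2 * ?K + (?E + csize ?c3 * ?K))) + 1)) ?Q"
      proof (rule runs_seq)
        let ?P3 = "\<lambda>t :: state. (reg t r_cur = y \<and> reg t r_idx = i \<and> reg t r_len = len \<and>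
          arr t a_list = arr s a_list) \<and> reg t r_rem = Q mod y \<and> reg t r_in = a"
        show "runs \<alpha> (Assign r_in (Reg r_gcd)) s2 (csize (Assign r_in (Reg r_gcd)) * ?K) ?P3"
          using s2 c2 r2 gV by (intro runs_wp) (auto simp: a_def)
        fix s3 assume s3: "?P3 s3"
        show "runs \<alpha> (Cond ?b (power_rem ;; ?c2 ;; euclid ;; ?c3) Skip) s3
          (3 * ?K + ((16 + 14 * bitlen V) * ?K + (csize ?c2 * ?K + (?E + csize ?c3 * ?K))) + 1) ?Q"
        proof (rule runs_cond)
          have "bcost s3 ?b \<le> bsize ?b * ?K"
            using s3 yV gV by (intro bcost_small) (auto simp: a_def)
          then show "bcost s3 ?b \<le> 3 * ?K" by simp
        next
          assume "\<not> bval \<alpha> s3 ?b"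
          moreover have "a > 0" using y(2) by (simp add: a_def)
          ultimately have "a = 1" using s3 by auto
          \<comment> \<open>No power has been computed in this branch. With gcd 1 the relation does
            not look at the exponent, so \<open>y\<close> serves as witness.\<close>
          then have "split_result Q y i (arr s a_list) len (arr s3 a_list) (reg s3 r_len)"
            using s3 y by (simp add: split_result_def a_def)
          then have "runs \<alpha> Skip s3 (csize Skip * ?K) ?Q" by (intro runs_wp) auto
          then show "runs \<alpha> Skip s3
              ((16 + 14 * bitlen V) * ?K + (csize ?c2 * ?K + (?E + csize ?c3 * ?K))) ?Q"
            by (rule runs_mono) (auto simp: algebra_simps)
        next
          assume "bval \<alpha> s3 ?b"
          then have a1: "a > 1" using s3 by auto
          show "runs \<alpha> (power_rem ;; ?c2 ;; euclid ;; ?c3) s3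
              ((16 + 14 * bitlen V) * ?K + (csize ?c2 * ?K + (?E + csize ?c3 * ?K))) ?Q"
          proof (rule runs_seq)
            show "runs \<alpha> power_rem s3 ((16 + 14 * bitlen V) * ?K)
                (\<lambda>t. \<exists>e\<ge>y. reg t r_rem = Q ^ e mod y)"
              using s3 y V by (intro runs_power_rem) auto
            fix s4 assume "\<exists>e\<ge>y. reg s4 r_rem = Q ^ e mod y" and fr4: "frame power_rem s3 s4"
            then obtain e where e: "e \<ge> y" "reg s4 r_rem = Q ^ e mod y" by blast
            have c4: "reg s4 r_cur = y \<and> reg s4 r_idx = i \<and> reg s4 r_len = len \<and>
                arr s4 a_list = arr s a_list"
              using s3 by (intro common[OF fr4]) (auto simp: power_rem_def)
            have a4: "reg s4 r_in = a" using s3 frame_reg[OF fr4] by (simp add: power_rem_def)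
            show "runs \<alpha> (?c2 ;; euclid ;; ?c3) s4 (csize ?c2 * ?K + (?E + csize ?c3 * ?K)) ?Q"
            proof (rule runs_seq)
              let ?P5 = "\<lambda>t :: state. (reg t r_cur = y \<and> reg t r_idx = i \<and> reg t r_len = len \<and>
                arr t a_list = arr s a_list) \<and> reg t r_in = a \<and>
                reg t r_gcd = y \<and> reg t r_snd = Q ^ e mod y"
              show "runs \<alpha> ?c2 s4 (csize ?c2 * ?K) ?P5"
                using c4 a4 e yV modV by (intro runs_wp) auto
              fix s5 assume s5: "?P5 s5"
              show "runs \<alpha> (euclid ;; ?c3) s5 (?E + csize ?c3 * ?K) ?Q"
              proof (rule runs_seq)
                show "runs \<alpha> euclid s5 ?E (\<lambda>t. reg t r_gcd = gcd y (Q ^ e))"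
                  unfolding gcd_mod_nat[of y "Q ^ e", symmetric]
                  using s5 y(2) yV by (intro runs_euclid) auto
                fix s6 assume s6: "reg s6 r_gcd = gcd y (Q ^ e)" and fr6: "frame euclid s5 s6"
                have c6: "reg s6 r_cur = y \<and> reg s6 r_idx = i \<and> reg s6 r_len = len \<and>
                    arr s6 a_list = arr s a_list"
                  using s5 by (intro common[OF fr6]) (auto simp: euclid_def)
                have a6: "reg s6 r_in = a" using s5 frame_reg[OF fr6] by (simp add: euclid_def)
                define b where "b = y div gcd y (Q ^ e)"
                have "b \<le> y" unfolding b_def by (rule div_le_dividend)
                then have b: "b \<le> V" using yV(1) by linarith
                have b0: "b > 0" using y(2) by (simp add: b_def div_greater_zero_iff gcd_le1_nat)
                have aV: "a \<le> V" unfolding a_def by (rule gV)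
                have res: "split_result Q e i (arr s a_list) len A' len' \<longleftrightarrow>
                    (if b = 1 then A' = (arr s a_list)(i := a) \<and> len' = len
                     else A' = (arr s a_list)(i := a, len := b) \<and> len' = Suc len)" for A' len'
                  using a1 y(1) by (simp add: split_result_def Let_def a_def b_def)
                have "wp \<alpha> V ?c3
                    (\<lambda>t. split_result Q e i (arr s a_list) len (arr t a_list) (reg t r_len)) s6"
                  using c6 a6 s6 yV gV V aV b b0 unfolding res
                  by (auto simp: b_def[symmetric])
                then have "runs \<alpha> ?c3 s6 (csize ?c3 * ?K)
                    (\<lambda>t. split_result Q e i (arr s a_list) len (arr t a_list) (reg t r_len))"
                  by (rule runs_wp)
                then show "runs \<alpha> ?c3 s6 (csize ?c3 * ?K) ?Q"
                  by (rule runs_mono) (use e in auto)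
              qed
            qed
          qed
        qed
      qed
    qed
  qed
  then show ?thesis
  proof (rule runs_mono)
    have "1 \<le> bitlen V" using bitlen_pos[of V] yV by simp
    then have K: "?K \<le> bitlen V * ?K" "1 \<le> ?K" using unit_cost_pos[of V] by auto
    have cs: "csize ?c1 = 12" "csize ?c2 = 4" "csize ?c3 = 19" "csize (Assign r_in (Reg r_gcd)) = 2"
      by simp_all
    show "csize ?c1 * ?K + (?E + (csize (Assign r_in (Reg r_gcd)) * ?K
      + (3 * ?K + ((16 + 14 * bitlen V) * ?K + (csize ?c2 * ?K + (?E + csize ?c3 * ?K))) + 1)))
      \<le> 160 * bitlen V * ?K"
      unfolding cs distrib_right mult.assoc mult_1 using K by linarith
  qed
qed

text \<open>The invariant of the whole list. \<open>c\<close> will be the divisibility counts of the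
  input, so the counts of all primes are preserved. \<open>M\<close> will be the maximum of the
  input; that it still bounds the entries is what makes the final ones prime.\<close>

definition factors :: "(nat \<Rightarrow> nat) \<Rightarrow> nat \<Rightarrow> nat \<Rightarrow> (nat \<Rightarrow> nat) \<Rightarrow> nat \<Rightarrow> bool" where
  "factors c W M A len \<longleftrightarrow>
     (\<forall>i<len. 0 < A i \<and> A i \<le> M) \<and>
     (\<forall>p. prime p \<longrightarrow> (\<Sum>i<len. of_bool (p dvd A i)) = c p) \<and>
     (\<Sum>i<len. weight (A i)) \<le> W"

lemma factors_length: "factors c W M A len \<Longrightarrow> len \<le> W"
proof -
  assume "factors c W M A len"
  then have "(\<Sum>i<len. weight (A i)) \<le> W" by (simp add: factors_def)
  moreover have "(\<Sum>i<len. 1) \<le> (\<Sum>i<len. weight (A i))"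
    by (intro sum_mono) (simp add: weight_def)
  ultimately show ?thesis by simp
qed

text \<open>The removed term is added on the left, which avoids truncated subtraction.\<close>

lemma sum_fun_upd_lessThan:
  fixes f A :: "nat \<Rightarrow> nat" and i len :: nat
  assumes "i < len"
  shows "(\<Sum>j<len. f ((A(i := a)) j)) + f (A i) = (\<Sum>j<len. f (A j)) + f a"
proof -
  have "(\<Sum>j<len. f ((A(i := a)) j)) = f a + (\<Sum>j\<in>{..<len} - {i}. f ((A(i := a)) j))"
    using assms by (subst sum.remove[of _ i]) auto
  moreover have "(\<Sum>j\<in>{..<len} - {i}. f ((A(i := a)) j)) = (\<Sum>j\<in>{..<len} - {i}. f (A j))"
    by (rule sum.cong) auto
  moreover have "(\<Sum>j<len. f (A j)) = f (A i) + (\<Sum>j\<in>{..<len} - {i}. f (A j))"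
    using assms by (subst sum.remove[of _ i]) auto
  ultimately show ?thesis by simp
qed

text \<open>Each prime of the entry divides exactly one of the two parts, and their weights add up
  to no more than the old one. A part \<open>b = 1\<close> counts for no prime and must be dropped:
  appending it would add weight 1 and could break the bound \<open>W\<close>.\<close>

lemma split_result_step:
  assumes fac: "factors c W M A len" and i: "i < len" and e: "e \<ge> A i"
    and sep: "separated S J (A i)"
    and res: "split_result (digit_prod S J) e i A len A' len'"
  shows "factors c W M A' len' \<and> len \<le> len' \<and> (\<forall>j<len. j \<noteq> i \<longrightarrow> A' j = A j) \<and>
    separated S (Suc J) (A' i) \<and> (\<forall>j. len \<le> j \<and> j < len' \<longrightarrow> separated S (Suc J) (A' j))"
proof -
  define y a b where "y = A i" and "a = gcd y (digit_prod S J)"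
    and "b = y div gcd y (digit_prod S J ^ e)"
  have y: "0 < y" "y \<le> M" "y \<le> e" using fac i e by (auto simp: factors_def y_def)
  note ab = split_pos[OF y(1,3), of S J, folded a_def b_def]
    split_mult_le[OF y(1,3), of S J, folded a_def b_def]
  have dvd: "a dvd y" "b dvd y"
    using split_dvd[OF y(1,3), of S J] by (simp_all add: a_def b_def)
  have le: "a \<le> y" "b \<le> y" using dvd y(1) dvd_imp_le by auto
  have one: "of_bool (p dvd a) + of_bool (p dvd b) = (of_bool (p dvd y) :: nat)" if "prime p" for p
    using prime_dvd_split_fst[OF y(1,3) that, of S J] prime_dvd_split_snd[OF y(1,3) that, of S J]
    unfolding a_def b_def by auto
  have fsep: "separated S (Suc J) a" and ssep: "separated S (Suc J) b"
    using separated_split_fst[OF y(1,3), of S J] separated_split_snd[OF y(1,3), of S J] sep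
    by (simp_all add: a_def b_def y_def)
  have res': "if a = 1 then A' = A \<and> len' = len
      else if b = 1 then A' = A(i := a) \<and> len' = len
      else A' = A(i := a, len := b) \<and> len' = Suc len"
    using res by (simp add: split_result_def Let_def a_def b_def y_def)
  consider "a = 1" | "a > 1" "b = 1" | "a > 1" "b > 1" using ab by linarith
  then show ?thesis
  proof cases
    case 1
    then have "separated S (Suc J) y"
      using separated_no_split[OF y(1,3), of S J] sep by (simp add: a_def y_def)
    then show ?thesis using 1 res' fac by (auto simp: y_def)
  next
    case 2
    then have A': "A' = A(i := a)" "len' = len" using res' by auto
    have "(\<Sum>j<len. of_bool (p dvd A' j)) = c p" if p: "prime p" for p
    proof -
      have "(\<Sum>j<len. of_bool (p dvd A j)) = c p" using fac p by (simp add: factors_def)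
      moreover have "\<not> p dvd b" using 2 p by auto
      ultimately show ?thesis
        using sum_fun_upd_lessThan[OF i, of "\<lambda>z. of_bool (p dvd z)" A a] one[OF p]
        unfolding A' y_def by simp
    qed
    moreover have "(\<Sum>j<len. weight (A' j)) \<le> W"
      using sum_fun_upd_lessThan[OF i, of weight A a] weight_mono[OF le(1)] fac
      unfolding A' factors_def y_def by linarith
    moreover have "\<forall>j<len. 0 < A' j \<and> A' j \<le> M"
      using fac le y ab unfolding factors_def A' by auto
    ultimately show ?thesis using fsep unfolding factors_def A' by auto
  next
    case 3
    then have A': "A' = A(i := a, len := b)" "len' = Suc len" using res' by auto
    have sum: "(\<Sum>j<Suc len. f (A' j)) + f y = (\<Sum>j<len. f (A j)) + f a + f b" for f :: "nat \<Rightarrow> nat"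
    proof -
      have "(\<Sum>j<len. f (A' j)) = (\<Sum>j<len. f ((A(i := a)) j))" unfolding A' by (rule sum.cong) auto
      moreover have "(\<Sum>j<Suc len. f (A' j)) = (\<Sum>j<len. f (A' j)) + f b" by (simp add: A')
      ultimately show ?thesis using sum_fun_upd_lessThan[OF i, of f A a] unfolding y_def by linarith
    qed
    have "(\<Sum>j<len'. of_bool (p dvd A' j)) = c p" if p: "prime p" for p
    proof -
      have "(\<Sum>j<len. of_bool (p dvd A j)) = c p" using fac p by (simp add: factors_def)
      then show ?thesis
        using sum[of "\<lambda>z. of_bool (p dvd z)"] one[OF p] unfolding A'(2) by linarith
    qed
    moreover have "(\<Sum>j<len'. weight (A' j)) \<le> W"
      using sum[of weight] weight_split[OF 3 ab(3)] fac unfolding A'(2) factors_def by linarith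
    moreover have "\<forall>j<len'. 0 < A' j \<and> A' j \<le> M"
      using fac le y ab unfolding factors_def A' by (auto simp: less_Suc_eq)
    ultimately show ?thesis using fsep ssep i unfolding factors_def A' by (auto simp: less_Suc_eq)
  qed
qed

text \<open>Only the first \<open>m\<close> entries have remainders in the tree. Round
  \<open>k\<close> changes no other of them, so those still ahead keep matching their remainders.
  The parts appended from \<open>m\<close> on come out of a split and are separated on arrival, so
  the loop does not visit them.\<close>

lemma runs_split_list:
  assumes fac: "factors c W M (arr s a_list) m" and m: "reg s r_len = m" "reg s r_leaves = m"
    and rem: "\<And>i. i < m \<Longrightarrow> arr s a_rtree (m + i) = digit_prod S J mod arr s a_list i"
    and sep: "\<And>i. i < m \<Longrightarrow> separated S J (arr s a_list i)"
    and V: "2 * M \<le> V" "M * M \<le> V" "2 * W + 1 \<le> V"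
  shows "runs \<alpha> split_list s ((m + 1) * (170 * bitlen V) * unit_cost V) (\<lambda>s'. m \<le> reg s' r_len \<and>
    factors c W M (arr s' a_list) (reg s' r_len) \<and>
    (\<forall>i<reg s' r_len. separated S (Suc J) (arr s' a_list i)))"
proof -
  let ?K = "unit_cost V"
  let ?b = "Less (Reg r_idx) (Reg r_leaves)"
  let ?c = "split_entry ;; incr r_idx"
  let ?Q = "digit_prod S J"
  define I where "I k t \<longleftrightarrow> reg t r_idx = k \<and> m \<le> reg t r_len \<and>
    factors c W M (arr t a_list) (reg t r_len) \<and>
    (\<forall>j. k \<le> j \<and> j < m \<longrightarrow> arr t a_list j = arr s a_list j) \<and>
    (\<forall>j<reg t r_len. j < k \<or> m \<le> j \<longrightarrow> separated S (Suc J) (arr t a_list j))"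
    for k and t :: state
  have mW: "m \<le> W" using factors_length[OF fac] .
  have wr: "r_idx \<notin> wregs split_entry" "r_leaves \<notin> wregs split_entry" "a_rtree \<notin> warrs split_entry"
    by (simp_all add: split_entry_def euclid_def power_rem_def)
  have step: "runs \<alpha> ?c t (160 * bitlen V * ?K + csize (incr r_idx) * ?K) (I (Suc k))"
    if k: "k < m" and I: "I k t" and lv: "reg t r_leaves = m" and R: "arr t a_rtree = arr s a_rtree"
    for k t
  proof (rule runs_seq)
    let ?len = "reg t r_len" and ?y = "arr t a_list k"
    have y: "?y = arr s a_list k" "k < ?len" using I k by (auto simp: I_def)
    have fact: "factors c W M (arr t a_list) ?len" using I by (simp add: I_def)
    have yM: "0 < ?y" "?y \<le> M" using fact y(2) by (auto simp: factors_def)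
    have "?y * ?y \<le> M * M" using yM by (intro mult_le_mono)
    then have "?y * ?y \<le> V" "2 * ?y \<le> V" using V yM by auto
    moreover have "?len \<le> W" using factors_length[OF fact] .
    ultimately show "runs \<alpha> split_entry t (160 * bitlen V * ?K)
      (\<lambda>s'. \<exists>e\<ge>?y. split_result ?Q e k (arr t a_list) ?len (arr s' a_list) (reg s' r_len))"
      using I k lv R y rem[OF k] V(3) mW yM(1)
      by (intro runs_split_entry[where m = m]) (auto simp: I_def)
    fix u
    assume "\<exists>e\<ge>?y. split_result ?Q e k (arr t a_list) ?len (arr u a_list) (reg u r_len)"
      and fr: "frame split_entry t u"
    then obtain e where e: "e \<ge> ?y"
      "split_result ?Q e k (arr t a_list) ?len (arr u a_list) (reg u r_len)" by blast
    have uk: "reg u r_idx = k" using frame_reg[OF fr wr(1)] I by (simp add: I_def)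
    have "separated S J ?y" using sep[OF k] y(1) by simp
    from split_result_step[OF fact y(2) e(1) this e(2)]
    have *: "factors c W M (arr u a_list) (reg u r_len)" "?len \<le> reg u r_len"
      "\<forall>j<?len. j \<noteq> k \<longrightarrow> arr u a_list j = arr t a_list j"
      "separated S (Suc J) (arr u a_list k)"
      "\<forall>j. ?len \<le> j \<and> j < reg u r_len \<longrightarrow> separated S (Suc J) (arr u a_list j)" by auto
    have "separated S (Suc J) (arr u a_list j)" if "j < reg u r_len" "j < Suc k \<or> m \<le> j" for j
    proof (cases "j = k \<or> ?len \<le> j")
      case True
      then show ?thesis using *(4,5) that(1) by auto
    next
      case False
      then have "j < ?len" "j < k \<or> m \<le> j" "j \<noteq> k" using that k by auto
      then show ?thesis using *(3) I unfolding I_def by metis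
    qed
    moreover have "\<forall>j. Suc k \<le> j \<and> j < m \<longrightarrow> arr u a_list j = arr s a_list j"
      using *(3) I by (auto simp: I_def)
    ultimately have "wp \<alpha> V (incr r_idx) (I (Suc k)) u"
      using * I uk k mW V(3) by (auto simp: I_def)
    then show "runs \<alpha> (incr r_idx) u (csize (incr r_idx) * ?K) (I (Suc k))" by (rule runs_wp)
  qed
  let ?T = "(\<Sum>k<m. 160 * bitlen V * ?K + csize (incr r_idx) * ?K + 3 * ?K + 1) + 3 * ?K + 1"
  have "runs \<alpha> split_list s (csize (Assign r_idx (Num 0)) * ?K + ?T) (I m)"
    unfolding split_list_def
  proof (rule runs_seq)
    show "runs \<alpha> (Assign r_idx (Num 0)) s (csize (Assign r_idx (Num 0)) * ?K) (I 0)"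
      using m fac by (intro runs_wp) (auto simp: I_def)
    fix s1 assume I0: "I 0 s1" and fr1: "frame (Assign r_idx (Num 0)) s s1"
    have s1: "reg s1 r_leaves = m" "arr s1 a_rtree = arr s a_rtree"
      using m frame_reg[OF fr1] frame_arr[OF fr1] by auto
    from I0 show "runs \<alpha> (While ?b ?c) s1 ?T (I m)"
    proof (rule runs_for)
      fix k t assume k: "k < m" and t: "I k t" and fr: "frame (While ?b ?c) s1 t"
      have t': "reg t r_leaves = m" "arr t a_rtree = arr s a_rtree"
        using s1 frame_reg[OF fr] frame_arr[OF fr] wr by auto
      have "bcost t ?b \<le> bsize ?b * ?K"
        using t t' k mW V(3) by (intro bcost_small) (auto simp: I_def)
      then show "bval \<alpha> t ?b \<and> bcost t ?b \<le> 3 * ?K \<and>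
          runs \<alpha> ?c t (160 * bitlen V * ?K + csize (incr r_idx) * ?K) (I (Suc k))"
        using step[OF k t t'] k t t' by (auto simp: I_def)
    next
      fix t assume t: "I m t" and fr: "frame (While ?b ?c) s1 t"
      have t': "reg t r_leaves = m" using s1 frame_reg[OF fr] wr by auto
      have "bcost t ?b \<le> bsize ?b * ?K"
        using t t' mW V(3) by (intro bcost_small) (auto simp: I_def)
      then show "\<not> bval \<alpha> t ?b \<and> bcost t ?b \<le> 3 * ?K" using t t' by (auto simp: I_def)
    qed
  qed
  then show ?thesis
  proof (rule runs_mono)
    have "1 \<le> bitlen V" using bitlen_pos[of V] V(3) by simp
    then have K: "1 \<le> ?K" "?K \<le> bitlen V * ?K" using unit_cost_pos[of V] by auto
    have cs: "csize (incr r_idx) = 4" "csize (Assign r_idx (Num 0)) = 2" by simp_all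
    have le: "160 * bitlen V * ?K + csize (incr r_idx) * ?K + 3 * ?K + 1 \<le> 170 * bitlen V * ?K"
      unfolding cs mult.assoc using K by linarith
    have "?T \<le> m * (170 * bitlen V * ?K) + 3 * ?K + 1"
      using mult_le_mono2[OF le, of m] by simp
    then have "csize (Assign r_idx (Num 0)) * ?K + ?T \<le> m * (170 * bitlen V * ?K) + 6 * ?K"
      using K unfolding cs by linarith
    also have "\<dots> \<le> m * (170 * bitlen V * ?K) + 170 * bitlen V * ?K"
      unfolding mult.assoc using K by linarith
    also have "\<dots> = (m + 1) * (170 * bitlen V) * ?K" by (simp add: algebra_simps)
    finally show "csize (Assign r_idx (Num 0)) * ?K + ?T \<le> (m + 1) * (170 * bitlen V) * ?K" .
  qed (auto simp: I_def)
qed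

section \<open>Filling the leaves of the trees\<close>

lemma runs_list_leaves:
  assumes m: "reg s r_len = m" "2 * m + 2 \<le> V" and small: "\<And>i. i < m \<Longrightarrow> arr s a_list i \<le> V"
  shows "runs \<alpha> list_leaves s (20 * (m + 1) * unit_cost V) (\<lambda>s'. reg s' r_leaves = m \<and>
    (\<forall>i<m. arr s' a_ltree (m + i) = arr s a_list i))"
proof -
  let ?K = "unit_cost V"
  let ?b = "Less (Reg r_idx) (Reg r_leaves)"
  let ?c = "Store a_ltree (Reg r_leaves \<oplus> Reg r_idx) (Arr a_list (Reg r_idx)) ;; incr r_idx"
  let ?init = "Assign r_leaves (Reg r_len) ;; Assign r_idx (Num 0)"
  define I where "I k t \<longleftrightarrow> reg t r_idx = k \<and> reg t r_leaves = m \<and>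
    (\<forall>i<k. arr t a_ltree (m + i) = arr s a_list i)" for k and t :: state
  have "runs \<alpha> list_leaves s (csize ?init * ?K + (m + 1) * csize (While ?b ?c) * ?K) (I m)"
    unfolding list_leaves_def
  proof (rule runs_seq)
    show "runs \<alpha> ?init s (csize ?init * ?K) (I 0)"
      using m by (intro runs_wp) (auto simp: I_def)
    fix s1 assume I0: "I 0 s1" and fr1: "frame ?init s s1"
    have s1: "arr s1 a_list = arr s a_list" using frame_arr[OF fr1] by auto
    from I0 show "runs \<alpha> (While ?b ?c) s1 ((m + 1) * csize (While ?b ?c) * ?K) (I m)"
    proof (rule runs_for_small)
      fix k t assume k: "k < m" and t: "I k t" and fr: "frame (While ?b ?c) s1 t"
      have "arr t a_list = arr s a_list" using s1 frame_arr[OF fr] by auto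
      then show "bval \<alpha> t ?b \<and> bsmall V t ?b \<and> wp \<alpha> V ?c (I (Suc k)) t"
        using k t m small by (auto simp: I_def less_Suc_eq)
    next
      fix t assume "I m t"
      then show "\<not> bval \<alpha> t ?b \<and> bsmall V t ?b" using m by (auto simp: I_def)
    qed
  qed
  then show ?thesis
  proof (rule runs_mono)
    have "csize ?init = 4" "csize (While ?b ?c) = 14" by simp_all
    then show "csize ?init * ?K + (m + 1) * csize (While ?b ?c) * ?K \<le> 20 * (m + 1) * ?K"
      by (simp add: algebra_simps)
  qed (auto simp: I_def)
qed

lemma runs_prime_leaves:
  assumes S: "reg s r_root = S" "2 * S + 2 \<le> V" and J: "reg s r_pow = 2 ^ J" "2 ^ J \<le> S"
    and pr: "\<And>k. k \<in> {1..S} \<Longrightarrow> arr s a_primes k = (if prime k then k else 1)"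
  shows "runs \<alpha> prime_leaves s (40 * (S + 1) * unit_cost V) (\<lambda>s'.
    \<forall>i<S. arr s' a_ptree (S + i) = (if prime (i + 1) \<and> odd ((i + 1) div 2 ^ J) then i + 1 else 1))"
proof -
  let ?K = "unit_cost V"
  let ?b = "Less (Reg r_idx) (Reg r_root)"
  let ?c = "Cond (Less ((Reg r_idx \<oplus> Num 1) \<oslash> Reg r_pow \<odot> Num 2) (Num 1))
          (Store a_ptree (Reg r_root \<oplus> Reg r_idx) (Num 1))
          (Store a_ptree (Reg r_root \<oplus> Reg r_idx) (Arr a_primes (Reg r_idx \<oplus> Num 1))) ;;
        incr r_idx"
  define I where "I k t \<longleftrightarrow> reg t r_idx = k \<and> (\<forall>i<k. arr t a_ptree (S + i) =
    (if prime (i + 1) \<and> odd ((i + 1) div 2 ^ J) then i + 1 else 1))" for k and t :: state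
  have "runs \<alpha> prime_leaves s (csize (Assign r_idx (Num 0)) * ?K + (S + 1) * csize (While ?b ?c) * ?K) (I S)"
    unfolding prime_leaves_def
  proof (rule runs_seq)
    show "runs \<alpha> (Assign r_idx (Num 0)) s (csize (Assign r_idx (Num 0)) * ?K) (I 0)"
      by (intro runs_wp) (auto simp: I_def)
    fix s1 assume I0: "I 0 s1" and fr1: "frame (Assign r_idx (Num 0)) s s1"
    have s1: "arr s1 a_primes = arr s a_primes" "reg s1 r_root = S" "reg s1 r_pow = 2 ^ J"
      using frame_arr[OF fr1] frame_reg[OF fr1] S J by auto
    from I0 show "runs \<alpha> (While ?b ?c) s1 ((S + 1) * csize (While ?b ?c) * ?K) (I S)"
    proof (rule runs_for_small)
      fix k t assume k: "k < S" and t: "I k t" and fr: "frame (While ?b ?c) s1 t"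
      have t': "arr t a_primes = arr s a_primes" "reg t r_root = S" "reg t r_pow = 2 ^ J"
        using s1 frame_arr[OF fr] frame_reg[OF fr] by auto
      have "arr s a_primes (Suc k) = (if prime (Suc k) then Suc k else 1)" using pr[of "Suc k"] k by simp
      then show "bval \<alpha> t ?b \<and> bsmall V t ?b \<and> wp \<alpha> V ?c (I (Suc k)) t"
        using k t t' S J by (auto simp: I_def less_Suc_eq odd_iff_mod_2_eq_one)
    next
      fix t assume "I S t" and fr: "frame (While ?b ?c) s1 t"
      moreover have "reg t r_root = S" using s1 frame_reg[OF fr] by auto
      ultimately show "\<not> bval \<alpha> t ?b \<and> bsmall V t ?b" using S by (auto simp: I_def)
    qed
  qed
  then show ?thesis
  proof (rule runs_mono)
    have cs: "csize (Assign r_idx (Num 0)) = 2" "csize (While ?b ?c) = 31" by simp_all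
    show "csize (Assign r_idx (Num 0)) * ?K + (S + 1) * csize (While ?b ?c) * ?K
        \<le> 40 * (S + 1) * ?K"
      unfolding cs by (simp add: algebra_simps)
  qed (auto simp: I_def)
qed

section \<open>One digit position, and all of them\<close>

lemma block_writes:
  "wregs prime_leaves = {r_idx}" "warrs prime_leaves = {a_ptree}"
  "wregs (prod_tree A r) = {r_idx}" "warrs (prod_tree A r) = {A}"
  "wregs list_leaves = {r_leaves, r_idx}" "warrs list_leaves = {a_ltree}"
  "wregs rem_tree = {r_idx}" "warrs rem_tree = {a_rtree}"
  "wregs split_list =
     {r_idx, r_cur, r_rem, r_gcd, r_snd, r_swap, r_in, r_exp, r_out, r_len}"
  "warrs split_list = {a_list}"
  by (auto simp: prime_leaves_def prod_tree_def list_leaves_def rem_tree_def split_list_def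
      split_entry_def euclid_def power_rem_def)

text \<open>\<open>E\<close> bounds the leaves of both trees, \<open>S\<close> for the primes and at
  most \<open>W\<close> for the list. One factor \<open>bitlen V\<close> stands for the bit length
  of a leaf and one for the harmonic sum over a tree.\<close>

lemma runs_stage:
  assumes fac: "factors c W M (arr s a_list) (reg s r_len)" "1 \<le> reg s r_len"
    and sep: "\<And>i. i < reg s r_len \<Longrightarrow> separated S J (arr s a_list i)"
    and S: "reg s r_root = S" "1 \<le> S" "S \<le> M" and J: "reg s r_pow = 2 ^ J" "2 ^ J \<le> S"
    and pr: "\<And>k. k \<in> {1..S} \<Longrightarrow> arr s a_primes k = (if prime k then k else 1)"
    and E: "S \<le> E" "W \<le> E"
    and V: "2 * M \<le> V" "M * M \<le> V" "2 * E + 2 \<le> V" "8 * (E * bitlen M) + 1 \<le> V"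
  shows "runs \<alpha> stage s (640 * (E * bitlen V ^ 2) * unit_cost V) (\<lambda>s'. 1 \<le> reg s' r_len \<and>
    factors c W M (arr s' a_list) (reg s' r_len) \<and>
    (\<forall>i<reg s' r_len. separated S (Suc J) (arr s' a_list i)) \<and> reg s' r_pow = 2 ^ Suc J)"
proof -
  let ?K = "unit_cost V" and ?L = "arr s a_list"
  define m where "m = reg s r_len"
  \<comment> \<open>At a leaf of either tree the index is below \<open>2 * E\<close> and the value
    at most \<open>M\<close>.\<close>
  define D where "D = 2 * E * bitlen M"
  define Q where "Q = digit_prod S J"
  let ?Post = "\<lambda>s'. 1 \<le> reg s' r_len \<and> factors c W M (arr s' a_list) (reg s' r_len) \<and>
    (\<forall>i<reg s' r_len. separated S (Suc J) (arr s' a_list i)) \<and> reg s' r_pow = 2 ^ Suc J"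
  have m: "1 \<le> m" "m \<le> W" using fac factors_length by (auto simp: m_def)
  have D: "D + 1 \<le> V" "4 * D + 1 \<le> V" using V(4) by (auto simp: D_def)
  have L: "0 < ?L i" "?L i \<le> M" if "i < m" for i
    using fac(1) that by (auto simp: factors_def m_def)
  have leaf: "i * bitlen x \<le> D" if "i < 2 * w" "w \<le> E" "x \<le> M" for i w x
  proof -
    have "i * bitlen x \<le> (2 * E) * bitlen M"
      using that by (intro mult_le_mono bitlen_mono) auto
    then show ?thesis by (simp add: D_def)
  qed
  have "runs \<alpha> stage s (40 * (S + 1) * ?K + ((22 * S + D * bitlen S) * ?K + (20 * (m + 1) * ?K
      + ((22 * m + D * bitlen m) * ?K + ((40 * m + 2 * D + 4 * D * bitlen (2 * m)) * ?K
      + ((m + 1) * (170 * bitlen V) * ?K + csize (Assign r_pow (Num 2 \<otimes> Reg r_pow)) * ?K)))))) ?Post"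
    unfolding stage_def
  proof (rule runs_seq)
    let ?leaf = "\<lambda>i. if prime (i + 1) \<and> odd ((i + 1) div 2 ^ J) then i + 1 else 1"
    show "runs \<alpha> prime_leaves s (40 * (S + 1) * ?K) (\<lambda>t. \<forall>i<S. arr t a_ptree (S + i) = ?leaf i)"
      using S J pr E V by (intro runs_prime_leaves) auto
    fix s1 assume s1: "\<forall>i<S. arr s1 a_ptree (S + i) = ?leaf i" and fr1: "frame prime_leaves s s1"
    have leaf1: "0 < arr s1 a_ptree i \<and> i * bitlen (arr s1 a_ptree i) \<le> D" if "i \<in> {S..<2*S}" for i
    proof -
      define j where "j = i - S"
      have j: "i = S + j" "j < S" using that by (auto simp: j_def)
      then have "0 < arr s1 a_ptree i" "arr s1 a_ptree i \<le> M" using s1 S by auto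
      then show ?thesis using leaf[of i S] that E by auto
    qed
    have Q1: "(\<Prod>i=S..<2*S. arr s1 a_ptree i) = Q"
    proof -
      have "(\<Prod>i=S..<2*S. arr s1 a_ptree i) = (\<Prod>i<S. arr s1 a_ptree (S + i))"
        using prod.shift_bounds_nat_ivl[of "arr s1 a_ptree" 0 S S]
        by (simp add: mult_2 atLeast0LessThan add.commute)
      also have "\<dots> = (\<Prod>i<S. ?leaf i)" using s1 by (intro prod.cong) auto
      also have "\<dots> = Q" unfolding Q_def digit_prod_def
        using prod.atLeast1_atMost_eq[of "\<lambda>k. if prime k \<and> odd (k div 2 ^ J) then k else 1" S]
        by (simp cong: if_cong)
      finally show ?thesis .
    qed
    show "runs \<alpha> (prod_tree a_ptree r_root ;; list_leaves ;; prod_tree a_ltree r_leaves ;;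
        rem_tree ;; split_list ;; Assign r_pow (Num 2 \<otimes> Reg r_pow)) s1
        ((22 * S + D * bitlen S) * ?K + (20 * (m + 1) * ?K
      + ((22 * m + D * bitlen m) * ?K + ((40 * m + 2 * D + 4 * D * bitlen (2 * m)) * ?K
      + ((m + 1) * (170 * bitlen V) * ?K + csize (Assign r_pow (Num 2 \<otimes> Reg r_pow)) * ?K))))) ?Post"
    proof (rule runs_seq)
      show "runs \<alpha> (prod_tree a_ptree r_root) s1 ((22 * S + D * bitlen S) * ?K)
          (\<lambda>t. arr t a_ptree 1 = Q \<and> bitlen Q \<le> D)"
      proof (rule runs_mono[OF runs_prod_tree order_refl])
        show "reg s1 r_root = S" using S frame_reg[OF fr1] by (simp add: block_writes)
        show "1 \<le> S" "2 * S + 2 \<le> V" "D + 1 \<le> V" using S V E D by auto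
        fix t assume t: "(\<forall>i\<in>{S..<2*S}. arr t a_ptree i = arr s1 a_ptree i) \<and>
          (\<forall>i\<in>{1..<2*S}. 0 < arr t a_ptree i \<and> i * bitlen (arr t a_ptree i) \<le> D) \<and>
          (\<forall>i\<in>{1..<S}. arr t a_ptree i = arr t a_ptree (2*i) * arr t a_ptree (2*i+1)) \<and>
          arr t a_ptree 1 = (\<Prod>i=S..<2*S. arr s1 a_ptree i)"
        then have "arr t a_ptree 1 = Q" using Q1 by simp
        moreover have "(1::nat) \<in> {1..<2*S}" using S(2) by simp
        then have "1 * bitlen (arr t a_ptree 1) \<le> D" using t by blast
        ultimately show "arr t a_ptree 1 = Q \<and> bitlen Q \<le> D" by simp
      qed (rule leaf1)
      fix s2 assume s2: "arr s2 a_ptree 1 = Q \<and> bitlen Q \<le> D"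
        and fr2: "frame (prod_tree a_ptree r_root) s1 s2"
      have s2': "arr s2 a_list = ?L" "reg s2 r_len = m" "reg s2 r_pow = 2 ^ J"
        using frame_arr[OF fr1] frame_arr[OF fr2] frame_reg[OF fr1] frame_reg[OF fr2] J
        by (simp_all add: block_writes m_def)
      show "runs \<alpha> (list_leaves ;; prod_tree a_ltree r_leaves ;;
          rem_tree ;; split_list ;; Assign r_pow (Num 2 \<otimes> Reg r_pow)) s2 (20 * (m + 1) * ?K
        + ((22 * m + D * bitlen m) * ?K + ((40 * m + 2 * D + 4 * D * bitlen (2 * m)) * ?K
        + ((m + 1) * (170 * bitlen V) * ?K + csize (Assign r_pow (Num 2 \<otimes> Reg r_pow)) * ?K)))) ?Post"
      proof (rule runs_seq)
        have "?L i \<le> V" if "i < m" for i using L(2)[OF that] V by auto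
        then show "runs \<alpha> list_leaves s2 (20 * (m + 1) * ?K) (\<lambda>t. reg t r_leaves = m \<and>
            (\<forall>i<m. arr t a_ltree (m + i) = arr s2 a_list i))"
          using s2' m E V by (intro runs_list_leaves) auto
        fix s3 assume s3: "reg s3 r_leaves = m \<and> (\<forall>i<m. arr s3 a_ltree (m + i) = arr s2 a_list i)"
          and fr3: "frame list_leaves s2 s3"
        have s3': "arr s3 a_list = ?L" "reg s3 r_len = m" "reg s3 r_pow = 2 ^ J"
          "arr s3 a_ptree 1 = Q"
          using s2 s2' frame_arr[OF fr3] frame_reg[OF fr3] by (simp_all add: block_writes)
        have leaf3: "0 < arr s3 a_ltree i \<and> i * bitlen (arr s3 a_ltree i) \<le> D"
          if "i \<in> {m..<2*m}" for i
        proof -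
          define j where "j = i - m"
          have j: "i = m + j" "j < m" using that by (auto simp: j_def)
          then have "arr s3 a_ltree i = ?L j" using s3 s2' by auto
          then show ?thesis using leaf[of i m "?L j"] that L[OF j(2)] m E by auto
        qed
        show "runs \<alpha> (prod_tree a_ltree r_leaves ;;
            rem_tree ;; split_list ;; Assign r_pow (Num 2 \<otimes> Reg r_pow)) s3
            ((22 * m + D * bitlen m) * ?K + ((40 * m + 2 * D + 4 * D * bitlen (2 * m)) * ?K
          + ((m + 1) * (170 * bitlen V) * ?K + csize (Assign r_pow (Num 2 \<otimes> Reg r_pow)) * ?K))) ?Post"
        proof (rule runs_seq)
          let ?P4 = "\<lambda>t. (\<forall>i\<in>{m..<2*m}. arr t a_ltree i = arr s3 a_ltree i) \<and>
            (\<forall>i\<in>{1..<2*m}. 0 < arr t a_ltree i \<and> i * bitlen (arr t a_ltree i) \<le> D) \<and>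
            (\<forall>i\<in>{1..<m}. arr t a_ltree i = arr t a_ltree (2*i) * arr t a_ltree (2*i+1))"
          show "runs \<alpha> (prod_tree a_ltree r_leaves) s3 ((22 * m + D * bitlen m) * ?K) ?P4"
          proof (rule runs_mono[OF runs_prod_tree order_refl])
            show "reg s3 r_leaves = m" using s3 by simp
            show "1 \<le> m" "2 * m + 2 \<le> V" "D + 1 \<le> V" using m V E D by auto
          qed (rule leaf3, assumption, blast)
          fix s4 assume s4: "?P4 s4" and fr4: "frame (prod_tree a_ltree r_leaves) s3 s4"
          have s4': "arr s4 a_list = ?L" "reg s4 r_len = m" "reg s4 r_pow = 2 ^ J"
            "arr s4 a_ptree 1 = Q" "reg s4 r_leaves = m"
            using s3 s3' frame_arr[OF fr4] frame_reg[OF fr4] by (simp_all add: block_writes)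
          show "runs \<alpha> (rem_tree ;; split_list ;; Assign r_pow (Num 2 \<otimes> Reg r_pow)) s4
              ((40 * m + 2 * D + 4 * D * bitlen (2 * m)) * ?K
            + ((m + 1) * (170 * bitlen V) * ?K + csize (Assign r_pow (Num 2 \<otimes> Reg r_pow)) * ?K)) ?Post"
          proof (rule runs_seq)
            show "runs \<alpha> rem_tree s4 ((40 * m + 2 * D + 4 * D * bitlen (2 * m)) * ?K)
              (\<lambda>t. \<forall>i\<in>{1..<2*m}. arr t a_rtree i = arr s4 a_ptree 1 mod arr s4 a_ltree i)"
              using s4 s4' s2 m V E D by (intro runs_rem_tree) auto
            fix s5
            assume s5: "\<forall>i\<in>{1..<2*m}. arr s5 a_rtree i = arr s4 a_ptree 1 mod arr s4 a_ltree i"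
              and fr5: "frame rem_tree s4 s5"
            have s5': "arr s5 a_list = ?L" "reg s5 r_len = m" "reg s5 r_pow = 2 ^ J"
              "reg s5 r_leaves = m"
              using s4' frame_arr[OF fr5] frame_reg[OF fr5] by (simp_all add: block_writes)
            have rem: "arr s5 a_rtree (m + i) = Q mod ?L i" if "i < m" for i
            proof -
              have "m + i \<in> {m..<2*m}" "m + i \<in> {1..<2*m}" using that m by auto
              then have "arr s5 a_rtree (m + i) = Q mod arr s3 a_ltree (m + i)"
                using s5 s4 s4'(4) by simp
              then show ?thesis using s3 s2' that by simp
            qed
            show "runs \<alpha> (split_list ;; Assign r_pow (Num 2 \<otimes> Reg r_pow)) s5
              ((m + 1) * (170 * bitlen V) * ?K + csize (Assign r_pow (Num 2 \<otimes> Reg r_pow)) * ?K) ?Post"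
            proof (rule runs_seq)
              let ?P6 = "\<lambda>t. m \<le> reg t r_len \<and> factors c W M (arr t a_list) (reg t r_len) \<and>
                (\<forall>i<reg t r_len. separated S (Suc J) (arr t a_list i))"
              show "runs \<alpha> split_list s5 ((m + 1) * (170 * bitlen V) * ?K) ?P6"
                using s5' rem fac sep V E
                by (intro runs_split_list) (auto simp: m_def[symmetric] Q_def)
              fix s6 assume s6: "?P6 s6" and fr6: "frame split_list s5 s6"
              have "reg s6 r_pow = 2 ^ J" using s5' frame_reg[OF fr6] by (simp add: block_writes)
              then show "runs \<alpha> (Assign r_pow (Num 2 \<otimes> Reg r_pow)) s6
                  (csize (Assign r_pow (Num 2 \<otimes> Reg r_pow)) * ?K) ?Post"
                using s6 m J S E V by (intro runs_wp) auto
            qed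
          qed
        qed
      qed
    qed
  qed
  then show ?thesis
  proof (rule runs_mono)
    let ?\<beta> = "bitlen V" and ?G = "E * bitlen V ^ 2"
    have \<beta>: "1 \<le> ?\<beta>" using bitlen_pos[of V] V(3) by simp
    have mV: "bitlen S \<le> ?\<beta>" "bitlen m \<le> ?\<beta>" "bitlen (2 * m) \<le> ?\<beta>" "bitlen M \<le> ?\<beta>"
      using V E m S by (auto intro!: bitlen_mono)
    have G: "E \<le> ?G" "E * ?\<beta> \<le> ?G" using \<beta> by (simp_all add: power2_eq_square)
    have Db: "D * x \<le> 2 * ?G" if "x \<le> ?\<beta>" for x
    proof -
      have "D * x \<le> (2 * E * ?\<beta>) * ?\<beta>" unfolding D_def using that mV(4) by (intro mult_le_mono) auto
      then show ?thesis by (simp add: power2_eq_square mult.assoc)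
    qed
    have mb: "m * ?\<beta> \<le> E * ?\<beta>" "?\<beta> \<le> E * ?\<beta>" using m E by auto
    have "40 * (S + 1) + ((22 * S + D * bitlen S) + (20 * (m + 1)
      + ((22 * m + D * bitlen m) + ((40 * m + 2 * D + 4 * D * bitlen (2 * m))
      + ((m + 1) * (170 * ?\<beta>) + 4))))) \<le> 640 * ?G"
    proof -
      have "(m + 1) * (170 * ?\<beta>) = 170 * (m * ?\<beta>) + 170 * ?\<beta>"
        "4 * D * bitlen (2 * m) = 4 * (D * bitlen (2 * m))" by simp_all
      \<comment> \<open>Nonlinear terms are replaced by variables, which leaves a linear inequality:
        every summand is a multiple of \<open>g\<close>, and the coefficients add up to less than
        640.\<close>
      moreover have "40 * (S + 1) + ((22 * S + d1) + (20 * (m + 1) + ((22 * m + d2)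
          + ((40 * m + 2 * D + 4 * d3) + ((170 * h + 170 * b) + 4))))) \<le> 640 * g"
        if "d1 \<le> 2 * g" "d2 \<le> 2 * g" "d3 \<le> 2 * g" "D \<le> 2 * g" "E \<le> g" "f \<le> g" "h \<le> f" "b \<le> f"
        for d1 d2 d3 f g h b :: nat
      proof -
        have "S \<le> g" "m \<le> g" "h \<le> g" "b \<le> g" "1 \<le> g" using that m E S(2) by simp_all
        then show ?thesis using that(1-4) by simp
      qed
      ultimately show ?thesis
        using Db[OF mV(1)] Db[OF mV(2)] Db[OF mV(3)] Db[OF \<beta>] G mb by (metis mult_1_right)
    qed
    from mult_le_mono1[OF this, of ?K]
    show "40 * (S + 1) * ?K + ((22 * S + D * bitlen S) * ?K + (20 * (m + 1) * ?K
      + ((22 * m + D * bitlen m) * ?K + ((40 * m + 2 * D + 4 * D * bitlen (2 * m)) * ?K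
      + ((m + 1) * (170 * ?\<beta>) * ?K + csize (Assign r_pow (Num 2 \<otimes> Reg r_pow)) * ?K)))))
      \<le> 640 * ?G * ?K"
      by (simp only: distrib_right csize.simps asize.simps)
  qed
qed

lemma runs_factor_list:
  assumes fac: "factors c W M (arr s a_list) (reg s r_len)" "1 \<le> reg s r_len"
    and S: "reg s r_root = S" "1 \<le> S" "S \<le> M"
    and pr: "\<And>k. k \<in> {1..S} \<Longrightarrow> arr s a_primes k = (if prime k then k else 1)"
    and E: "S \<le> E" "W \<le> E"
    and V: "2 * M \<le> V" "M * M \<le> V" "2 * E + 2 \<le> V" "8 * (E * bitlen M) + 1 \<le> V"
  shows "runs \<alpha> factor_list s (660 * (E * bitlen V ^ 3) * unit_cost V) (\<lambda>s'.
    factors c W M (arr s' a_list) (reg s' r_len) \<and>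
    (\<forall>i<reg s' r_len. separated S (bitlen S) (arr s' a_list i)))"
proof -
  let ?K = "unit_cost V"
  let ?b = "Less (Reg r_pow) (Reg r_root \<oplus> Num 1)"
  let ?T = "640 * (E * bitlen V ^ 2) * ?K"
  define I where "I J t \<longleftrightarrow> 1 \<le> reg t r_len \<and> factors c W M (arr t a_list) (reg t r_len) \<and>
    (\<forall>i<reg t r_len. separated S J (arr t a_list i)) \<and> reg t r_pow = 2 ^ J" for J and t :: state
  have le: "2 ^ J \<le> S \<longleftrightarrow> J < bitlen S" for J using bitlen_le_iff[of S J] by linarith
  have wr: "r_root \<notin> wregs stage" "a_primes \<notin> warrs stage"
    by (simp_all add: stage_def block_writes)
  have "runs \<alpha> factor_list s (csize (Assign r_pow (Num 1)) * ?K
      + ((\<Sum>J<bitlen S. ?T + 5 * ?K + 1) + 5 * ?K + 1)) (I (bitlen S))"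
    unfolding factor_list_def
  proof (rule runs_seq)
    show "runs \<alpha> (Assign r_pow (Num 1)) s (csize (Assign r_pow (Num 1)) * ?K) (I 0)"
      using fac V by (intro runs_wp) (auto simp: I_def separated_0 factors_def)
    fix s1 assume I0: "I 0 s1" and fr1: "frame (Assign r_pow (Num 1)) s s1"
    have s1: "reg s1 r_root = S" "arr s1 a_primes = arr s a_primes"
      using S frame_reg[OF fr1] frame_arr[OF fr1] by auto
    from I0 show "runs \<alpha> (While ?b stage) s1 ((\<Sum>J<bitlen S. ?T + 5 * ?K + 1) + 5 * ?K + 1) (I (bitlen S))"
    proof (rule runs_for)
      fix J t assume J: "J < bitlen S" and t: "I J t" and fr: "frame (While ?b stage) s1 t"
      have t': "reg t r_root = S" "arr t a_primes = arr s a_primes"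
        using s1 frame_reg[OF fr] frame_arr[OF fr] wr by auto
      have JS: "2 ^ J \<le> S" using J le by simp
      have "bcost t ?b \<le> bsize ?b * ?K"
        using t t' JS E V by (intro bcost_small) (auto simp: I_def)
      then have "bcost t ?b \<le> 5 * ?K" by simp
      moreover have "runs \<alpha> stage t ?T (I (Suc J))"
        unfolding I_def by (rule runs_stage) (use t t' JS S pr E V in \<open>auto simp: I_def\<close>)
      ultimately show "bval \<alpha> t ?b \<and> bcost t ?b \<le> 5 * ?K \<and> runs \<alpha> stage t ?T (I (Suc J))"
        using t t' JS by (auto simp: I_def)
    next
      fix t assume t: "I (bitlen S) t" and fr: "frame (While ?b stage) s1 t"
      have t': "reg t r_root = S" using s1 frame_reg[OF fr] wr by auto
      \<comment> \<open>On leaving the loop \<open>r_pow\<close> exceeds \<open>S\<close> but not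
        \<open>2 * S\<close>, so the last test of the guard still handles small numbers.\<close>
      have "2 ^ (bitlen S - 1) \<le> S" using S(2) by (intro two_power_le_of_bitlen) simp
      then have "2 ^ bitlen S \<le> 2 * S" by (cases "bitlen S") auto
      then have "bcost t ?b \<le> bsize ?b * ?K"
        using t t' E V by (intro bcost_small) (auto simp: I_def)
      then show "\<not> bval \<alpha> t ?b \<and> bcost t ?b \<le> 5 * ?K"
        using t t' less_two_power_bitlen[of S] by (auto simp: I_def)
    qed
  qed
  then show ?thesis
  proof (rule runs_mono)
    let ?\<beta> = "bitlen V"
    have \<beta>: "1 \<le> ?\<beta>" using bitlen_pos[of V] V(3) by simp
    have K: "1 \<le> ?K" by (rule unit_cost_pos)
    have G: "1 \<le> E * ?\<beta> ^ 2" using \<beta> E S by auto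
    have GK: "?K \<le> E * ?\<beta> ^ 2 * ?K" using mult_le_mono1[OF G, of ?K] by simp
    have "?T + 5 * ?K + 1 \<le> 646 * (E * ?\<beta> ^ 2 * ?K)" unfolding mult.assoc[of 640] using GK K by linarith
    moreover have "bitlen S \<le> ?\<beta>" using E V by (intro bitlen_mono) auto
    ultimately have "bitlen S * (?T + 5 * ?K + 1) \<le> ?\<beta> * (646 * (E * ?\<beta> ^ 2 * ?K))"
      by (intro mult_le_mono)
    also have "\<dots> = 646 * (E * ?\<beta> ^ 3 * ?K)" by (simp add: power3_eq_cube power2_eq_square)
    finally have 1: "bitlen S * (?T + 5 * ?K + 1) \<le> 646 * (E * ?\<beta> ^ 3 * ?K)" .
    have "1 \<le> E * ?\<beta> ^ 3" using \<beta> E S by auto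
    then have "?K \<le> E * ?\<beta> ^ 3 * ?K" using mult_le_mono1[of 1 "E * ?\<beta> ^ 3" ?K] by simp
    moreover have eq: "csize (Assign r_pow (Num 1)) = 2"
      "(\<Sum>J<bitlen S. ?T + 5 * ?K + 1) = bitlen S * (?T + 5 * ?K + 1)" by simp_all
    ultimately show "csize (Assign r_pow (Num 1)) * ?K
      + ((\<Sum>J<bitlen S. ?T + 5 * ?K + 1) + 5 * ?K + 1) \<le> 660 * (E * ?\<beta> ^ 3) * ?K"
      unfolding mult.assoc[of 660] eq using 1 K by linarith
  qed (auto simp: I_def)
qed

section \<open>Scanning, sieving and counting\<close>

lemma sum_list_le:
  assumes "\<forall>x\<in>set xs. x \<le> M"
  shows "sum_list xs \<le> length xs * (M :: nat)"
  using assms by (induction xs) auto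

lemma runs_scan:
  assumes s: "reg s r_len = length xs" "reg s r_idx = 0" "reg s r_sum = 0" "reg s r_mult = 0"
      "reg s r_max = 0" "arr s a_count = (\<lambda>_. 0)"
    and xs: "\<And>i. i < length xs \<Longrightarrow> arr s a_list i = xs ! i" "\<forall>x\<in>set xs. 0 < x \<and> x \<le> M" "xs \<noteq> []"
    and V: "length xs + 1 \<le> V" "length xs * M \<le> V" "M \<le> V"
  shows "runs \<alpha> scan s (50 * (length xs + 1) * unit_cost V) (\<lambda>s'. reg s' r_size = length xs \<and>
    reg s' r_sum = sum_list xs \<and> reg s' r_mult = max_mult (mset xs) \<and> reg s' r_max = Max (set xs))"
proof -
  let ?K = "unit_cost V" and ?n = "length xs"
  let ?b = "Less (Reg r_idx) (Reg r_size)"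
  let ?c = "Assign r_tmp (Arr a_list (Reg r_idx)) ;;
        Assign r_sum (Reg r_sum \<oplus> Reg r_tmp) ;;
        Store a_count (Reg r_tmp) (Arr a_count (Reg r_tmp) \<oplus> Num 1) ;;
        Cond (Less (Reg r_mult) (Arr a_count (Reg r_tmp)))
          (Assign r_mult (Arr a_count (Reg r_tmp))) Skip ;;
        Cond (Less (Reg r_max) (Reg r_tmp)) (Assign r_max (Reg r_tmp)) Skip ;;
        incr r_idx"
  \<comment> \<open>Before the first element both maxima are 0 and attained by nothing, hence the
    disjunctions. Since the list is nonempty and its elements are positive, the cases with 0 vanish
    at the end.\<close>
  define I where "I k t \<longleftrightarrow> reg t r_idx = k \<and> reg t r_size = ?n \<and>
    reg t r_sum = sum_list (take k xs) \<and>
    (\<forall>v. arr t a_count v = count (mset (take k xs)) v) \<and>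
    (\<forall>v. count (mset (take k xs)) v \<le> reg t r_mult) \<and>
    (reg t r_mult = 0 \<or> (\<exists>v\<in>set (take k xs). reg t r_mult = count (mset (take k xs)) v)) \<and>
    (\<forall>v\<in>set (take k xs). v \<le> reg t r_max) \<and>
    (reg t r_max = 0 \<or> reg t r_max \<in> set (take k xs))" for k and t :: state
  have cnt: "count (mset (take k xs)) v \<le> k" for k v
    using count_le_size[of "mset (take k xs)" v] by simp
  have "runs \<alpha> scan s (csize (Assign r_size (Reg r_len)) * ?K + (?n + 1) * csize (While ?b ?c) * ?K) (I ?n)"
    unfolding scan_def
  proof (rule runs_seq)
    show "runs \<alpha> (Assign r_size (Reg r_len)) s (csize (Assign r_size (Reg r_len)) * ?K) (I 0)"
      using s V by (intro runs_wp) (auto simp: I_def)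
    fix s1 assume I0: "I 0 s1" and fr1: "frame (Assign r_size (Reg r_len)) s s1"
    have s1: "arr s1 a_list = arr s a_list" using frame_arr[OF fr1] by auto
    from I0 show "runs \<alpha> (While ?b ?c) s1 ((?n + 1) * csize (While ?b ?c) * ?K) (I ?n)"
    proof (rule runs_for_small)
      fix k t assume k: "k < ?n" and t: "I k t" and fr: "frame (While ?b ?c) s1 t"
      let ?p = "take k xs"
      define x where "x = xs ! k"
      have "x \<in> set xs" using k by (simp add: x_def)
      then have x: "arr t a_list k = x" "0 < x" "x \<le> M" "x \<le> V"
        using s1 frame_arr[OF fr] xs(1)[OF k] xs(2) V by (auto simp: x_def)
      have tk: "take (Suc k) xs = ?p @ [x]" using k by (simp add: take_Suc_conv_app_nth x_def)
      have "sum_list (?p @ [x]) \<le> length (?p @ [x]) * M"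
        using xs(2) x(3) by (intro sum_list_le) (auto dest: in_set_takeD)
      also have "\<dots> \<le> ?n * M" using k by (intro mult_le_mono1) simp
      finally have sum: "sum_list ?p + x \<le> V" "sum_list ?p \<le> V" using V(2) by auto
      have cV: "count (mset ?p) v + 1 \<le> V" "count (mset ?p) v \<le> V" for v
        using cnt[of k v] k V(1) by auto
      have t': "reg t r_idx = k" "reg t r_size = ?n" "reg t r_sum = sum_list ?p"
        "\<And>v. arr t a_count v = count (mset ?p) v"
        "\<And>v. count (mset ?p) v \<le> reg t r_mult"
        "reg t r_mult = 0 \<or> (\<exists>v\<in>set ?p. reg t r_mult = count (mset ?p) v)"
        "\<And>v. v \<in> set ?p \<Longrightarrow> v \<le> reg t r_max"
        "reg t r_max = 0 \<or> reg t r_max \<in> set ?p"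
        using t by (auto simp: I_def)
      have multV: "reg t r_mult \<le> V" using t'(6) cV by auto
      have maxV: "reg t r_max \<le> V"
        using t'(8) xs(2) V(3) by (auto dest!: in_set_takeD)
      define u where "u = (if reg t r_mult < count (mset ?p) x + 1 then count (mset ?p) x + 1
        else reg t r_mult)"
      define w where "w = (if reg t r_max < x then x else reg t r_max)"
      have u: "count (mset (?p @ [x])) v \<le> u" for v
        using t'(5)[of v] t'(5)[of x] by (auto simp: u_def)
      have u': "u = 0 \<or> (\<exists>v\<in>set (?p @ [x]). u = count (mset (?p @ [x])) v)"
      proof (cases "reg t r_mult < count (mset ?p) x + 1")
        case True
        then show ?thesis by (auto simp: u_def)
      next
        case False
        then obtain v where v: "v \<in> set ?p" "reg t r_mult = count (mset ?p) v" using t'(6) by auto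
        then have "v \<noteq> x" using False by auto
        then show ?thesis using False v by (auto simp: u_def)
      qed
      have w: "v \<in> set (?p @ [x]) \<Longrightarrow> v \<le> w" for v
        using t'(7)[of v] by (auto simp: w_def)
      have w': "w = 0 \<or> w \<in> set (?p @ [x])" using t'(8) by (auto simp: w_def)
      have I': "I (Suc k) t''" if "reg t'' r_idx = Suc k" "reg t'' r_size = ?n"
        "reg t'' r_sum = sum_list ?p + x"
        "arr t'' a_count = (arr t a_count)(x := Suc (count (mset ?p) x))"
        "reg t'' r_mult = u" "reg t'' r_max = w" for t'' :: state
        unfolding I_def tk using that u u' w w' t'(4) by simp
      have "bval \<alpha> t ?b \<and> bsmall V t ?b" using t' k V by auto
      moreover have "wp \<alpha> V ?c (I (Suc k)) t"
        using t'(1-4) x sum cV multV maxV k V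
        by (simp add: I' u_def w_def)
      ultimately show "bval \<alpha> t ?b \<and> bsmall V t ?b \<and> wp \<alpha> V ?c (I (Suc k)) t" by blast
    next
      fix t assume "I ?n t"
      then show "\<not> bval \<alpha> t ?b \<and> bsmall V t ?b" using V by (auto simp: I_def)
    qed
  qed
  then show ?thesis
  proof (rule runs_mono)
    have cs: "csize (Assign r_size (Reg r_len)) = 2" "csize (While ?b ?c) = 37" by simp_all
    show "csize (Assign r_size (Reg r_len)) * ?K + (?n + 1) * csize (While ?b ?c) * ?K
        \<le> 50 * (?n + 1) * ?K"
      unfolding cs by (simp add: algebra_simps)
    fix t assume t: "I ?n t"
    obtain x where x: "x \<in> set xs" using xs(3) by (cases xs) auto
    have "count (mset xs) x > 0" using x by simp
    then have "reg t r_mult \<noteq> 0" using t unfolding I_def by (metis le_zero_eq less_irrefl take_all order_refl)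
    then have mem: "reg t r_mult \<in> count (mset xs) ` set_mset (mset xs)" using t by (auto simp: I_def)
    have "reg t r_mult = max_mult (mset xs)"
      unfolding max_mult_def
      by (rule Max_eqI[symmetric]) (use t mem in \<open>auto simp: I_def\<close>)
    moreover have "0 < x" "x \<le> reg t r_max" using x xs(2) t by (auto simp: I_def)
    then have "reg t r_max \<in> set xs" using t by (auto simp: I_def)
    then have "reg t r_max = Max (set xs)"
      by (intro Max_eqI[symmetric]) (use t in \<open>auto simp: I_def\<close>)
    ultimately show "reg t r_size = ?n \<and> reg t r_sum = sum_list xs \<and>
        reg t r_mult = max_mult (mset xs) \<and> reg t r_max = Max (set xs)"
      using t by (auto simp: I_def)
  qed
qed

lemma runs_find_root:
  assumes s: "reg s r_root = 0" "reg s r_max = M"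
    and S: "M \<le> S * S" "\<And>k. k < S \<Longrightarrow> k * k < M" and V: "S * S \<le> V" "S + 1 \<le> V" "M \<le> V"
  shows "runs \<alpha> find_root s (20 * (S + 1) * unit_cost V) (\<lambda>s'. reg s' r_root = S)"
proof -
  let ?K = "unit_cost V"
  let ?b = "Less (Reg r_root \<otimes> Reg r_root) (Reg r_max)"
  have "runs \<alpha> find_root s ((S + 1) * csize (While ?b (incr r_root)) * ?K) (\<lambda>t. reg t r_root = S)"
    unfolding find_root_def
  proof (rule runs_for_small[where I = "\<lambda>k t. reg t r_root = k"])
    show "reg s r_root = 0" by (rule s)
    fix k t assume k: "k < S" and t: "reg t r_root = k" and fr: "frame (While ?b (incr r_root)) s t"
    have "reg t r_max = M" using frame_reg[OF fr] s by simp
    moreover have "k * k \<le> S * S" using k by (intro mult_le_mono) auto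
    ultimately show "bval \<alpha> t ?b \<and> bsmall V t ?b \<and> wp \<alpha> V (incr r_root) (\<lambda>t. reg t r_root = Suc k) t"
      using t k S(2)[OF k] V by auto
  next
    fix t assume t: "reg t r_root = S" and fr: "frame (While ?b (incr r_root)) s t"
    have "reg t r_max = M" using frame_reg[OF fr] s by simp
    then show "\<not> bval \<alpha> t ?b \<and> bsmall V t ?b" using t S V by auto
  qed
  then show ?thesis
  proof (rule runs_mono)
    have cs: "csize (While ?b (incr r_root)) = 10" by simp
    show "(S + 1) * csize (While ?b (incr r_root)) * ?K \<le> 20 * (S + 1) * ?K"
      unfolding cs by simp
  qed
qed

text \<open>Describes the sieve when all \<open>d\<close> below \<open>i\<close> have been
  processed. The condition \<open>d < k\<close> reflects that striking starts at
  \<open>2 * d\<close>.\<close>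

definition struck :: "nat \<Rightarrow> nat \<Rightarrow> bool" where
  "struck i k \<longleftrightarrow> (\<exists>d. 2 \<le> d \<and> d < i \<and> d dvd k \<and> d < k)"

lemma struck_Suc: "2 \<le> i \<Longrightarrow> struck (Suc i) k \<longleftrightarrow> struck i k \<or> i dvd k \<and> i < k"
  by (auto simp: struck_def less_Suc_eq)

lemma struck_iff_not_prime:
  assumes "2 \<le> k" "k \<le> S"
  shows "struck (Suc S) k \<longleftrightarrow> \<not> prime k"
proof
  assume "struck (Suc S) k"
  then show "\<not> prime k" using assms by (auto simp: struck_def prime_nat_iff)
next
  assume "\<not> prime k"
  then obtain d where d: "d dvd k" "d \<noteq> 1" "d \<noteq> k" using assms by (auto simp: prime_nat_iff)
  have "0 < d" using d(1) assms by (cases d) auto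
  moreover have "d \<le> k" using d(1) assms by (intro dvd_imp_le) auto
  ultimately have "2 \<le> d" "d < k" using d by auto
  then show "struck (Suc S) k" using d(1) assms unfolding struck_def by (intro exI[of _ d]) auto
qed

lemma runs_sieve:
  assumes s: "reg s r_root = S" "1 \<le> S" and V: "2 * S + 2 \<le> V"
  shows "runs \<alpha> sieve s (60 * ((S + 1) * (bitlen V + 1)) * unit_cost V) (\<lambda>s'.
    \<forall>k\<in>{1..S}. arr s' a_primes k = (if prime k then k else 1))"
proof -
  let ?K = "unit_cost V"
  let ?b = "Less (Reg r_idx) (Reg r_root \<oplus> Num 1)"
  let ?c = "Store a_primes (Reg r_idx) (Reg r_idx) ;; incr r_idx"
  let ?bi = "Less (Reg r_tmp) (Reg r_root \<oplus> Num 1)"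
  let ?ci = "Store a_primes (Reg r_tmp) (Num 1) ;; Assign r_tmp (Reg r_tmp \<oplus> Reg r_idx)"
  let ?ai = "Assign r_tmp (Num 2 \<otimes> Reg r_idx)"
  let ?d = "?ai ;; While ?bi ?ci ;; incr r_idx"
  define A where "A t i \<longleftrightarrow> (\<forall>k\<in>{1..S}. arr t a_primes k = (if struck i k then 1 else k))"
    for t :: state and i
  define I1 where "I1 k t \<longleftrightarrow> reg t r_idx = k + 1 \<and> (\<forall>j\<in>{1..k}. arr t a_primes j = j)"
    for k and t :: state
  define I2 where "I2 k t \<longleftrightarrow> reg t r_idx = k + 2 \<and> A t (k + 2)" for k and t :: state
  have inner: "runs \<alpha> ?d t (csize ?ai * ?K + ((S div i - 1 + 1) * csize (While ?bi ?ci) * ?K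
      + csize (incr r_idx) * ?K)) (I2 (Suc k))"
    if i: "i = k + 2" "i \<le> S" and I: "I2 k t" and root: "reg t r_root = S" for k t i
  proof (rule runs_seq)
    \<comment> \<open>Round \<open>j\<close> strikes \<open>(j + 2) * i\<close>. The last multiple
      within range is \<open>S div i * i\<close>, so there are \<open>S div i - 1\<close> rounds. No
      multiple of \<open>i\<close> lies strictly between consecutive ones; this also justifies
      starting at \<open>2 * i\<close>.\<close>
    define I3 where "I3 j u \<longleftrightarrow> reg u r_tmp = (j + 2) * i \<and> (\<forall>k\<in>{1..S}. arr u a_primes k =
       (if struck i k \<or> i dvd k \<and> i < k \<and> k < (j + 2) * i then 1 else k))" for j and u :: state
    have no: "\<not> (i dvd k \<and> i < k \<and> k < 2 * i)" for k
    proof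
      assume *: "i dvd k \<and> i < k \<and> k < 2 * i"
      then obtain q where q: "k = i * q" by blast
      with * have "1 < q" "q < 2" by auto
      then show False by simp
    qed
    have I30: "I3 0 u" if "reg u r_tmp = 2 * i" "arr u a_primes = arr t a_primes" for u
      unfolding I3_def add_0 using no that I i by (simp add: I2_def A_def)
    show "runs \<alpha> ?ai t (csize ?ai * ?K) (\<lambda>u. I3 0 u \<and> reg u r_idx = i \<and> reg u r_root = S)"
      using I i root V by (intro runs_wp) (auto simp: I2_def intro!: I30)
    fix t1 assume t1: "I3 0 t1 \<and> reg t1 r_idx = i \<and> reg t1 r_root = S"
    show "runs \<alpha> (While ?bi ?ci ;; incr r_idx) t1
        ((S div i - 1 + 1) * csize (While ?bi ?ci) * ?K + csize (incr r_idx) * ?K) (I2 (Suc k))"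
    proof (rule runs_seq)
      have div1: "1 \<le> S div i" using i by (simp add: Suc_le_eq div_greater_zero_iff)
      show "runs \<alpha> (While ?bi ?ci) t1 ((S div i - 1 + 1) * csize (While ?bi ?ci) * ?K) (I3 (S div i - 1))"
      proof (rule runs_for_small)
        show "I3 0 t1" using t1 by simp
      next
        fix j u assume j: "j < S div i - 1" and u: "I3 j u" and fr: "frame (While ?bi ?ci) t1 u"
        have u': "reg u r_idx = i" "reg u r_root = S" using frame_reg[OF fr] t1 by auto
        have "(j + 2) * i \<le> (S div i) * i" using j by (intro mult_le_mono1) simp
        also have "\<dots> \<le> S" by simp
        finally have le: "(j + 2) * i \<le> S" .
        have upd: "((arr u a_primes)((j + 2) * i := 1)) k =
           (if struck i k \<or> i dvd k \<and> i < k \<and> k < (Suc j + 2) * i then 1 else k)"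
          if k: "k \<in> {1..S}" for k
        proof (cases "k = (j + 2) * i")
          case True
          moreover have "2 \<le> i" using i(1) by simp
          ultimately have "i dvd k" "i < k" "k < (Suc j + 2) * i" by auto
          then show ?thesis using True by simp
        next
          case False
          have "k < (j + 2) * i" if "i dvd k" "k < (Suc j + 2) * i"
          proof -
            obtain q where q: "k = i * q" using \<open>i dvd k\<close> by blast
            have "i * q < i * (Suc j + 2)" using that(2) q by (metis mult.commute)
            then have "q < Suc j + 2" by (rule mult_less_cancel1[THEN iffD1, THEN conjunct2])
            moreover have "q \<noteq> j + 2" using False q by (auto simp: mult.commute)
            ultimately have "q < j + 2" by simp
            then have "i * q < i * (j + 2)" using i(1) by (intro mult_strict_left_mono) auto
            then show ?thesis using q by (metis mult.commute)
          qed
          moreover have "(j + 2) * i \<le> (Suc j + 2) * i" by simp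
          ultimately have "i dvd k \<and> i < k \<and> k < (j + 2) * i \<longleftrightarrow> i dvd k \<and> i < k \<and> k < (Suc j + 2) * i"
            by (meson less_le_trans)
          then show ?thesis using False u k by (simp add: I3_def)
        qed
        have I3': "I3 (Suc j) u'" if "reg u' r_tmp = (j + 2) * i + i"
          "arr u' a_primes = (arr u a_primes)((j + 2) * i := 1)" for u'
          unfolding I3_def using upd that by (simp add: algebra_simps)
        have "reg u r_tmp = (j + 2) * i" using u by (simp add: I3_def)
        then show "bval \<alpha> u ?bi \<and> bsmall V u ?bi \<and> wp \<alpha> V ?ci (I3 (Suc j)) u"
          using u' le i V by (auto intro!: I3' simp del: add_2_eq_Suc')
      next
        fix u assume u: "I3 (S div i - 1) u" and fr: "frame (While ?bi ?ci) t1 u"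
        have u': "reg u r_root = S" using frame_reg[OF fr] t1 by auto
        have eq: "reg u r_tmp = S div i * i + i"
          using u div1 unfolding I3_def by (simp add: algebra_simps)
        moreover have "S = S div i * i + S mod i" by simp
        moreover have "S mod i < i" using i by simp
        ultimately have "S < reg u r_tmp" "reg u r_tmp \<le> 2 * S"
          using i div_times_less_eq_dividend[of S i] by linarith+
        then show "\<not> bval \<alpha> u ?bi \<and> bsmall V u ?bi" using u' V by auto
      qed
      fix u assume u: "I3 (S div i - 1) u" and fr: "frame (While ?bi ?ci) t1 u"
      have u': "reg u r_idx = i" using frame_reg[OF fr] t1 by auto
      have "S < (S div i - 1 + 2) * i"
      proof -
        have "S = S div i * i + S mod i" by simp
        moreover have "S mod i < i" using i(1) by simp
        moreover have "(S div i - 1 + 2) * i = S div i * i + i" using div1 by (simp add: algebra_simps)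
        ultimately show ?thesis by linarith
      qed
      then have "A u (Suc i)" using u i by (auto simp: A_def I3_def struck_Suc)
      then show "runs \<alpha> (incr r_idx) u (csize (incr r_idx) * ?K) (I2 (Suc k))"
        using u' i V by (intro runs_wp) (auto simp: I2_def A_def)
    qed
  qed
  let ?T = "\<lambda>k. csize ?ai * ?K + ((S div (k + 2) - 1 + 1) * csize (While ?bi ?ci) * ?K
      + csize (incr r_idx) * ?K)"
  let ?W = "(\<Sum>k<S-1. ?T k + 5 * ?K + 1) + 5 * ?K + 1"
  have "runs \<alpha> sieve s (csize (Assign r_idx (Num 1)) * ?K + ((S + 1) * csize (While ?b ?c) * ?K
      + (csize (Assign r_idx (Num 2)) * ?K + ?W))) (\<lambda>t. A t (Suc S))"
    unfolding sieve_def
  proof (rule runs_seq)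
    show "runs \<alpha> (Assign r_idx (Num 1)) s (csize (Assign r_idx (Num 1)) * ?K)
        (\<lambda>t. I1 0 t \<and> reg t r_root = S)"
      using s V by (intro runs_wp) (auto simp: I1_def)
    fix s1 assume s1: "I1 0 s1 \<and> reg s1 r_root = S"
    show "runs \<alpha> (While ?b ?c ;; Assign r_idx (Num 2) ;; While ?b ?d) s1
        ((S + 1) * csize (While ?b ?c) * ?K + (csize (Assign r_idx (Num 2)) * ?K + ?W)) (\<lambda>t. A t (Suc S))"
    proof (rule runs_seq)
      show "runs \<alpha> (While ?b ?c) s1 ((S + 1) * csize (While ?b ?c) * ?K) (I1 S)"
      proof (rule runs_for_small)
        show "I1 0 s1" using s1 by simp
      next
        fix k t assume k: "k < S" and t: "I1 k t" and fr: "frame (While ?b ?c) s1 t"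
        have "reg t r_root = S" using frame_reg[OF fr] s1 by auto
        then show "bval \<alpha> t ?b \<and> bsmall V t ?b \<and> wp \<alpha> V ?c (I1 (Suc k)) t"
          using k t V by (auto simp: I1_def)
      next
        fix t assume t: "I1 S t" and fr: "frame (While ?b ?c) s1 t"
        have "reg t r_root = S" using frame_reg[OF fr] s1 by auto
        then show "\<not> bval \<alpha> t ?b \<and> bsmall V t ?b" using t V by (auto simp: I1_def)
      qed
      fix s2 assume s2: "I1 S s2" and fr2: "frame (While ?b ?c) s1 s2"
      have root2: "reg s2 r_root = S" using frame_reg[OF fr2] s1 by auto
      show "runs \<alpha> (Assign r_idx (Num 2) ;; While ?b ?d) s2
          (csize (Assign r_idx (Num 2)) * ?K + ?W) (\<lambda>t. A t (Suc S))"
      proof (rule runs_seq)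
        show "runs \<alpha> (Assign r_idx (Num 2)) s2 (csize (Assign r_idx (Num 2)) * ?K)
            (\<lambda>t. I2 0 t \<and> reg t r_root = S)"
          using s2 root2 V by (intro runs_wp) (auto simp: I1_def I2_def A_def struck_def)
        fix s3 assume s3: "I2 0 s3 \<and> reg s3 r_root = S"
        have "runs \<alpha> (While ?b ?d) s3 ?W (I2 (S - 1))"
        proof (rule runs_for)
          show "I2 0 s3" using s3 by simp
        next
          fix k t assume k: "k < S - 1" and t: "I2 k t" and fr: "frame (While ?b ?d) s3 t"
          have root: "reg t r_root = S" using frame_reg[OF fr] s3 by auto
          have "bcost t ?b \<le> bsize ?b * ?K"
            using t root k V by (intro bcost_small) (auto simp: I2_def)
          then have "bcost t ?b \<le> 5 * ?K" by simp
          moreover have "runs \<alpha> ?d t (?T k) (I2 (Suc k))"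
            using k by (intro inner[OF refl _ t root]) simp
          ultimately show "bval \<alpha> t ?b \<and> bcost t ?b \<le> 5 * ?K \<and> runs \<alpha> ?d t (?T k) (I2 (Suc k))"
            using t root k by (auto simp: I2_def)
        next
          fix t assume t: "I2 (S - 1) t" and fr: "frame (While ?b ?d) s3 t"
          have root: "reg t r_root = S" using frame_reg[OF fr] s3 by auto
          have "bcost t ?b \<le> bsize ?b * ?K"
            using t root V by (intro bcost_small) (auto simp: I2_def)
          then show "\<not> bval \<alpha> t ?b \<and> bcost t ?b \<le> 5 * ?K" using t root s(2) by (auto simp: I2_def)
        qed
        then show "runs \<alpha> (While ?b ?d) s3 ?W (\<lambda>t. A t (Suc S))"
          by (rule runs_mono) (use s(2) in \<open>auto simp: I2_def\<close>)
      qed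
    qed
  qed
  then show ?thesis
  proof (rule runs_mono)
    have cs: "csize ?ai = 4" "csize (While ?bi ?ci) = 13" "csize (incr r_idx) = 4"
      "csize (While ?b ?c) = 13" "csize (Assign r_idx (Num 1)) = 2" "csize (Assign r_idx (Num 2)) = 2"
      by simp_all
    have K: "1 \<le> ?K" by (rule unit_cost_pos)
    have "(\<Sum>k<S-1. S div (k + 2)) = (\<Sum>i\<in>(\<lambda>k. k + 2) ` {..<S-1}. S div i)"
      by (subst sum.reindex) (auto simp: inj_on_def)
    also have "\<dots> \<le> (\<Sum>i=1..S. S div i)" by (rule sum_mono2) auto
    also have "\<dots> \<le> S * bitlen S" by (rule sum_div_le)
    also have "\<dots> \<le> S * bitlen V" using V by (intro mult_le_mono2 bitlen_mono) simp
    finally have div: "(\<Sum>k<S-1. S div (k + 2)) \<le> S * bitlen V" .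
    have Tk: "?T k + 5 * ?K + 1 \<le> (13 * (S div (k + 2)) + 30) * ?K" for k
    proof -
      have "(S div (k + 2) - 1 + 1) * 13 * ?K \<le> (S div (k + 2) + 1) * 13 * ?K"
        by (intro mult_le_mono1) simp
      also have "\<dots> = 13 * (S div (k + 2)) * ?K + 13 * ?K" by (simp add: algebra_simps)
      finally show ?thesis unfolding cs distrib_right using K by linarith
    qed
    have "(\<Sum>k<S-1. ?T k + 5 * ?K + 1) \<le> (\<Sum>k<S-1. (13 * (S div (k + 2)) + 30) * ?K)"
      by (intro sum_mono Tk)
    also have "\<dots> = (13 * (\<Sum>k<S-1. S div (k + 2)) + 30 * (S - 1)) * ?K"
      by (simp add: sum_distrib_right[symmetric] sum.distrib sum_distrib_left)
    also have "\<dots> \<le> (13 * (S * bitlen V) + 30 * S) * ?K"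
      using div by (intro mult_le_mono1 add_mono mult_le_mono2) auto
    finally have "csize (Assign r_idx (Num 1)) * ?K + ((S + 1) * csize (While ?b ?c) * ?K
      + (csize (Assign r_idx (Num 2)) * ?K + ?W))
      \<le> 2 * ?K + ((S + 1) * 13 * ?K + (2 * ?K + ((13 * (S * bitlen V) + 30 * S) * ?K + 5 * ?K + 1)))"
      unfolding cs by linarith
    also have "\<dots> \<le> (2 + (S + 1) * 13 + 2 + (13 * (S * bitlen V) + 30 * S) + 6) * ?K"
      using K by (simp only: distrib_right)
    also have "\<dots> \<le> 60 * ((S + 1) * (bitlen V + 1)) * ?K"
      by (intro mult_le_mono1) (simp add: algebra_simps)
    finally show "csize (Assign r_idx (Num 1)) * ?K + ((S + 1) * csize (While ?b ?c) * ?K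
      + (csize (Assign r_idx (Num 2)) * ?K + ?W)) \<le> 60 * ((S + 1) * (bitlen V + 1)) * ?K" .
    fix t assume t: "A t (Suc S)"
    have "arr t a_primes k = (if prime k then k else 1)" if k: "k \<in> {1..S}" for k
    proof (cases "k = 1")
      case True
      then show ?thesis using t k by (auto simp: A_def)
    next
      case False
      then show ?thesis using t k struck_iff_not_prime[of k S] by (auto simp: A_def)
    qed
    then show "\<forall>k\<in>{1..S}. arr t a_primes k = (if prime k then k else 1)" by blast
  qed
qed

text \<open>Among entries that are 1 or prime, \<open>p\<close> divides only those equal to
  \<open>p\<close>, so occurrences of a value are counts of divisibility.\<close>

lemma runs_count_primes:
  assumes s: "reg s r_len = len" "arr s a_pcount = (\<lambda>_. 0)"
    and A: "\<And>i. i < len \<Longrightarrow> arr s a_list i \<noteq> 1 \<Longrightarrow> prime (arr s a_list i)"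
      "\<And>i. i < len \<Longrightarrow> arr s a_list i \<le> V"
    and c: "\<And>p. prime p \<Longrightarrow> (\<Sum>i<len. of_bool (p dvd arr s a_list i)) = c p"
    and V: "len + 1 \<le> V" "2 \<le> V"
  shows "runs \<alpha> count_primes s (50 * (len + 1) * unit_cost V) (\<lambda>s'. prime (reg s' r_best) \<and>
    reg s' r_best \<le> V \<and> arr s' a_pcount (reg s' r_best) = c (reg s' r_best) \<and>
    (\<forall>p. prime p \<longrightarrow> c p \<le> c (reg s' r_best)))"
proof -
  let ?K = "unit_cost V" and ?L = "arr s a_list"
  let ?init = "Assign r_idx (Num 0) ;; Assign r_best (Num 2)"
  let ?b = "Less (Reg r_idx) (Reg r_len)"
  let ?c = "Assign r_tmp (Arr a_list (Reg r_idx)) ;;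
        Cond (Less (Num 1) (Reg r_tmp))
          (Store a_pcount (Reg r_tmp) (Arr a_pcount (Reg r_tmp) \<oplus> Num 1) ;;
           Cond (Less (Arr a_pcount (Reg r_best)) (Arr a_pcount (Reg r_tmp)))
             (Assign r_best (Reg r_tmp)) Skip)
          Skip ;;
        incr r_idx"
  define f where "f k v = (\<Sum>i<k. of_bool (?L i = v \<and> 1 < v) :: nat)" for k v :: nat
  define I where "I k t \<longleftrightarrow> reg t r_idx = k \<and> arr t a_pcount = f k \<and>
    (\<forall>v. f k v \<le> f k (reg t r_best)) \<and> prime (reg t r_best) \<and> reg t r_best \<le> V"
    for k and t :: state
  have fle: "f k v \<le> k" for k v
  proof -
    have "f k v \<le> (\<Sum>i<k. 1)" unfolding f_def by (rule sum_mono) auto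
    then show ?thesis by simp
  qed
  have "runs \<alpha> count_primes s (csize ?init * ?K + (len + 1) * csize (While ?b ?c) * ?K) (I len)"
    unfolding count_primes_def
  proof (rule runs_seq)
    have "f 0 = (\<lambda>_. 0)" by (auto simp: f_def)
    then show "runs \<alpha> ?init s (csize ?init * ?K) (I 0)"
      using s V by (intro runs_wp) (simp add: I_def)
    fix s1 assume I0: "I 0 s1" and fr1: "frame ?init s s1"
    have s1: "arr s1 a_list = ?L" "reg s1 r_len = len"
      using frame_arr[OF fr1] frame_reg[OF fr1] s by auto
    from I0 show "runs \<alpha> (While ?b ?c) s1 ((len + 1) * csize (While ?b ?c) * ?K) (I len)"
    proof (rule runs_for_small)
      fix k t assume k: "k < len" and t: "I k t" and fr: "frame (While ?b ?c) s1 t"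
      define y where "y = ?L k"
      have t': "arr t a_list k = y" "reg t r_len = len" "reg t r_idx = k" "arr t a_pcount = f k"
        "reg t r_best \<le> V"
        using s1 frame_arr[OF fr] frame_reg[OF fr] t by (auto simp: y_def I_def)
      have yV: "y \<le> V" using A(2)[OF k] by (simp add: y_def)
      have fV: "f k v \<le> V" "f k v + 1 \<le> V" for v using fle[of k v] k V(1) by auto
      have bt: "f k v \<le> f k (reg t r_best)" "prime (reg t r_best)" for v using t by (auto simp: I_def)
      have "wp \<alpha> V ?c (I (Suc k)) t"
      proof (cases "1 < y")
        case False
        then have "f (Suc k) = f k" by (auto simp: f_def y_def[symmetric])
        then have "I (Suc k) u" if "reg u r_idx = Suc k" "arr u a_pcount = f k"
          "reg u r_best = reg t r_best" for u
          using that bt t'(5) by (simp add: I_def)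
        then show ?thesis using t' False yV k V by simp
      next
        case True
        then have py: "prime y" using A(1)[OF k] by (auto simp: y_def)
        have f': "f (Suc k) = (f k)(y := Suc (f k y))"
          using True by (auto simp: f_def y_def[symmetric])
        define z where "z = (if ((f k)(y := Suc (f k y))) (reg t r_best) < Suc (f k y) then y
          else reg t r_best)"
        \<comment> \<open>Only the count of \<open>y\<close> has grown, so the maximum is attained
          at the old best value or at \<open>y\<close>.\<close>
        have "f (Suc k) v \<le> f (Suc k) z" for v
          using bt(1)[of v] bt(1)[of y] unfolding f' z_def by auto
        moreover have "prime z" "z \<le> V" using py bt(2) yV t'(5) by (auto simp: z_def)
        ultimately have I': "I (Suc k) u" if "reg u r_idx = Suc k"
          "arr u a_pcount = (f k)(y := Suc (f k y))" "reg u r_best = z" for u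
          using that unfolding I_def f' by simp
        show ?thesis
          using t' True yV k V fV fV[of y] by (simp add: I' z_def)
      qed
      then show "bval \<alpha> t ?b \<and> bsmall V t ?b \<and> wp \<alpha> V ?c (I (Suc k)) t"
        using t' k V by simp
    next
      fix t assume t: "I len t" and fr: "frame (While ?b ?c) s1 t"
      have "reg t r_len = len" using s1 frame_reg[OF fr] by auto
      then show "\<not> bval \<alpha> t ?b \<and> bsmall V t ?b" using t V by (simp add: I_def)
    qed
  qed
  then show ?thesis
  proof (rule runs_mono)
    have cs: "csize ?init = 4" "csize (While ?b ?c) \<le> 40" by simp_all
    have "(len + 1) * csize (While ?b ?c) * ?K \<le> (len + 1) * 40 * ?K"
      by (intro mult_le_mono1 mult_le_mono2 cs)
    then have "csize ?init * ?K + (len + 1) * csize (While ?b ?c) * ?K \<le> 4 * ?K + (len + 1) * 40 * ?K"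
      unfolding cs(1) by (rule add_left_mono)
    also have "\<dots> \<le> 50 * (len + 1) * ?K" by (simp add: algebra_simps)
    finally show "csize ?init * ?K + (len + 1) * csize (While ?b ?c) * ?K \<le> 50 * (len + 1) * ?K" .
    fix t assume t: "I len t"
    have "f len p = c p" if p: "prime p" for p
    proof -
      have "f len p = (\<Sum>i<len. of_bool (p dvd ?L i))"
        unfolding f_def
      proof (rule sum.cong)
        fix i assume "i \<in> {..<len}"
        then have "?L i = 1 \<or> prime (?L i)" using A(1) by auto
        then have "?L i = p \<and> 1 < p \<longleftrightarrow> p dvd ?L i"
          using p primes_dvd_imp_eq[OF p] prime_gt_1_nat[OF p] by auto
        then show "of_bool (?L i = p \<and> 1 < p) = of_bool (p dvd ?L i)" by simp
      qed simp
      then show ?thesis using c[OF p] by simp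
    qed
    then show "prime (reg t r_best) \<and> reg t r_best \<le> V \<and>
      arr t a_pcount (reg t r_best) = c (reg t r_best) \<and>
      (\<forall>p. prime p \<longrightarrow> c p \<le> c (reg t r_best))"
      using t unfolding I_def by metis
  qed
qed

section \<open>Correctness and running time\<close>

text \<open>The positive denominator is cleared, which leaves natural numbers on which
  \<open>decide\<close> can compute. The subtraction is exact, as the multiples form a
  submultiset.\<close>

lemma almost_divisor_iff:
  assumes "X \<noteq> {#}"
  shows "almost_divisor \<alpha> X d \<longleftrightarrow> d > 1 \<and>
    real ((size X - size (filter_mset (\<lambda>x. d dvd x) X)) * (size X * size X))
      \<le> \<alpha> * real (max_mult X * sum_mset X)"
proof -
  have n: "0 < real (size X)" using assms by (simp add: nonempty_has_size[symmetric])
  have "size (nonmultiples X d) = size X - size (filter_mset (\<lambda>x. d dvd x) X)"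
    by (simp add: nonmultiples_def multiples_def size_Diff_submset)
  then show ?thesis
    using n by (simp add: almost_divisor_def power2_eq_square pos_le_divide_eq mult.assoc)
qed

text \<open>The right side of the inequality does not depend on the divisor, so if any divisor
  passes, one with the most multiples does. A prime factor of an almost divisor has at least as many
  multiples, and \<open>p\<close> beats all primes.\<close>

lemma finds_almost_divisor_if_best:
  assumes X: "X \<noteq> {#}" and p: "prime p"
    and best: "\<And>q. prime q \<Longrightarrow>
      size (filter_mset (\<lambda>x. q dvd x) X) \<le> size (filter_mset (\<lambda>x. p dvd x) X)"
    and test: "if almost_divisor \<alpha> X p then reg s 0 = 1 else reg s 0 = 0" and out: "reg s 1 = p"
  shows "finds_almost_divisor \<alpha> X s"
proof -
  have "almost_divisor \<alpha> X p" if d: "almost_divisor \<alpha> X d" for d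
  proof -
    have "d \<noteq> 1" using d by (simp add: almost_divisor_def)
    then obtain q where q: "prime q" "q dvd d" using prime_factor_nat by blast
    have "size (filter_mset (\<lambda>x. d dvd x) X) \<le> size (filter_mset (\<lambda>x. q dvd x) X)"
      using q(2) by (intro size_mset_mono filter_mset_mono_strong) (auto intro: dvd_trans)
    also have "\<dots> \<le> size (filter_mset (\<lambda>x. p dvd x) X)" by (rule best[OF q(1)])
    finally have "real ((size X - size (filter_mset (\<lambda>x. p dvd x) X)) * (size X * size X))
        \<le> real ((size X - size (filter_mset (\<lambda>x. d dvd x) X)) * (size X * size X))"
      by (intro of_nat_mono mult_le_mono1) simp
    then show ?thesis
      using d prime_gt_1_nat[OF p] unfolding almost_divisor_iff[OF X] by linarith
  qed
  then show ?thesis using test out unfolding finds_almost_divisor_def by metis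
qed

lemma sum_of_bool_dvd_nth:
  "(\<Sum>i<length xs. of_bool (p dvd xs ! i)) = size (filter_mset (\<lambda>x. p dvd x) (mset xs))"
proof -
  have "(\<Sum>i<length xs. of_bool (p dvd xs ! i)) = card {i. i < length xs \<and> p dvd xs ! i}"
    by (simp add: sum_of_bool_eq) (metis (no_types) lessThan_def Collect_conj_eq)
  also have "\<dots> = length (filter (\<lambda>x. p dvd x) xs)" by (simp add: length_filter_conv_card)
  also have "\<dots> = size (filter_mset (\<lambda>x. p dvd x) (mset xs))"
    by (metis mset_filter size_mset)
  finally show ?thesis .
qed

text \<open>With \<open>N = n + S\<close>, the most demanding requirement on \<open>V\<close> is
  \<open>8 * (E * bitlen M) + 1\<close>; here \<open>E <= N ^ 3\<close> and
  \<open>bitlen M <= M <= N ^ 2\<close>, which gives the fifth power, and 16 absorbs the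
  coefficients. Estimates this crude are harmless, because only \<open>bitlen V\<close> is paid
  for.\<close>

lemma runs_almost_divisor_prog:
  fixes xs :: "nat list"
  defines "n \<equiv> length xs" and "M \<equiv> Max (set xs)"
  assumes xs: "xs \<noteq> []" "\<forall>x\<in>set xs. 0 < x"
    and S: "M \<le> S * S" "\<And>k. k < S \<Longrightarrow> k * k < M"
    and W: "W = n * bitlen M" and E: "E = W + S" and V: "V = 16 * (n + S) ^ 5"
  shows "runs \<alpha> almost_divisor_prog (input_state xs) (2000 * (E * bitlen V ^ 3) * unit_cost V)
    (finds_almost_divisor \<alpha> (mset xs))"
proof -
  let ?K = "unit_cost V" and ?X = "mset xs" and ?s = "input_state xs"
  let ?\<beta> = "bitlen V"
  define c where "c p = size (filter_mset (\<lambda>x. p dvd x) ?X)" for p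
  define N where "N = n + S"
  have n1: "1 \<le> n" using xs by (simp add: n_def Suc_le_eq)
  have M: "x \<le> M" if "x \<in> set xs" for x using that by (simp add: M_def)
  have Mmem: "M \<in> set xs" using xs by (simp add: M_def)
  then have M1: "1 \<le> M" using xs by (simp add: Suc_le_eq)
  have S1: "1 \<le> S" using S(1) M1 by (cases S) auto
  \<comment> \<open>Lets \<open>M\<close> bound the leaves of the prime tree as well as those of the
    list tree.\<close>
  have SM: "S \<le> M"
  proof (cases "S = 1")
    case False
    have "(S - 1) * (S - 1) < M" using S(2)[of "S - 1"] S1 by simp
    moreover have "S - 1 \<le> (S - 1) * (S - 1)" using False S1 by (cases "S - 1") auto
    ultimately show ?thesis by linarith
  qed (use M1 in simp)
  have N: "2 \<le> N" "n \<le> N" "S \<le> N" using n1 S1 by (auto simp: N_def)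
  have MN: "M \<le> N ^ 2"
    using S(1) N(3) mult_le_mono[of S N S N] by (simp add: power2_eq_square)
  have pow: "N ^ j \<le> N ^ 5" if "j \<le> 5" for j using N that by (intro power_increasing) auto
  have V': "V = 16 * N ^ 5" by (simp add: V N_def)
  have N5: "1 \<le> N ^ 5" using N by simp
  have E3: "E \<le> N ^ 3"
  proof -
    have "E \<le> n * N ^ 2 + S * N ^ 2" unfolding E W
      using MN bitlen_le_self[of M] N by (intro add_mono mult_le_mono) auto
    also have "\<dots> = N ^ 3" by (simp add: N_def power3_eq_cube power2_eq_square algebra_simps)
    finally show ?thesis .
  qed
  have EM: "E * bitlen M \<le> N ^ 5"
  proof -
    have "E * bitlen M \<le> N ^ 3 * N ^ 2"
      using E3 MN bitlen_le_self[of M] by (intro mult_le_mono) auto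
    then show ?thesis by (simp add: power_add[symmetric])
  qed
  have MM: "M * M \<le> N ^ 4" using mult_le_mono[OF MN MN] by (simp add: power_add[symmetric])
  have nM: "n * M \<le> N ^ 3"
    using mult_le_mono[OF N(2) MN] by (simp add: power3_eq_cube power2_eq_square)
  have nnM: "n * (n * M) \<le> N ^ 4"
    using mult_le_mono[OF N(2) nM] by (simp add: power_Suc[symmetric] del: power_Suc)
  have SS: "S * S \<le> N ^ 2" using N(3) by (simp add: power2_eq_square mult_le_mono)
  have nnn: "n * (n * n) \<le> N ^ 3"
    using N(2) by (simp add: power3_eq_cube mult.assoc mult_le_mono)
  have VE: "2 * M \<le> V" "M * M \<le> V" "2 * E + 2 \<le> V" "8 * (E * bitlen M) + 1 \<le> V"
    "n * M \<le> V" "n * (n * M) \<le> V" "S * S \<le> V" "n * (n * n) \<le> V" "M \<le> V" "N \<le> N ^ 5"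
    using MN MM E3 EM nM nnM SS nnn pow[of 1] pow[of 2] pow[of 3] pow[of 4] N5 unfolding V'
    by simp_all
  have VN: "n + 1 \<le> V" "S + 1 \<le> V" "2 * S + 2 \<le> V" "2 \<le> V"
    using VE(10) N unfolding V' by simp_all
  have nW: "n \<le> W" unfolding W using bitlen_pos[of M] M1 by (cases "bitlen M") auto
  have fac: "factors c W M (\<lambda>i. if i < n then xs ! i else 0) n"
  proof -
    have "(\<Sum>i<n. weight (xs ! i)) \<le> (\<Sum>i<n. bitlen M)"
    proof (rule sum_mono)
      fix i assume "i \<in> {..<n}"
      then have "xs ! i \<le> M" using M by (simp add: n_def)
      from weight_mono[OF this] show "weight (xs ! i) \<le> bitlen M"
        using bitlen_pos[of M] M1 by (simp add: weight_def)
    qed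
    then show ?thesis
      using xs(2) M sum_of_bool_dvd_nth[where xs = xs]
      by (auto simp: factors_def W c_def n_def)
  qed
  let ?T = "50 * (n + 1) * ?K + (20 * (S + 1) * ?K + (60 * ((S + 1) * (?\<beta> + 1)) * ?K
      + (660 * (E * ?\<beta> ^ 3) * ?K + (50 * (W + 1) * ?K + csize decide * ?K))))"
  have "runs \<alpha> almost_divisor_prog ?s ?T (finds_almost_divisor \<alpha> ?X)"
    unfolding almost_divisor_prog_def
  proof (rule runs_seq)
    let ?P1 = "\<lambda>t. reg t r_size = n \<and> reg t r_sum = sum_list xs \<and> reg t r_mult = max_mult ?X \<and>
      reg t r_max = M"
    show "runs \<alpha> scan ?s (50 * (n + 1) * ?K) ?P1"
      unfolding n_def M_def
      by (rule runs_scan[where M = M])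
        (use xs M VE VN in \<open>auto simp: input_state_def n_def\<close>)
    fix s1 assume s1: "?P1 s1" and fr1: "frame scan ?s s1"
    have s1': "reg s1 r_root = 0" "reg s1 r_len = n"
      "arr s1 a_list = (\<lambda>i. if i < n then xs ! i else 0)" "arr s1 a_pcount = (\<lambda>_. 0)"
      using frame_reg[OF fr1] frame_arr[OF fr1]
      by (simp_all add: scan_def input_state_def n_def)
    show "runs \<alpha> (find_root ;; sieve ;; factor_list ;; count_primes ;; decide) s1
      (20 * (S + 1) * ?K + (60 * ((S + 1) * (?\<beta> + 1)) * ?K
      + (660 * (E * ?\<beta> ^ 3) * ?K + (50 * (W + 1) * ?K + csize decide * ?K))))
      (finds_almost_divisor \<alpha> ?X)"
    proof (rule runs_seq)
      show "runs \<alpha> find_root s1 (20 * (S + 1) * ?K) (\<lambda>t. reg t r_root = S)"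
        using s1 s1' S VE VN by (intro runs_find_root[where M = M]) auto
      fix s2 assume s2: "reg s2 r_root = S" and fr2: "frame find_root s1 s2"
      have s2': "?P1 s2" "reg s2 r_len = n"
        "arr s2 a_list = (\<lambda>i. if i < n then xs ! i else 0)" "arr s2 a_pcount = (\<lambda>_. 0)"
        using s1 s1' frame_reg[OF fr2] frame_arr[OF fr2] by (simp_all add: find_root_def)
      show "runs \<alpha> (sieve ;; factor_list ;; count_primes ;; decide) s2
        (60 * ((S + 1) * (?\<beta> + 1)) * ?K
        + (660 * (E * ?\<beta> ^ 3) * ?K + (50 * (W + 1) * ?K + csize decide * ?K)))
        (finds_almost_divisor \<alpha> ?X)"
      proof (rule runs_seq)
        let ?P3 = "\<lambda>t. \<forall>k\<in>{1..S}. arr t a_primes k = (if prime k then k else 1)"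
        show "runs \<alpha> sieve s2 (60 * ((S + 1) * (?\<beta> + 1)) * ?K) ?P3"
          using s2 S1 VN by (intro runs_sieve) auto
        fix s3 assume s3: "?P3 s3" and fr3: "frame sieve s2 s3"
        have s3': "?P1 s3" "reg s3 r_len = n" "reg s3 r_root = S"
          "arr s3 a_list = (\<lambda>i. if i < n then xs ! i else 0)" "arr s3 a_pcount = (\<lambda>_. 0)"
          using s2 s2' frame_reg[OF fr3] frame_arr[OF fr3] by (simp_all add: sieve_def)
        show "runs \<alpha> (factor_list ;; count_primes ;; decide) s3
          (660 * (E * ?\<beta> ^ 3) * ?K + (50 * (W + 1) * ?K + csize decide * ?K))
          (finds_almost_divisor \<alpha> ?X)"
        proof (rule runs_seq)
          let ?P4 = "\<lambda>t. factors c W M (arr t a_list) (reg t r_len) \<and>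
            (\<forall>i<reg t r_len. separated S (bitlen S) (arr t a_list i))"
          show "runs \<alpha> factor_list s3 (660 * (E * ?\<beta> ^ 3) * ?K) ?P4"
            using s3 s3' fac n1 S1 SM VE(1-4)
            by (intro runs_factor_list) (auto simp: E)
          fix s4 assume s4: "?P4 s4" and fr4: "frame factor_list s3 s4"
          have s4': "?P1 s4" "arr s4 a_pcount = (\<lambda>_. 0)"
            using s3' frame_reg[OF fr4] frame_arr[OF fr4]
            by (simp_all add: factor_list_def stage_def block_writes)
          have fac4: "factors c W M (arr s4 a_list) (reg s4 r_len)" using s4 by simp
          have len: "reg s4 r_len \<le> W" using factors_length[OF fac4] .
          have pr: "prime (arr s4 a_list i)" if i: "i < reg s4 r_len" "arr s4 a_list i \<noteq> 1" for i
          proof (rule separated_imp_prime)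
            show "separated S (bitlen S) (arr s4 a_list i)" using s4 i by simp
            show "S < 2 ^ bitlen S" by (rule less_two_power_bitlen)
            have "arr s4 a_list i \<le> M" using fac4 i by (simp add: factors_def)
            then show "arr s4 a_list i \<le> S\<^sup>2" using S(1) by (simp add: power2_eq_square)
          qed (rule i)
          show "runs \<alpha> (count_primes ;; decide) s4 (50 * (W + 1) * ?K + csize decide * ?K)
            (finds_almost_divisor \<alpha> ?X)"
          proof (rule runs_seq)
            let ?P5 = "\<lambda>t. prime (reg t r_best) \<and> reg t r_best \<le> V \<and>
              arr t a_pcount (reg t r_best) = c (reg t r_best) \<and>
              (\<forall>p. prime p \<longrightarrow> c p \<le> c (reg t r_best))"
            have "runs \<alpha> count_primes s4 (50 * (reg s4 r_len + 1) * ?K) ?P5"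
            proof (rule runs_count_primes)
              show "arr s4 a_list i \<le> V" if "i < reg s4 r_len" for i
                using fac4 that VE(9) by (auto simp: factors_def intro: le_trans)
              show "reg s4 r_len + 1 \<le> V" using len VE(3) by (simp add: E)
            qed (use s4'(2) pr fac4 VN in \<open>auto simp: factors_def\<close>)
            then show "runs \<alpha> count_primes s4 (50 * (W + 1) * ?K) ?P5"
              by (rule runs_mono) (use len in auto)
            fix s5 assume s5: "?P5 s5" and fr5: "frame count_primes s4 s5"
            define p where "p = reg s5 r_best"
            have s5': "?P1 s5" using s4' frame_reg[OF fr5] by (simp add: count_primes_def)
            have p: "prime p" "p \<le> V" "arr s5 a_pcount p = c p" "\<And>q. prime q \<Longrightarrow> c q \<le> c p"
              using s5 by (auto simp: p_def)
            have cn: "c p \<le> n"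
              unfolding c_def n_def using size_mset_mono[OF multiset_filter_subset] by (metis size_mset)
            have sum: "sum_list xs \<le> n * M"
              unfolding n_def using M by (intro sum_list_le) auto
            have mult: "max_mult ?X \<le> n"
              unfolding max_mult_def n_def
              using xs(1) count_le_size[of ?X] by (subst Max_le_iff) auto
            have small: "(n - c p) * (n * n) \<le> V" "n * n \<le> V" "max_mult ?X * sum_list xs \<le> V"
              "n \<le> V" "c p \<le> V" "sum_list xs \<le> V" "max_mult ?X \<le> V"
            proof -
              have "(n - c p) * (n * n) \<le> n * (n * n)" by (intro mult_le_mono1) simp
              then show "(n - c p) * (n * n) \<le> V" using VE(8) by linarith
              have "1 * (n * n) \<le> n * (n * n)" using n1 by (intro mult_le_mono1)
              then show "n * n \<le> V" using VE(8) by linarith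
              have "max_mult ?X * sum_list xs \<le> n * (n * M)" using mult sum by (intro mult_le_mono)
              then show "max_mult ?X * sum_list xs \<le> V" using VE(6) by linarith
              show "n \<le> V" "c p \<le> V" "sum_list xs \<le> V" "max_mult ?X \<le> V"
                using VN(1) cn sum mult VE(5) by linarith+
            qed
            have iff: "almost_divisor \<alpha> ?X p \<longleftrightarrow>
                real ((n - c p) * (n * n)) \<le> \<alpha> * real (max_mult ?X * sum_list xs)"
              using almost_divisor_iff[of ?X \<alpha> p] xs(1) prime_gt_1_nat[OF p(1)]
              by (simp add: c_def n_def sum_mset_sum_list)
            have fin: "finds_almost_divisor \<alpha> ?X u"
              if "reg u r_len = (if almost_divisor \<alpha> ?X p then 1 else 0)" "reg u r_best = p" for u
              using xs(1) p(1,4) that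
              by (intro finds_almost_divisor_if_best[where p = p]) (auto simp: c_def)
            have "wp \<alpha> V decide (finds_almost_divisor \<alpha> ?X) s5"
              using s5' p(2,3) small VN(4) iff p_def[symmetric] unfolding decide_def
              by (simp add: fin)
            then show "runs \<alpha> decide s5 (csize decide * ?K) (finds_almost_divisor \<alpha> ?X)"
              by (rule runs_wp)
          qed
        qed
      qed
    qed
  qed
  then show ?thesis
  proof (rule runs_mono)
    have \<beta>: "1 \<le> ?\<beta>" using bitlen_pos[of V] VN by simp
    define g where "g = E * ?\<beta> ^ 3"
    have E1: "1 \<le> E" "n \<le> E" "S \<le> E" "W \<le> E" using S1 nW by (auto simp: E)
    have "E * 1 \<le> g" unfolding g_def using \<beta> by (intro mult_le_mono2) simp
    moreover have "E * ?\<beta> \<le> g" unfolding g_def using \<beta> by (intro mult_le_mono2 self_le_power) auto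
    moreover have "(S + 1) * (?\<beta> + 1) \<le> (2 * E) * (2 * ?\<beta>)"
      using E1 \<beta> by (intro mult_le_mono) auto
    moreover have "csize decide \<le> 20" by (simp add: decide_def)
    moreover have "(2 * E) * (2 * ?\<beta>) = 4 * (E * ?\<beta>)" by simp
    ultimately have g: "E \<le> g" "(S + 1) * (?\<beta> + 1) \<le> 4 * g" "csize decide \<le> 20" by linarith+
    have "50 * (n + 1) + (20 * (S + 1) + (60 * h + (660 * g + (50 * (W + 1) + d)))) \<le> 2000 * g"
      if "h \<le> 4 * g" "d \<le> 20" for h d :: nat
    proof -
      have "n \<le> g" "S \<le> g" "W \<le> g" "1 \<le> g" using g(1) E1 by simp_all
      then show ?thesis using that by simp
    qed
    from mult_le_mono1[OF this[OF g(2,3)], of ?K]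
    show "?T \<le> 2000 * (E * ?\<beta> ^ 3) * ?K" unfolding g_def[symmetric] by (simp only: distrib_right)
  qed
qed

text \<open>Six logarithms arise: one from \<open>E <= (n + S) * \<beta>\<close>, three from
  \<open>\<beta> ^ 3\<close> and two from \<open>unit_cost V <= 16 * \<beta> ^ 2\<close>. The
  constant is \<open>2000 * 16\<close>, doubled by \<open>n + S <= 2 * Z\<close>, times the sixth
  power of 15 from \<open>\<beta> <= 15 * l\<close>.\<close>

theorem theorem4p10:
  shows "\<exists>(prog :: com) (C :: real) (k :: nat).
    \<forall>(\<alpha> :: real) (X :: nat multiset) (xs :: nat list).
      \<alpha> > 0 \<and> X \<noteq> {#} \<and> (\<forall>x \<in># X. x > 0) \<and> mset xs = X \<longrightarrow>
      (\<exists>t s. exec \<alpha> prog (input_state xs) t s \<and>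
             finds_almost_divisor \<alpha> X s \<and>
             real t \<le> C * (real (size X) + sqrt (real (Max_mset X)))
                        * log 2 (real (size X) + sqrt (real (Max_mset X))) ^ k)"
proof (rule exI[of _ almost_divisor_prog], rule exI[of _ "64000 * 15 ^ 6"], rule exI[of _ 6],
    intro allI impI)
  fix \<alpha> :: real and X :: "nat multiset" and xs :: "nat list"
  assume "\<alpha> > 0 \<and> X \<noteq> {#} \<and> (\<forall>x \<in># X. x > 0) \<and> mset xs = X"
  then have X: "X = mset xs" and xs: "xs \<noteq> []" "\<forall>x\<in>set xs. 0 < x" by auto
  define n M where "n = length xs" and "M = Max (set xs)"
  define S where "S = (LEAST S. M \<le> S * S)"
  have "M \<in> set xs" using xs by (simp add: M_def)
  then have M1: "1 \<le> M" using xs by (simp add: Suc_le_eq)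
  then have "M \<le> M * M" by simp
  then have S: "M \<le> S * S" unfolding S_def by (rule LeastI)
  have S_least: "k * k < M" if "k < S" for k
    using not_less_Least[of k "\<lambda>S. M \<le> S * S"] that by (simp add: S_def)
  have n1: "1 \<le> n" using xs by (simp add: n_def Suc_le_eq)
  have S1: "1 \<le> S" using S M1 by (cases S) auto
  define E V where "E = n * bitlen M + S" and "V = 16 * (n + S) ^ 5"
  define \<beta> where "\<beta> = bitlen V"
  obtain t s where run: "exec \<alpha> almost_divisor_prog (input_state xs) t s"
    "t \<le> 2000 * (E * \<beta> ^ 3) * unit_cost V" "finds_almost_divisor \<alpha> X s"
    using runs_almost_divisor_prog[OF xs, folded n_def M_def, OF S S_least refl E_def V_def]
    unfolding runs_def X \<beta>_def by blast
  define Z l where "Z = real n + sqrt (real M)" and "l = log 2 Z"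
  have N1: "1 \<le> n + S" using n1 by simp
  then have "V > 0" by (auto simp: V_def Suc_le_eq)
  then have \<beta>1: "1 \<le> \<beta>" using bitlen_pos[of V] by (simp add: \<beta>_def)
  have "M \<le> V"
  proof -
    have "M \<le> (n + S) ^ 2" using S mult_le_mono[of S "n + S" S "n + S"] by (simp add: power2_eq_square)
    also have "\<dots> \<le> (n + S) ^ 5" using N1 by (intro power_increasing) auto
    finally show ?thesis by (simp add: V_def)
  qed
  then have "E \<le> n * \<beta> + S * \<beta>"
    unfolding E_def \<beta>_def using \<beta>1[unfolded \<beta>_def] by (intro add_mono mult_le_mono2 bitlen_mono) auto
  then have E: "E \<le> (n + S) * \<beta>" by (simp add: algebra_simps)
  have "unit_cost V \<le> (4 * \<beta>)\<^sup>2"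
    unfolding unit_cost_def \<beta>_def[symmetric] using \<beta>1 by (intro power_mono) auto
  then have K: "unit_cost V \<le> 16 * \<beta>\<^sup>2" by (simp add: power_mult_distrib)
  have "t \<le> 2000 * (((n + S) * \<beta>) * \<beta> ^ 3) * (16 * \<beta>\<^sup>2)"
    using run(2) mult_le_mono[OF mult_le_mono2[OF mult_le_mono1[OF E, of "\<beta> ^ 3"], of 2000] K]
    by linarith
  also have "\<dots> = 32000 * (n + S) * (\<beta> * \<beta> ^ 3 * \<beta>\<^sup>2)" by simp
  also have "\<beta> * \<beta> ^ 3 * \<beta>\<^sup>2 = \<beta> ^ 6" by (simp add: eval_nat_numeral)
  finally have "real t \<le> real (32000 * (n + S) * \<beta> ^ 6)" by (rule of_nat_mono)
  then have t: "real t \<le> 32000 * real (n + S) * real \<beta> ^ 6" by simp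
  have "1 \<le> sqrt (real M)" using M1 by simp
  moreover have "1 \<le> real n" using n1 by simp
  ultimately have Z2: "2 \<le> Z" unfolding Z_def by linarith
  have "real (S - 1) < sqrt (real M)"
  proof (rule real_less_rsqrt)
    have "(S - 1) * (S - 1) < M" using S_least[of "S - 1"] S1 by simp
    then have "real ((S - 1) * (S - 1)) < real M" by (simp only: of_nat_less_iff)
    then show "(real (S - 1))\<^sup>2 < real M" by (simp add: power2_eq_square)
  qed
  then have "real S \<le> sqrt (real M) + 1" using S1 by (simp add: of_nat_diff)
  then have NZ: "real (n + S) \<le> 2 * Z" using Z2 by (simp add: Z_def)
  \<comment> \<open>The input is nonempty with positive elements, so \<open>Z\<close> is at least 2;
    hence additive constants can be absorbed into \<open>l\<close>.\<close>
  have l1: "1 \<le> l" using Z2 log_mono[of 2 2 Z] by (simp add: l_def)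
  have "real \<beta> \<le> log 2 (real V) + 1"
  proof -
    have "1 \<le> real V" using \<open>V > 0\<close> by linarith
    then have "0 \<le> log 2 (real V)" by simp
    then show ?thesis using \<open>V > 0\<close> by (simp add: \<beta>_def floorlog_def)
  qed
  also have "log 2 (real V) = log 2 16 + 5 * log 2 (real (n + S))"
    using N1 by (simp add: V_def log_mult log_nat_power)
  also have "log 2 16 = (4 :: real)" using log_pow_cancel[of 2 4] by simp
  also have "log 2 (real (n + S)) \<le> log 2 (2 * Z)" using NZ N1 by (intro log_mono) auto
  also have "log 2 (2 * Z) = 1 + l" using Z2 by (simp add: l_def log_mult)
  \<comment> \<open>The bound reached is \<open>4 + 5 * (1 + l) + 1 = 10 + 5 * l\<close>.\<close>
  finally have \<beta>l: "real \<beta> \<le> 15 * l" using l1 by simp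
  have "32000 * real (n + S) * real \<beta> ^ 6 \<le> 32000 * (2 * Z) * (15 * l) ^ 6"
    using NZ \<beta>l Z2 by (intro mult_mono power_mono) auto
  also have "\<dots> = (64000 * 15 ^ 6) * Z * l ^ 6" by (simp add: power_mult_distrib)
  finally have "real t \<le> (64000 * 15 ^ 6) * Z * l ^ 6" using t by linarith
  moreover have "Z = real (size X) + sqrt (real (Max_mset X))" by (simp add: Z_def X n_def M_def)
  ultimately show "\<exists>t s. exec \<alpha> almost_divisor_prog (input_state xs) t s \<and> finds_almost_divisor \<alpha> X s \<and>
     real t \<le> (64000 * 15 ^ 6) * (real (size X) + sqrt (real (Max_mset X)))
                        * log 2 (real (size X) + sqrt (real (Max_mset X))) ^ 6"
    using run unfolding l_def by blast
qed

end
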